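(* Let $(U,P)$ be a suitable weak solution of the stationary Navier--Stokes equations in $\mathbb R^5$ satisfying $$\mathfrak M(U,P):=\sup_{R>0}R^{-2}\int_{B_R}|U|^3\,dx+\sup_{R>0}R^{-2}\int_{B_R}|P|^{3/2}\,dx<\infty .$$ If $(U,P)$ has the renormalized head-pressure property (RHP) in $\mathbb R^5\setminus\{0\}$, then $$H:=\frac{|U|^2}{2}+P\le0\quad\text{almost everywhere in }\mathbb R^5 .$$
   Context: $B_R\subset\mathbb R^5$ is the open ball of radius $R$ centered at the origin. A pair $(U,P)$ is a suitable weak solution of the stationary Navier--Stokes equations in an open set $G\subset\mathbb R^5$ if $U\in H^1_{\rm loc}(G;\mathbb R^5)$, $P\in L^{3/2}_{\rm loc}(G)$, the equations $-\Delta U+\operatorname{div}(U\otimes U)+\nabla P=0$, $\operatorname{div}U=0$ hold in $\mathcal D'(G)$, and for every nonnegative $\phi\in C_c^\infty(G)$ $$\int_G|\nabla U|^2\phi\,dx\le\int_G\frac{|U|^2}{2}\Delta\phi\,dx+\int_G\Bigl(\frac{|U|^2}{2}+P\Bigr)U\cdot\nabla\phi\,dx .$$ Let $H:=\frac{|U|^2}{2}+P$, $H_+:=\max(H,0)$ and $W:=H_+^{3/4}$. The pair $(U,P)$ has the renormalized head-pressure property (RHP) in an open set $G$ if $W\in H^1_{\rm loc}(G)$ and $$\operatorname{div}\Bigl(\frac43W\nabla W-\frac23UW^2\Bigr)\ge\frac89|\nabla W|^2\quad\text{in }\mathcal D'(G),$$ i.e. when tested against nonnegative functions in $C_c^\infty(G)$.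 *)

theory Defs
  imports "HOL-Analysis.Analysis"
begin

section \<open>Test functions\<close>

definition partial_deriv :: "'n \<Rightarrow> (real ^ 'n \<Rightarrow> real) \<Rightarrow> real ^ 'n \<Rightarrow> real" where
  "partial_deriv i f x = frechet_derivative f (at x) (axis i 1)"

definition grad :: "(real ^ 'n \<Rightarrow> real) \<Rightarrow> real ^ 'n \<Rightarrow> real ^ 'n" where
  "grad f x = (\<chi> i. partial_deriv i f x)"

definition laplacian :: "(real ^ 'n \<Rightarrow> real) \<Rightarrow> real ^ 'n \<Rightarrow> real" where
  "laplacian f x = (\<Sum>i\<in>UNIV. partial_deriv i (partial_deriv i f) x)"

fun C_k :: "nat \<Rightarrow> (real ^ 'n \<Rightarrow> real) \<Rightarrow> bool" where
  "C_k 0 f \<longleftrightarrow> continuous_on UNIV f"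
| "C_k (Suc k) f \<longleftrightarrow> f differentiable_on UNIV \<and> (\<forall>i. C_k k (partial_deriv i f))"

text \<open>Elements of \<open>C\<^sub>c\<^sup>\<infinity>(G)\<close> are represented by their extensions by zero to the whole space.\<close>

definition test_fun :: "(real ^ 'n) set \<Rightarrow> (real ^ 'n \<Rightarrow> real) \<Rightarrow> bool" where
  "test_fun G \<phi> \<longleftrightarrow> (\<forall>k. C_k k \<phi>) \<and>
     compact (closure {x. \<phi> x \<noteq> 0}) \<and> closure {x. \<phi> x \<noteq> 0} \<subseteq> G"

section \<open>Distributional derivatives\<close>

text \<open>Pairings with \<open>\<phi>\<close> of the distributions on \<open>G\<close> obtained by differentiating the regular
  distribution of a locally integrable function (or vector field).\<close>

definition dist_partial ::
  "(real ^ 'n) set \<Rightarrow> 'n \<Rightarrow> (real ^ 'n \<Rightarrow> real) \<Rightarrow> (real ^ 'n \<Rightarrow> real) \<Rightarrow> real" where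
  "dist_partial G i f \<phi> = - (LINT x:G|lebesgue. f x * partial_deriv i \<phi> x)"

definition dist_div ::
  "(real ^ 'n) set \<Rightarrow> (real ^ 'n \<Rightarrow> real ^ 'n) \<Rightarrow> (real ^ 'n \<Rightarrow> real) \<Rightarrow> real" where
  "dist_div G F \<phi> = - (LINT x:G|lebesgue. F x \<bullet> grad \<phi> x)"

definition dist_laplacian ::
  "(real ^ 'n) set \<Rightarrow> (real ^ 'n \<Rightarrow> real) \<Rightarrow> (real ^ 'n \<Rightarrow> real) \<Rightarrow> real" where
  "dist_laplacian G f \<phi> = (LINT x:G|lebesgue. f x * laplacian \<phi> x)"

section \<open>Local Lebesgue and Sobolev spaces\<close>

definition L_loc :: "real \<Rightarrow> (real ^ 'n) set \<Rightarrow> (real ^ 'n \<Rightarrow> 'b::euclidean_space) \<Rightarrow> bool" where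
  "L_loc p G f \<longleftrightarrow> set_borel_measurable lebesgue G f \<and>
     (\<forall>K. compact K \<and> K \<subseteq> G \<longrightarrow> set_integrable lebesgue K (\<lambda>x. norm (f x) powr p))"

definition is_weak_grad ::
  "(real ^ 'n) set \<Rightarrow> (real ^ 'n \<Rightarrow> real) \<Rightarrow> (real ^ 'n \<Rightarrow> real ^ 'n) \<Rightarrow> bool" where
  "is_weak_grad G f g \<longleftrightarrow> L_loc 1 G f \<and> L_loc 1 G g \<and>
     (\<forall>i \<phi>. test_fun G \<phi> \<longrightarrow> dist_partial G i f \<phi> = (LINT x:G|lebesgue. g x $ i * \<phi> x))"

definition H1_loc :: "(real ^ 'n) set \<Rightarrow> (real ^ 'n \<Rightarrow> real) \<Rightarrow> bool" where
  "H1_loc G f \<longleftrightarrow> L_loc 2 G f \<and> (\<exists>g. is_weak_grad G f g \<and> L_loc 2 G g)"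

text \<open>For \<open>f\<close> in \<open>H\<^sup>1\<^sub>l\<^sub>o\<^sub>c(G)\<close> the weak gradient is unique up to null sets of \<open>G\<close>; the choice of
  representative does not affect any of the integrals below.\<close>

definition weak_grad ::
  "(real ^ 'n) set \<Rightarrow> (real ^ 'n \<Rightarrow> real) \<Rightarrow> real ^ 'n \<Rightarrow> real ^ 'n" where
  "weak_grad G f = (SOME g. is_weak_grad G f g \<and> L_loc 2 G g)"

section \<open>Suitable weak solutions and the renormalized head-pressure property\<close>

definition head :: "(real ^ 'n \<Rightarrow> real ^ 'n) \<Rightarrow> (real ^ 'n \<Rightarrow> real) \<Rightarrow> real ^ 'n \<Rightarrow> real" where
  "head U P x = (norm (U x))\<^sup>2 / 2 + P x"

text \<open>The \<open>i\<close>-th row of \<open>U \<otimes> U\<close> is the vector field \<open>U\<^sub>i U\<close>, and \<open>|\<nabla>U|\<^sup>2\<close> is the sum of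
  \<open>|\<nabla>U\<^sub>i|\<^sup>2\<close> over \<open>i\<close>. In dimension five, \<open>H\<^sup>1\<^sub>l\<^sub>o\<^sub>c\<close> embeds into \<open>L\<^sup>3\<^sub>l\<^sub>o\<^sub>c\<close>, so that all
  integrals converge.\<close>

definition suitable_weak_solution ::
  "(real ^ 5) set \<Rightarrow> (real ^ 5 \<Rightarrow> real ^ 5) \<Rightarrow> (real ^ 5 \<Rightarrow> real) \<Rightarrow> bool" where
  "suitable_weak_solution G U P \<longleftrightarrow>
     open G \<and>
     (\<forall>i. H1_loc G (\<lambda>x. U x $ i)) \<and>
     L_loc (3/2) G P \<and>
     (\<forall>i \<phi>. test_fun G \<phi> \<longrightarrow>
        - dist_laplacian G (\<lambda>x. U x $ i) \<phi> + dist_div G (\<lambda>x. U x $ i *\<^sub>R U x) \<phi>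
          + dist_partial G i P \<phi> = 0) \<and>
     (\<forall>\<phi>. test_fun G \<phi> \<longrightarrow> dist_div G U \<phi> = 0) \<and>
     (\<forall>\<phi>. test_fun G \<phi> \<and> (\<forall>x. 0 \<le> \<phi> x) \<longrightarrow>
        (LINT x:G|lebesgue. (\<Sum>i\<in>UNIV. (norm (weak_grad G (\<lambda>y. U y $ i) x))\<^sup>2) * \<phi> x)
        \<le> (LINT x:G|lebesgue. (norm (U x))\<^sup>2 / 2 * laplacian \<phi> x)
          + (LINT x:G|lebesgue. ((norm (U x))\<^sup>2 / 2 + P x) * (U x \<bullet> grad \<phi> x)))"

definition RHP ::
  "(real ^ 5) set \<Rightarrow> (real ^ 5 \<Rightarrow> real ^ 5) \<Rightarrow> (real ^ 5 \<Rightarrow> real) \<Rightarrow> bool" where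
  "RHP G U P \<longleftrightarrow>
     open G \<and>
     (let W = (\<lambda>x. max (head U P x) 0 powr (3/4)) in
        H1_loc G W \<and>
        (\<forall>\<phi>. test_fun G \<phi> \<and> (\<forall>x. 0 \<le> \<phi> x) \<longrightarrow>
           dist_div G (\<lambda>x. (4/3 * W x) *\<^sub>R weak_grad G W x - (2/3 * (W x)\<^sup>2) *\<^sub>R U x) \<phi>
           \<ge> (LINT x:G|lebesgue. 8/9 * (norm (weak_grad G W x))\<^sup>2 * \<phi> x)))"

text \<open>The integrals are taken in \<open>[0, \<infinity>]\<close>, so that finiteness of the suprema is meaningful.\<close>

definition Morrey :: "(real ^ 5 \<Rightarrow> real ^ 5) \<Rightarrow> (real ^ 5 \<Rightarrow> real) \<Rightarrow> ennreal" where
  "Morrey U P =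
     (SUP R\<in>{0<..}. ennreal (1 / R\<^sup>2) *
        (\<integral>\<^sup>+x\<in>ball 0 R. ennreal (norm (U x) ^ 3) \<partial>lebesgue)) +
     (SUP R\<in>{0<..}. ennreal (1 / R\<^sup>2) *
        (\<integral>\<^sup>+x\<in>ball 0 R. ennreal (\<bar>P x\<bar> powr (3/2)) \<partial>lebesgue))"

end

theory Submission imports Defs begin

text \<open>The hypotheses are invariant under the Navier--Stokes scaling, so all estimates are made on a
  fixed shell. There, comparing \<open>W\<close> with its mollification gives
  \<open>\<parallel>W - W\<^sub>t\<parallel>\<^sub>3 \<le> C t\<^bsup>1/6\<^esup> \<parallel>\<nabla>W\<parallel>\<^sub>2\<close>; hence the transport term \<open>W\<^sup>2 |U|\<close> is a small multiple of the
  energy \<open>\<integral> |\<nabla>W|\<^sup>2\<close> plus a constant, and hole filling bounds the energy of every dyadic shell by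
  the same constant.

  Testing the inequality with a cutoff between two scales bounds the energy in between by the
  difference of the fluxes through the two boundary shells. As \<open>U\<close> is divergence free, a constant
  may be subtracted from \<open>W\<^sup>2\<close>, so that the flux through a shell is bounded by the square root of
  its energy. The fluxes are therefore bounded, the total energy is finite, the energies of the
  shells tend to \<open>0\<close> at the origin and at infinity, the fluxes tend to \<open>0\<close>, and \<open>\<nabla>W = 0\<close>. A nonzero
  constant \<open>W\<close> would contradict the growth bound \<open>\<integral>\<^bsub>B(R)\<^esub> W\<^sup>2 \<le> M R\<^sup>2\<close> in dimension five.\<close>

section \<open>Smooth functions\<close>

text \<open>When lengths scale by lambda, U scales like lambda U, H like lambda^2 H and W like
  lambda^(3/2) W. In dimension five the energy of W and its flux are then dimensionless, so an
  estimate on one shell bounds every shell by the same constant. This alone does not sum over the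
  scales; the gain is that the flux is of first order in the root of the energy. The obstacle is the
  cubic transport term, for which no smallness is assumed. With U in L^3 it needs W in L^3, and 3
  lies below the critical Sobolev exponent 10/3 of dimension five. The remaining room is the
  positive power of the mollification radius, which supplies the missing smallness. It also allows
  the Sobolev embedding to be replaced by a geometric series over shrinking radii. The energy
  inequality is available only off the origin, so the flux through small shells must be shown to
  vanish just like that through large ones. The equation div U = 0 is used across the origin, so
  that a single cutoff equal to 1 near 0 suffices for subtracting a constant.\<close>

fun smooth1 :: "nat \<Rightarrow> (real \<Rightarrow> real) \<Rightarrow> bool" where
  "smooth1 0 f \<longleftrightarrow> continuous_on UNIV f"
| "smooth1 (Suc k) f \<longleftrightarrow> (\<exists>f'. (\<forall>x. (f has_real_derivative f' x) (at x)) \<and> smooth1 k f')"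

lemma smooth1_SucI:
  "\<lbrakk>\<And>x. (f has_real_derivative f' x) (at x); smooth1 k f'\<rbrakk> \<Longrightarrow> smooth1 (Suc k) f"
  by auto

text \<open>Needed for products: the derivative \<open>f' x * g x + g' x * f x\<close> involves the
  factors themselves, one order lower.\<close>

lemma smooth1_SucD: "smooth1 (Suc k) f \<Longrightarrow> smooth1 k f"
proof (induction k arbitrary: f)
  case 0
  then show ?case
    by (metis DERIV_continuous_on smooth1.simps has_field_derivative_at_within One_nat_def)
next
  case (Suc k)
  from Suc.prems obtain f' where f': "\<And>x. (f has_real_derivative f' x) (at x)" "smooth1 (Suc k) f'"
    by (auto simp del: smooth1.simps simp: smooth1.simps(2)[of "Suc k"])
  from smooth1_SucI[OF f'(1) Suc.IH[OF f'(2)]] show ?case .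
qed

lemma smooth1_const: "smooth1 k (\<lambda>x. c)"
proof (induction k arbitrary: c)
  case (Suc k)
  show ?case by (rule smooth1_SucI[where f'="\<lambda>x. 0"]) (auto intro: Suc)
qed auto

lemma smooth1_add: "\<lbrakk>smooth1 k f; smooth1 k g\<rbrakk> \<Longrightarrow> smooth1 k (\<lambda>x. f x + g x)"
proof (induction k arbitrary: f g)
  case (Suc k)
  from Suc.prems obtain f' g' where "\<And>x. (f has_real_derivative f' x) (at x)" "smooth1 k f'"
    "\<And>x. (g has_real_derivative g' x) (at x)" "smooth1 k g'" by auto
  with Suc.IH show ?case by (intro smooth1_SucI[where f'="\<lambda>x. f' x + g' x"]) (auto intro: derivative_intros)
qed (auto intro: continuous_intros)

lemma smooth1_mult: "\<lbrakk>smooth1 k f; smooth1 k g\<rbrakk> \<Longrightarrow> smooth1 k (\<lambda>x. f x * g x)"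
proof (induction k arbitrary: f g)
  case (Suc k)
  from Suc.prems obtain f' g' where fg: "\<And>x. (f has_real_derivative f' x) (at x)" "smooth1 k f'"
    "\<And>x. (g has_real_derivative g' x) (at x)" "smooth1 k g'" by auto
  have "smooth1 k f" "smooth1 k g" using Suc.prems smooth1_SucD by blast+
  then have "smooth1 k (\<lambda>x. f' x * g x + g' x * f x)" by (intro smooth1_add Suc.IH fg)
  then show ?case by (rule smooth1_SucI[rotated]) (intro DERIV_mult fg)
qed (auto intro: continuous_intros)

lemma smooth1_affine: "smooth1 k f \<Longrightarrow> smooth1 k (\<lambda>x. f (a * x + b))"
proof (induction k arbitrary: f)
  case 0
  then have "continuous_on UNIV f" by simp
  from continuous_on_compose2[OF this, of UNIV "\<lambda>x. a * x + b"] show ?case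
    by (simp add: continuous_intros)
next
  case (Suc k)
  from Suc.prems obtain f' where f': "\<And>x. (f has_real_derivative f' x) (at x)" "smooth1 k f'" by auto
  have "((\<lambda>x. f (a * x + b)) has_real_derivative f' (a * x + b) * a) (at x)" for x
    by (rule DERIV_chain2[OF f'(1)]) (auto intro!: derivative_eq_intros)
  then show ?case
    by (rule smooth1_SucI[where f'="\<lambda>x. f' (a * x + b) * a"])
       (intro smooth1_mult smooth1_const Suc.IH f')
qed

section \<open>Flat functions built from exp (-1/t)\<close>

definition flat_exp :: "nat \<Rightarrow> real \<Rightarrow> real" where
  "flat_exp m t = (if 0 < t then (1/t) ^ m * exp (- (1/t)) else 0)"

lemma flat_exp_tendsto: "(flat_exp m \<longlongrightarrow> 0) (at 0)"
proof -
  have "((\<lambda>x::real. x ^ m / exp x) \<longlongrightarrow> 0) at_top" by (rule tendsto_power_div_exp_0)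
  then have "((\<lambda>t::real. inverse t ^ m / exp (inverse t)) \<longlongrightarrow> 0) (at_right 0)"
    by (rule filterlim_compose) (rule filterlim_inverse_at_top_right)
  then have R: "(flat_exp m \<longlongrightarrow> 0) (at_right 0)"
    by (rule Lim_transform_eventually)
       (auto simp: eventually_at_filter flat_exp_def exp_minus field_simps inverse_eq_divide)
  have L: "(flat_exp m \<longlongrightarrow> 0) (at_left 0)"
    by (rule tendsto_eventually) (auto simp: eventually_at_filter flat_exp_def)
  from filterlim_split_at_real[OF L R] show ?thesis .
qed

text \<open>The powers \<open>(1/t) ^ m\<close> are carried along to make the family closed under
  differentiation; smoothness of all members is then one induction with m arbitrary. In particular
  \<open>flat_exp 2\<close> is the derivative of \<open>flat_exp 0\<close>, which is why it appears
  in the formulas for the mollifier.\<close>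

lemma flat_exp_deriv:
  "(flat_exp m has_real_derivative - real m * flat_exp (m+1) t + flat_exp (m+2) t) (at t)"
proof (cases t "0::real" rule: linorder_cases)
  case less
  have "((\<lambda>_. 0) has_real_derivative 0) (at t)" by simp
  then have "(flat_exp m has_real_derivative 0) (at t)"
    by (rule DERIV_cong_ev[THEN iffD1, rotated -1])
       (use less in \<open>auto simp: flat_exp_def eventually_nhds intro!: exI[of _ "{..<0}"]\<close>)
  with less show ?thesis by (simp add: flat_exp_def)
next
  case equal
  \<comment> \<open>The difference quotient of \<open>flat_exp m\<close> at 0 is
    \<open>flat_exp (m+1)\<close>.\<close>
  have "((\<lambda>h. (flat_exp m (0 + h) - flat_exp m 0) / h) \<longlongrightarrow> 0) (at 0)"
    by (rule Lim_transform_eventually[OF flat_exp_tendsto[of "m+1"]])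
       (auto simp: eventually_at_filter flat_exp_def)
  with equal show ?thesis by (simp add: DERIV_def flat_exp_def)
next
  case greater
  have "((\<lambda>t. (1/t) ^ m * exp (- (1/t))) has_real_derivative
     - real m * ((1/t)^(m+1) * exp (- (1/t))) + (1/t)^(m+2) * exp (- (1/t))) (at t)"
  proof (cases m)
    case (Suc k)
    have "t ^ k = t * t ^ (k - 1) \<or> k = 0" by (cases k) auto
    with Suc greater show ?thesis
      by (auto intro!: derivative_eq_intros simp: field_simps power2_eq_square)
  qed (use greater in \<open>auto intro!: derivative_eq_intros simp: field_simps power2_eq_square\<close>)
  then have "(flat_exp m has_real_derivative
     - real m * ((1/t)^(m+1) * exp (- (1/t))) + (1/t)^(m+2) * exp (- (1/t))) (at t)"
    by (rule DERIV_cong_ev[THEN iffD1, rotated -1])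
       (use greater in \<open>auto simp: flat_exp_def eventually_nhds intro!: exI[of _ "{0<..}"]\<close>)
  with greater show ?thesis by (simp add: flat_exp_def)
qed

lemma smooth1_flat_exp: "smooth1 k (flat_exp m)"
proof (induction k arbitrary: m)
  case 0
  show ?case by (auto intro!: DERIV_continuous_on flat_exp_deriv)
next
  case (Suc k)
  show ?case
    by (rule smooth1_SucI[OF flat_exp_deriv])
       (intro smooth1_add smooth1_mult smooth1_const Suc)
qed

lemma flat_exp_nonneg: "0 \<le> flat_exp m t"
  by (auto simp: flat_exp_def)

lemma flat_exp_pos: "0 < flat_exp m t \<longleftrightarrow> 0 < t"
  by (auto simp: flat_exp_def)

section \<open>Smooth functions of several variables\<close>

definition smooth_fun :: "(real ^ 'n \<Rightarrow> real) \<Rightarrow> bool" where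
  "smooth_fun f \<longleftrightarrow> (\<forall>k. C_k k f)"

lemma partial_deriv_eqI:
  assumes "(f has_derivative (\<lambda>h. D \<bullet> h)) (at x)"
  shows "partial_deriv i f x = D $ i"
  unfolding partial_deriv_def frechet_derivative_at[OF assms, symmetric] by (simp add: inner_axis)

lemma grad_eqI:
  assumes "(f has_derivative (\<lambda>h. D \<bullet> h)) (at x)"
  shows "grad f x = D"
  by (simp add: grad_def partial_deriv_eqI[OF assms])

lemma has_derivative_grad:
  fixes f :: "real ^ 'n \<Rightarrow> real"
  assumes "f differentiable at x"
  shows "(f has_derivative (\<lambda>h. grad f x \<bullet> h)) (at x)"
proof -
  define f' where "f' = frechet_derivative f (at x)"
  have d: "(f has_derivative f') (at x)" using assms by (simp add: frechet_derivative_works f'_def)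
  then have l: "linear f'" by (simp add: has_derivative_linear)
  have "f' h = grad f x \<bullet> h" for h
  proof -
    have "f' h = f' (\<Sum>i\<in>UNIV. h $ i *\<^sub>R axis i 1)"
      by (simp add: basis_expansion[where x=h, unfolded vector_scalar_mult_def] scalar_mult_eq_scaleR[symmetric] basis_expansion)
    also have "\<dots> = (\<Sum>i\<in>UNIV. h $ i * f' (axis i 1))"
      by (simp add: linear_sum[OF l] linear_scale[OF l])
    finally show ?thesis by (simp add: grad_def partial_deriv_def f'_def inner_vec_def mult.commute)
  qed
  then have "f' = (\<lambda>h. grad f x \<bullet> h)" by auto
  with d show ?thesis by simp
qed

text \<open>\<open>C_k\<close> recurses through partial derivatives of the Frechet derivative. This
  rule and \<open>C_k_SucE\<close> replace them by a gradient field, so that the closure proofs can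
  use the calculus of \<open>has_derivative\<close>.\<close>

lemma C_k_SucI:
  assumes "\<And>x. (f has_derivative (\<lambda>h. D x \<bullet> h)) (at x)" "\<And>i. C_k k (\<lambda>x. D x $ i)"
  shows "C_k (Suc k) f"
proof -
  have "partial_deriv i f = (\<lambda>x. D x $ i)" for i
    using partial_deriv_eqI[OF assms(1)] by auto
  then show ?thesis using assms by (auto simp: differentiable_on_def differentiable_def)
qed

lemma C_k_SucE:
  assumes "C_k (Suc k) f"
  shows "\<And>x. (f has_derivative (\<lambda>h. grad f x \<bullet> h)) (at x)" "\<And>i. C_k k (\<lambda>x. grad f x $ i)"
proof -
  show "\<And>x. (f has_derivative (\<lambda>h. grad f x \<bullet> h)) (at x)"
    using assms by (intro has_derivative_grad) (auto simp: differentiable_on_def)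
  show "C_k k (\<lambda>x. grad f x $ i)" for i using assms by (simp add: grad_def)
qed

lemma C_k_SucD: "C_k (Suc k) f \<Longrightarrow> C_k k f"
proof (induction k arbitrary: f)
  case 0
  then show ?case by (auto intro!: differentiable_imp_continuous_on)
next
  case (Suc k)
  show ?case
    by (rule C_k_SucI[OF C_k_SucE(1)[OF Suc.prems]]) (rule Suc.IH[OF C_k_SucE(2)[OF Suc.prems]])
qed

lemma C_k_const: "C_k k (\<lambda>x. c)"
proof (induction k arbitrary: c)
  case (Suc k)
  show ?case by (rule C_k_SucI[where D="\<lambda>x. 0"]) (auto intro: Suc)
qed auto

lemma C_k_nth: "C_k k (\<lambda>x. x $ i)"
proof (cases k)
  case (Suc m)
  show ?thesis unfolding Suc
  proof (rule C_k_SucI[where D="\<lambda>x. axis i 1"])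
    show "((\<lambda>x. x $ i) has_derivative (\<lambda>h. axis i 1 \<bullet> h)) (at x)" for x :: "real ^ 'a"
      using bounded_linear_imp_has_derivative[OF bounded_linear_vec_nth] by (simp add: inner_axis')
  qed (rule C_k_const)
qed (auto intro: continuous_intros)

lemma C_k_add: "\<lbrakk>C_k k f; C_k k g\<rbrakk> \<Longrightarrow> C_k k (\<lambda>x. f x + g x)"
proof (induction k arbitrary: f g)
  case (Suc k)
  show ?case
  proof (rule C_k_SucI[where D="\<lambda>x. grad f x + grad g x"])
    show "((\<lambda>x. f x + g x) has_derivative (\<lambda>h. (grad f x + grad g x) \<bullet> h)) (at x)" for x
      unfolding inner_add_left by (intro has_derivative_add C_k_SucE(1)[OF Suc.prems(1)] C_k_SucE(1)[OF Suc.prems(2)])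
    show "C_k k (\<lambda>x. (grad f x + grad g x) $ i)" for i
      using Suc.IH[OF C_k_SucE(2)[OF Suc.prems(1)] C_k_SucE(2)[OF Suc.prems(2)]] by simp
  qed
qed (auto intro: continuous_intros)

lemma C_k_mult: "\<lbrakk>C_k k f; C_k k g\<rbrakk> \<Longrightarrow> C_k k (\<lambda>x. f x * g x)"
proof (induction k arbitrary: f g)
  case (Suc k)
  show ?case
  proof (rule C_k_SucI[where D="\<lambda>x. f x *\<^sub>R grad g x + g x *\<^sub>R grad f x"])
    show "((\<lambda>x. f x * g x) has_derivative (\<lambda>h. (f x *\<^sub>R grad g x + g x *\<^sub>R grad f x) \<bullet> h)) (at x)" for x
      by (rule has_derivative_eq_rhs[OF has_derivative_mult[OF C_k_SucE(1)[OF Suc.prems(1)] C_k_SucE(1)[OF Suc.prems(2)]]])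
         (auto simp: inner_add_left)
    show "C_k k (\<lambda>x. (f x *\<^sub>R grad g x + g x *\<^sub>R grad f x) $ i)" for i
      using C_k_add[OF Suc.IH[OF C_k_SucD[OF Suc.prems(1)] C_k_SucE(2)[OF Suc.prems(2)]]
        Suc.IH[OF C_k_SucD[OF Suc.prems(2)] C_k_SucE(2)[OF Suc.prems(1)]]] by simp
  qed
qed (auto intro: continuous_intros)

lemma C_k_comp: "\<lbrakk>smooth1 k \<eta>; C_k k f\<rbrakk> \<Longrightarrow> C_k k (\<lambda>x. \<eta> (f x))"
proof (induction k arbitrary: \<eta> f)
  case 0
  then show ?case using continuous_on_compose2[of UNIV \<eta> UNIV f] by simp
next
  case (Suc k)
  from Suc.prems obtain \<eta>' where e: "\<And>x. (\<eta> has_real_derivative \<eta>' x) (at x)" "smooth1 k \<eta>'"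
    using smooth1.simps(2) by blast
  show ?case
  proof (rule C_k_SucI[where D="\<lambda>x. \<eta>' (f x) *\<^sub>R grad f x"])
    show "((\<lambda>x. \<eta> (f x)) has_derivative (\<lambda>h. (\<eta>' (f x) *\<^sub>R grad f x) \<bullet> h)) (at x)" for x
      using has_derivative_compose[OF C_k_SucE(1)[OF Suc.prems(2)] e(1)[of "f x", unfolded has_field_derivative_def]]
      by simp
    show "C_k k (\<lambda>x. (\<eta>' (f x) *\<^sub>R grad f x) $ i)" for i
      using C_k_mult[OF Suc.IH[OF e(2) C_k_SucD[OF Suc.prems(2)]] C_k_SucE(2)[OF Suc.prems(2)]] by simp
  qed
qed

lemma smooth_fun_intros:
  "smooth_fun (\<lambda>x. c)" "smooth_fun (\<lambda>x. x $ i)"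
  "\<lbrakk>smooth_fun f; smooth_fun g\<rbrakk> \<Longrightarrow> smooth_fun (\<lambda>x. f x + g x)"
  "\<lbrakk>smooth_fun f; smooth_fun g\<rbrakk> \<Longrightarrow> smooth_fun (\<lambda>x. f x * g x)"
  by (auto simp: smooth_fun_def C_k_const C_k_nth C_k_add C_k_mult)

lemma smooth_fun_comp: "\<lbrakk>\<And>k. smooth1 k \<eta>; smooth_fun f\<rbrakk> \<Longrightarrow> smooth_fun (\<lambda>x. \<eta> (f x))"
  by (auto simp: smooth_fun_def C_k_comp)

lemma smooth_fun_diff: "\<lbrakk>smooth_fun f; smooth_fun g\<rbrakk> \<Longrightarrow> smooth_fun (\<lambda>x. f x - g x)"
proof -
  assume "smooth_fun f" "smooth_fun g"
  then have "smooth_fun (\<lambda>x. f x + (-1) * g x)" by (intro smooth_fun_intros)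
  then show ?thesis by simp
qed

lemma smooth_fun_sum: "(\<And>i. i \<in> A \<Longrightarrow> smooth_fun (f i)) \<Longrightarrow> smooth_fun (\<lambda>x. \<Sum>i\<in>A. f i x)"
  by (induction A rule: infinite_finite_induct) (auto intro: smooth_fun_intros)

lemma smooth_fun_comp_scale:
  fixes f :: "real ^ 'n \<Rightarrow> real"
  assumes "smooth_fun f"
  shows "smooth_fun (\<lambda>x. f (c *\<^sub>R x))"
proof -
  have "C_k k f \<Longrightarrow> C_k k (\<lambda>x. f (c *\<^sub>R x))" for k and f :: "real ^ 'n \<Rightarrow> real"
  proof (induction k arbitrary: f)
    case 0
    then have "continuous_on UNIV f" by simp
    from continuous_on_compose2[OF this, of UNIV "\<lambda>x. c *\<^sub>R x"] show ?case
      by (simp add: continuous_intros)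
  next
    case (Suc k)
    show ?case
    proof (rule C_k_SucI[where D="\<lambda>x. c *\<^sub>R grad f (c *\<^sub>R x)"])
      show "((\<lambda>x. f (c *\<^sub>R x)) has_derivative (\<lambda>h. (c *\<^sub>R grad f (c *\<^sub>R x)) \<bullet> h)) (at x)" for x
        using has_derivative_compose[OF bounded_linear_imp_has_derivative[OF bounded_linear_scaleR_right]
            C_k_SucE(1)[OF Suc.prems]] by simp
      show "C_k k (\<lambda>x. (c *\<^sub>R grad f (c *\<^sub>R x)) $ i)" for i
        using C_k_mult[OF C_k_const Suc.IH[OF C_k_SucE(2)[OF Suc.prems]]] by simp
    qed
  qed
  with assms show ?thesis by (simp add: smooth_fun_def)
qed

lemma smooth_fun_has_derivative:
  "smooth_fun f \<Longrightarrow> (f has_derivative (\<lambda>h. grad f x \<bullet> h)) (at x)"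
  unfolding smooth_fun_def by (rule C_k_SucE(1)[of 0]) blast

lemma smooth_fun_continuous: "smooth_fun f \<Longrightarrow> continuous_on S f"
  unfolding smooth_fun_def using C_k.simps(1)[of f] continuous_on_subset[of UNIV f S] by blast

lemma smooth_fun_grad_nth: "smooth_fun f \<Longrightarrow> smooth_fun (\<lambda>x. grad f x $ i)"
  unfolding smooth_fun_def using C_k_SucE(2) by blast

lemma smooth_fun_continuous_grad: "smooth_fun f \<Longrightarrow> continuous_on S (grad f)"
  using smooth_fun_continuous[OF smooth_fun_grad_nth]
  by (subst continuous_on_componentwise) (auto simp: Basis_vec_def inner_axis)

lemma smooth_fun_dist_sq: "smooth_fun (\<lambda>x. (norm (x - a))\<^sup>2 :: real)"
proof -
  have e: "(\<lambda>x. (norm (x - a))\<^sup>2) = (\<lambda>x. \<Sum>i\<in>UNIV. (x $ i - a $ i) * (x $ i - a $ i))"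
    by (auto simp: power2_norm_eq_inner inner_vec_def)
  show ?thesis unfolding e by (intro smooth_fun_sum smooth_fun_intros smooth_fun_diff)
qed

text \<open>Centre and factor are parameters because both kinds of radial functions need it: a = x,
  c = 1 / t^2 for the mollifier, a = 0, c = 1 for the cutoffs around the origin.\<close>

lemma grad_radial:
  fixes a :: "real ^ 'n"
  assumes "(\<eta> has_real_derivative d) (at (c * (norm (x - a))\<^sup>2))"
  shows "grad (\<lambda>x. \<eta> (c * (norm (x - a))\<^sup>2)) x = (2 * c * d) *\<^sub>R (x - a)"
proof -
  have 1: "((\<lambda>x. c * (norm (x - a))\<^sup>2) has_derivative (\<lambda>h. (2 * c) * ((x - a) \<bullet> h))) (at x)"
    unfolding power2_norm_eq_inner by (auto intro!: derivative_eq_intros simp: inner_commute algebra_simps)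
  show ?thesis
    by (rule grad_eqI) (use has_derivative_compose[OF 1 assms[unfolded has_field_derivative_def]]
        in \<open>auto simp: mult_ac\<close>)
qed

lemma test_funI:
  assumes "smooth_fun \<phi>" "compact K" "K \<subseteq> G" "\<And>x. x \<notin> K \<Longrightarrow> \<phi> x = 0"
  shows "test_fun G \<phi>"
proof -
  have sub: "closure {x. \<phi> x \<noteq> 0} \<subseteq> K"
    by (rule closure_minimal) (use assms(2,4) in \<open>auto simp: compact_imp_closed\<close>)
  have "compact (K \<inter> closure {x. \<phi> x \<noteq> 0})"
    by (rule compact_Int_closed[OF assms(2)]) simp
  moreover have "K \<inter> closure {x. \<phi> x \<noteq> 0} = closure {x. \<phi> x \<noteq> 0}" using sub by blast
  ultimately show ?thesis using assms(1,3) sub by (simp add: test_fun_def smooth_fun_def)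
qed

lemma test_funD:
  assumes "test_fun G \<phi>"
  obtains K where "compact K" "K \<subseteq> G" "smooth_fun \<phi>" "\<And>x. x \<notin> K \<Longrightarrow> \<phi> x = 0"
    "\<And>x. x \<notin> K \<Longrightarrow> grad \<phi> x = 0"
proof -
  define K where "K = closure {x. \<phi> x \<noteq> 0}"
  have K: "compact K" "K \<subseteq> G" "smooth_fun \<phi>"
    using assms unfolding test_fun_def smooth_fun_def K_def by blast+
  have z: "\<phi> x = 0" if "x \<notin> K" for x
    using that closure_subset[of "{x. \<phi> x \<noteq> 0}"] unfolding K_def by blast
  have "grad \<phi> x = 0" if x: "x \<notin> K" for x
  proof -
    \<comment> \<open>Outside the closed support \<phi> vanishes on a whole neighbourhood, so its
      gradient vanishes there as well.\<close>
    have o: "open (- K)" unfolding K_def by (rule open_Compl) (rule closed_closure)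
    have "((\<lambda>_. 0) has_derivative (\<lambda>h. 0 \<bullet> h)) (at x)" by simp
    then have "(\<phi> has_derivative (\<lambda>h. 0 \<bullet> h)) (at x)"
      by (rule has_derivative_transform_within_open[OF _ o]) (use x z in auto)
    then show ?thesis by (rule grad_eqI)
  qed
  with K z that show thesis by blast
qed

lemma smooth1_inverse:
  assumes "\<And>x. f x \<noteq> 0"
  shows "smooth1 k f \<Longrightarrow> smooth1 k (\<lambda>x. inverse (f x))"
proof (induction k)
  case 0
  with assms show ?case by (auto intro: continuous_intros)
next
  case (Suc k)
  from Suc.prems obtain f' where f': "\<And>x. (f has_real_derivative f' x) (at x)" "smooth1 k f'" by auto
  have k: "smooth1 k (\<lambda>x. inverse (f x))" using Suc smooth1_SucD by blast
  show ?case
  proof (rule smooth1_SucI)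
    show "((\<lambda>x. inverse (f x)) has_real_derivative (-1) * (f' x * (inverse (f x) * inverse (f x)))) (at x)" for x
      using DERIV_inverse_fun[OF f'(1) assms] by (simp add: power2_eq_square mult_ac)
    show "smooth1 k (\<lambda>x. (-1) * (f' x * (inverse (f x) * inverse (f x))))"
      by (intro smooth1_mult smooth1_const k f')
  qed
qed

section \<open>Smooth cutoffs\<close>

definition cutoff :: "real \<Rightarrow> real" where
  "cutoff t = flat_exp 0 t * inverse (flat_exp 0 t + flat_exp 0 (1 - t))"

text \<open>t and 1 - t are never both nonpositive, so one of the two summands is positive. The
  quotient \<open>cutoff\<close> is then a smooth step from 0 on t \<le> 0 to 1 on t \<ge>
  1.\<close>

lemma cutoff_denominator: "flat_exp 0 t + flat_exp 0 (1 - t) > 0"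
  using flat_exp_nonneg[of 0 t] flat_exp_nonneg[of 0 "1-t"] flat_exp_pos[of 0 t] flat_exp_pos[of 0 "1-t"]
  by linarith

lemma smooth1_cutoff: "smooth1 k cutoff"
proof -
  have "smooth1 k (\<lambda>t. flat_exp 0 t * inverse (flat_exp 0 t + flat_exp 0 ((-1) * t + 1)))"
  proof (intro smooth1_mult smooth1_flat_exp smooth1_inverse smooth1_add)
    show "flat_exp 0 t + flat_exp 0 ((-1) * t + 1) \<noteq> 0" for t
      using cutoff_denominator[of t] by (simp add: algebra_simps)
    show "smooth1 k (\<lambda>t. flat_exp 0 ((-1) * t + 1))" by (rule smooth1_affine) (rule smooth1_flat_exp)
  qed
  then show ?thesis by (simp add: cutoff_def[abs_def])
qed

lemma cutoff_range: "0 \<le> cutoff t" "cutoff t \<le> 1"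
  using cutoff_denominator[of t] flat_exp_nonneg[of 0 t] flat_exp_nonneg[of 0 "1-t"]
  by (auto simp: cutoff_def field_simps)

lemma cutoff_eq_0: "t \<le> 0 \<Longrightarrow> cutoff t = 0"
  by (simp add: cutoff_def flat_exp_def)

lemma cutoff_eq_1: "1 \<le> t \<Longrightarrow> cutoff t = 1"
  using cutoff_denominator[of t] by (simp add: cutoff_def flat_exp_def)

lemma smooth1_has_deriv:
  assumes "\<And>k. smooth1 k f"
  shows "(f has_real_derivative deriv f t) (at t)" "smooth1 k (deriv f)"
proof -
  obtain f' where f': "\<And>x. (f has_real_derivative f' x) (at x)" "smooth1 k f'"
    using assms[of "Suc k"] by auto
  then have "deriv f = f'" by (auto intro: DERIV_imp_deriv)
  with f' show "(f has_real_derivative deriv f t) (at t)" "smooth1 k (deriv f)" by auto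
qed

lemma deriv_cutoff_outside: "t < 0 \<or> 1 < t \<Longrightarrow> deriv cutoff t = 0"
proof (elim disjE)
  assume t: "t < 0"
  have "((\<lambda>_. 0) has_real_derivative 0) (at t)" by simp
  then have "(cutoff has_real_derivative 0) (at t)"
    by (rule has_field_derivative_transform_within_open[of _ _ _ "{..<0}"]) (use t in \<open>auto simp: cutoff_eq_0\<close>)
  then show ?thesis by (rule DERIV_imp_deriv)
next
  assume t: "1 < t"
  have "((\<lambda>_. 1) has_real_derivative 0) (at t)" by simp
  then have "(cutoff has_real_derivative 0) (at t)"
    by (rule has_field_derivative_transform_within_open[of _ _ _ "{1<..}"]) (use t in \<open>auto simp: cutoff_eq_1\<close>)
  then show ?thesis by (rule DERIV_imp_deriv)
qed

lemma deriv_cutoff_bounded: "\<exists>K>0. \<forall>t. \<bar>deriv cutoff t\<bar> \<le> K"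
proof -
  have "continuous_on UNIV (deriv cutoff)"
    using smooth1_has_deriv(2)[OF smooth1_cutoff, of 0] by simp
  then have "continuous_on {0..1} (deriv cutoff)" by (rule continuous_on_subset) simp
  then have "bounded (deriv cutoff ` {0..1})"
    by (intro compact_imp_bounded compact_continuous_image) auto
  then obtain K where K: "K > 0" "\<forall>t\<in>{0..1}. \<bar>deriv cutoff t\<bar> \<le> K"
    unfolding bounded_pos by auto
  have "\<bar>deriv cutoff t\<bar> \<le> K" for t
    using K deriv_cutoff_outside[of t] by (cases "t \<in> {0..1}") auto
  with K show ?thesis by blast
qed

section \<open>Mollification\<close>

text \<open>Dominated convergence for the difference quotients: on the convex set S the mean value
  inequality bounds them by the bound on \<kappa>'. The derivative is taken within S, so that the
  closed interval [0,1] of \<open>mollify_path\<close> is covered with its end points.\<close>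

lemma has_derivative_integral_dominated:
  fixes \<kappa> \<kappa>' :: "real \<Rightarrow> 'a::euclidean_space \<Rightarrow> real" and f :: "'a \<Rightarrow> real"
  assumes "convex S" "s0 \<in> S"
    and deriv: "\<And>s z. s \<in> S \<Longrightarrow> ((\<lambda>s. \<kappa> s z) has_real_derivative \<kappa>' s z) (at s within S)"
    and bound: "\<And>s z. s \<in> S \<Longrightarrow> \<bar>\<kappa>' s z\<bar> \<le> B * indicator K z"
    and f: "set_integrable lborel K f" "f \<in> borel_measurable borel"
    and int: "\<And>s. s \<in> S \<Longrightarrow> integrable lborel (\<lambda>z. f z * \<kappa> s z)"
    and meas: "\<And>s. s \<in> S \<Longrightarrow> \<kappa> s \<in> borel_measurable borel" "\<kappa>' s0 \<in> borel_measurable borel"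
  shows "((\<lambda>s. \<integral>z. f z * \<kappa> s z \<partial>lborel) has_real_derivative (\<integral>z. f z * \<kappa>' s0 z \<partial>lborel)) (at s0 within S)"
  unfolding has_field_derivative_iff tendsto_at_iff_sequentially
proof (intro allI impI)
  fix X assume X: "\<forall>i. X i \<in> S - {s0}" "X \<longlonglongrightarrow> s0"
  define u where "u n z = f z * ((\<kappa> (X n) z - \<kappa> s0 z) / (X n - s0))" for n z
  have "(\<lambda>n. \<integral>z. u n z \<partial>lborel) \<longlonglongrightarrow> (\<integral>z. f z * \<kappa>' s0 z \<partial>lborel)"
  proof (rule integral_dominated_convergence)
    show "(\<lambda>z. f z * \<kappa>' s0 z) \<in> borel_measurable lborel" using f(2) meas(2) by simp
    show "u n \<in> borel_measurable lborel" for n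
      using f(2) meas(1)[of "X n"] meas(1)[OF assms(2)] X(1) unfolding u_def by simp
    show "integrable lborel (\<lambda>z. B * \<bar>indicator K z *\<^sub>R f z\<bar>)"
      using f(1) unfolding set_integrable_def by (intro integrable_mult_right integrable_abs)
    show "AE z in lborel. (\<lambda>n. u n z) \<longlonglongrightarrow> f z * \<kappa>' s0 z"
    proof (rule AE_I2)
      fix z
      have "((\<lambda>n. (\<kappa> (X n) z - \<kappa> s0 z) / (X n - s0))) \<longlonglongrightarrow> \<kappa>' s0 z"
        using deriv[OF assms(2), of z] X unfolding has_field_derivative_iff tendsto_at_iff_sequentially
        by (auto simp: o_def)
      then show "(\<lambda>n. u n z) \<longlonglongrightarrow> f z * \<kappa>' s0 z" unfolding u_def by (intro tendsto_intros)
    qed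
    show "AE z in lborel. norm (u n z) \<le> B * \<bar>indicator K z *\<^sub>R f z\<bar>" for n
    proof (rule AE_I2)
      fix z
      have "norm (\<kappa> (X n) z - \<kappa> s0 z) \<le> (B * indicator K z) * norm (X n - s0)"
        by (rule field_differentiable_bound[OF assms(1) deriv]) (use bound assms(2) X in auto)
      then have "\<bar>(\<kappa> (X n) z - \<kappa> s0 z) / (X n - s0)\<bar> \<le> B * indicator K z"
        using X(1) by (auto simp: field_simps)
      from mult_left_mono[OF this, of "\<bar>f z\<bar>"]
      show "norm (u n z) \<le> B * \<bar>indicator K z *\<^sub>R f z\<bar>"
        by (auto simp: u_def abs_mult indicator_def mult_ac)
    qed
  qed
  moreover have "(\<integral>z. u n z \<partial>lborel) =
      ((\<lambda>s. ((\<integral>z. f z * \<kappa> s z \<partial>lborel) - (\<integral>z. f z * \<kappa> s0 z \<partial>lborel)) / (s - s0)) \<circ> X) n" for n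
  proof -
    have "(\<integral>z. u n z \<partial>lborel) = (\<integral>z. (f z * \<kappa> (X n) z - f z * \<kappa> s0 z) / (X n - s0) \<partial>lborel)"
      by (simp add: u_def algebra_simps)
    also have "\<dots> = ((\<integral>z. f z * \<kappa> (X n) z \<partial>lborel) - (\<integral>z. f z * \<kappa> s0 z \<partial>lborel)) / (X n - s0)"
      using int[of "X n"] int[of s0] X(1) assms(2) by (subst integral_divide_zero, subst Bochner_Integration.integral_diff) auto
    finally show ?thesis by simp
  qed
  ultimately show "((\<lambda>s. ((\<integral>z. f z * \<kappa> s z \<partial>lborel) - (\<integral>z. f z * \<kappa> s0 z \<partial>lborel)) / (s - s0)) \<circ> X)
      \<longlonglongrightarrow> (\<integral>z. f z * \<kappa>' s0 z \<partial>lborel)"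
    by (simp add: o_def)
qed

section \<open>Affine changes of variables in dimension five\<close>

lemma lborel_affine':
  fixes x :: "real ^ 5"
  assumes "t > 0"
  shows "lborel = density (distr lborel borel (\<lambda>y. x + t *\<^sub>R y)) (\<lambda>_. ennreal (t ^ 5))"
  using lborel_affine[of t x] assms by simp

lemma nn_integral_affine:
  fixes x :: "real ^ 5" and F :: "real ^ 5 \<Rightarrow> ennreal"
  assumes "t > 0" and [measurable]: "F \<in> borel_measurable borel"
  shows "(\<integral>\<^sup>+z. F z \<partial>lborel) = ennreal (t ^ 5) * (\<integral>\<^sup>+y. F (x + t *\<^sub>R y) \<partial>lborel)"
  by (subst lborel_affine'[OF assms(1), of x])
     (simp add: nn_integral_density nn_integral_distr nn_integral_cmult)

lemma integral_affine:
  fixes x :: "real ^ 5" and F :: "real ^ 5 \<Rightarrow> real"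
  assumes "t > 0" and [measurable]: "F \<in> borel_measurable borel"
  shows "(\<integral>z. F z \<partial>lborel) = t ^ 5 * (\<integral>y. F (x + t *\<^sub>R y) \<partial>lborel)"
  using assms(1)
  by (subst lborel_affine'[OF assms(1), of x])
     (simp add: integral_density integral_distr)

lemma integrable_affine_iff:
  fixes x :: "real ^ 5" and F :: "real ^ 5 \<Rightarrow> real"
  assumes "t > 0" and [measurable]: "F \<in> borel_measurable borel"
  shows "integrable lborel F \<longleftrightarrow> integrable lborel (\<lambda>y. F (x + t *\<^sub>R y))"
  using assms(1)
  by (subst lborel_affine'[OF assms(1), of x])
     (simp add: integrable_density integrable_distr_eq)

section \<open>The mollifier\<close>

definition mollifier_mass :: real where
  "mollifier_mass = (\<integral>y. flat_exp 0 (1 - (norm (y :: real ^ 5))\<^sup>2) \<partial>lborel)"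

text \<open>Radius t and centre x are both explicit arguments because \<open>mollify_path\<close>
  varies them simultaneously. The factor t ^ 5 normalises the integral in five dimensions.\<close>

definition mollifier :: "real \<Rightarrow> real ^ 5 \<Rightarrow> real ^ 5 \<Rightarrow> real" where
  "mollifier t x z = flat_exp 0 (1 - (norm (z - x))\<^sup>2 / t\<^sup>2) / (mollifier_mass * t ^ 5)"

lemma flat_exp_measurable [measurable]: "flat_exp m \<in> borel_measurable borel"
  using smooth1_flat_exp[of 0 m] by (intro borel_measurable_continuous_onI) simp

lemma flat_exp_0_le_1: "flat_exp 0 t \<le> 1"
  by (auto simp: flat_exp_def)

text \<open>From the quadratic Taylor bound exp (1/t) \<ge> (1/t)^2 / 2.\<close>

lemma flat_exp_2_le_2: "flat_exp 2 t \<le> 2"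
proof (cases "t > 0")
  case True
  have "1 + 1/t + (1/t)\<^sup>2 / 2 \<le> exp (1/t)" by (rule exp_lower_Taylor_quadratic) (use True in auto)
  moreover have "0 \<le> 1 + 1/t" using True by simp
  ultimately have "(1/t)\<^sup>2 \<le> 2 * exp (1/t)" by linarith
  with True show ?thesis by (simp add: flat_exp_def exp_minus divide_simps mult_ac)
qed (auto simp: flat_exp_def)

lemma integrable_indicator_cball: "integrable lborel (indicator (cball (x :: real ^ 5) r) :: _ \<Rightarrow> real)"
  by (rule integrable_real_indicator) (use emeasure_lborel_cball_finite[of x r] in auto)

lemma mollifier_mass_pos: "mollifier_mass > 0"
proof -
  let ?f = "\<lambda>y :: real ^ 5. flat_exp 0 (1 - (norm y)\<^sup>2)"
  have i: "integrable lborel ?f"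
  proof (rule Bochner_Integration.integrable_bound[OF integrable_indicator_cball[of 0 1]])
    show "AE y in lborel. norm (?f y) \<le> norm (indicator (cball 0 1) y :: real)"
    proof (rule AE_I2)
      fix y :: "real ^ 5"
      show "norm (?f y) \<le> norm (indicator (cball 0 1) y :: real)"
      proof (cases "norm y \<le> 1")
        case False
        then have "1 < (norm y)\<^sup>2" by (simp add: one_less_power)
        then show ?thesis by (simp add: flat_exp_def)
      qed (use flat_exp_0_le_1 flat_exp_nonneg in auto)
    qed
  qed simp
  \<comment> \<open>On the ball of radius 1/2 the argument 1 - |y|^2 is at least 1/2, so the
    integrand is at least exp (-2) there.\<close>
  have "0 < exp (-2) * measure lborel (cball (0 :: real ^ 5) (1/2))"
    by (intro mult_pos_pos) (auto intro!: content_cball_pos)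
  also have "\<dots> = (\<integral>y. exp (-2) * indicator (cball (0 :: real ^ 5) (1/2)) y \<partial>lborel)" by simp
  also have "\<dots> \<le> (\<integral>y. ?f y \<partial>lborel)"
  proof (rule integral_mono[OF integrable_mult_right i])
    show "integrable lborel (indicator (cball (0 :: real ^ 5) (1/2)) :: _ \<Rightarrow> real)" by (rule integrable_indicator_cball)
    fix y :: "real ^ 5"
    show "exp (-2) * indicator (cball (0 :: real ^ 5) (1/2)) y \<le> ?f y"
    proof (cases "y \<in> cball 0 (1/2)")
      case True
      then have "(norm y)\<^sup>2 \<le> (1/2)\<^sup>2" by (intro power_mono) auto
      then have "1/2 \<le> 1 - (norm y)\<^sup>2" by (simp add: power2_eq_square)
      moreover from this have "1 / (1 - (norm y)\<^sup>2) \<le> 1 / (1/2)" by (intro divide_left_mono) auto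
      ultimately show ?thesis using True by (simp add: flat_exp_def)
    qed (simp add: flat_exp_nonneg)
  qed
  finally show ?thesis by (simp add: mollifier_mass_def)
qed

lemma mollifier_measurable [measurable (raw)]:
  assumes [measurable]: "a \<in> borel_measurable M" "b \<in> M \<rightarrow>\<^sub>M borel" "c \<in> M \<rightarrow>\<^sub>M borel"
  shows "(\<lambda>w. mollifier (a w) (b w) (c w)) \<in> borel_measurable M"
  unfolding mollifier_def by measurable

lemma mollifier_nonneg: "t > 0 \<Longrightarrow> 0 \<le> mollifier t x z"
  unfolding mollifier_def using mollifier_mass_pos flat_exp_nonneg by (intro divide_nonneg_nonneg) auto

lemma mollifier_eq_0:
  assumes "t > 0" "t \<le> dist x z"
  shows "mollifier t x z = 0"
proof -
  have "t\<^sup>2 \<le> (norm (z - x))\<^sup>2" using assms by (intro power_mono) (auto simp: dist_norm norm_minus_commute)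
  then have "1 - (norm (z - x))\<^sup>2 / t\<^sup>2 \<le> 0" using assms by (simp add: divide_simps)
  then show ?thesis unfolding mollifier_def flat_exp_def by simp
qed

lemma mollifier_le:
  assumes "t > 0"
  shows "mollifier t x z \<le> 1 / (mollifier_mass * t ^ 5) * indicator (cball x t) z"
proof (cases "z \<in> cball x t")
  case True
  then show ?thesis
    using mollifier_mass_pos assms flat_exp_0_le_1 by (auto simp: mollifier_def intro!: divide_right_mono)
qed (use mollifier_eq_0[of t x z] assms in auto)

lemma mollifier_integrable: "t > 0 \<Longrightarrow> integrable lborel (mollifier t x)"
  by (rule Bochner_Integration.integrable_bound
        [OF integrable_mult_right[OF integrable_indicator_cball, of "1 / (mollifier_mass * t ^ 5)" x t]])
     (use mollifier_le[of t x] mollifier_nonneg[of t x] mollifier_mass_pos in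
       \<open>auto intro!: AE_I2 simp: abs_mult\<close>)

lemma mollifier_integral:
  assumes "t > 0"
  shows "(\<integral>z. mollifier t x z \<partial>lborel) = 1"
proof -
  have "(\<integral>z. mollifier t x z \<partial>lborel) = t ^ 5 * (\<integral>y. mollifier t x (x + t *\<^sub>R y) \<partial>lborel)"
    by (rule integral_affine[OF assms]) simp
  also have "\<dots> = t ^ 5 * (\<integral>y. flat_exp 0 (1 - (norm (y :: real ^ 5))\<^sup>2) / (mollifier_mass * t ^ 5) \<partial>lborel)"
    using assms by (simp add: mollifier_def power_mult_distrib)
  also have "\<dots> = 1" using assms mollifier_mass_pos by (simp add: mollifier_mass_def[symmetric])
  finally show ?thesis .
qed

text \<open>Counterpart of \<open>is_weak_grad\<close> for Borel functions and
  \<open>lborel\<close>, where Fubini and changes of variables apply directly. The integrals run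
  over the whole space, since a test function and its derivatives vanish outside G.\<close>

definition loc_weak_grad ::
  "(real ^ 5) set \<Rightarrow> (real ^ 5 \<Rightarrow> real) \<Rightarrow> (real ^ 5 \<Rightarrow> real ^ 5) \<Rightarrow> bool" where
  "loc_weak_grad G f g \<longleftrightarrow> f \<in> borel_measurable borel \<and> g \<in> borel_measurable borel \<and>
     (\<forall>K. compact K \<and> K \<subseteq> G \<longrightarrow> set_integrable lborel K f \<and> set_integrable lborel K g) \<and>
     (\<forall>i \<phi>. test_fun G \<phi> \<longrightarrow>
        (\<integral>x. f x * partial_deriv i \<phi> x \<partial>lborel) = - (\<integral>x. g x $ i * \<phi> x \<partial>lborel))"

definition mollify :: "(real ^ 5 \<Rightarrow> real) \<Rightarrow> real \<Rightarrow> real ^ 5 \<Rightarrow> real" where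
  "mollify f t x = (\<integral>z. f z * mollifier t x z \<partial>lborel)"

text \<open>Transport identity: along an affine path of centres and radii, the mollifier moves by minus
  the divergence of itself times the velocity \<open>v - \<tau> y\<close>, \<open>y = (p - z) / r\<close>.\<close>

definition transport_field :: "real ^ 5 \<Rightarrow> real \<Rightarrow> real \<Rightarrow> real ^ 5 \<Rightarrow> real ^ 5 \<Rightarrow> real ^ 5" where
  "transport_field v \<tau> r p z = v - (\<tau> / r) *\<^sub>R (p - z)"

text \<open>The s-derivative of the mollifier when its centre p moves with velocity v and its radius
  r with speed \<tau>. The term with \<open>flat_exp 2\<close> differentiates the profile, the one
  with \<open>flat_exp 0\<close> the normalisation r ^ 5.\<close>

definition mollifier_rate :: "real ^ 5 \<Rightarrow> real \<Rightarrow> real \<Rightarrow> real ^ 5 \<Rightarrow> real ^ 5 \<Rightarrow> real" where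
  "mollifier_rate v \<tau> r p z = (1 / (mollifier_mass * r ^ 5)) *
     (flat_exp 2 (1 - (norm (z - p))\<^sup>2 / r\<^sup>2) * (2 / r\<^sup>2 * ((z - p) \<bullet> v) + 2 * \<tau> / r ^ 3 * (norm (z - p))\<^sup>2)
      - 5 * \<tau> / r * flat_exp 0 (1 - (norm (z - p))\<^sup>2 / r\<^sup>2))"

lemma mollifier_has_rate:
  assumes r: "t + s * \<tau> > 0"
  shows "((\<lambda>s. mollifier (t + s * \<tau>) (x + s *\<^sub>R v) z) has_real_derivative
     mollifier_rate v \<tau> (t + s * \<tau>) (x + s *\<^sub>R v) z) (at s within S)"
proof -
  define r p where "r = t + s * \<tau>" and "p = x + s *\<^sub>R v"
  have "r > 0" using r by (simp add: r_def)
  have n: "((\<lambda>s. (norm (z - (x + s *\<^sub>R v)))\<^sup>2) has_real_derivative (- 2 * ((z - p) \<bullet> v))) (at s)"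
    unfolding power2_norm_eq_inner has_field_derivative_def
    by (auto intro!: derivative_eq_intros simp: p_def inner_commute algebra_simps)
  have d: "((\<lambda>s. t + s * \<tau>) has_real_derivative \<tau>) (at s)"
    by (auto intro!: derivative_eq_intros)
  have gen1: "((\<lambda>s. 1 - N s / (R s)\<^sup>2) has_real_derivative (- N' / (R s)\<^sup>2 + 2 * \<tau> / (R s) ^ 3 * N s)) (at s)"
    and gen2: "((\<lambda>s. N s / (mollifier_mass * R s ^ 5)) has_real_derivative
      (1 / (mollifier_mass * R s ^ 5)) * (N' - 5 * \<tau> / R s * N s)) (at s)"
    if "(N has_real_derivative N') (at s)" "(R has_real_derivative \<tau>) (at s)" "R s > 0"
    for N N' R
    using that mollifier_mass_pos
    by (auto intro!: derivative_eq_intros simp: field_simps eval_nat_numeral)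
  have a: "((\<lambda>s. 1 - (norm (z - (x + s *\<^sub>R v)))\<^sup>2 / (t + s * \<tau>)\<^sup>2) has_real_derivative
     (2 / r\<^sup>2 * ((z - p) \<bullet> v) + 2 * \<tau> / r ^ 3 * (norm (z - p))\<^sup>2)) (at s)"
    using gen1[OF n d r] by (simp add: r_def p_def)
  have e: "((\<lambda>s. flat_exp 0 (1 - (norm (z - (x + s *\<^sub>R v)))\<^sup>2 / (t + s * \<tau>)\<^sup>2)) has_real_derivative
     flat_exp 2 (1 - (norm (z - p))\<^sup>2 / r\<^sup>2) *
     (2 / r\<^sup>2 * ((z - p) \<bullet> v) + 2 * \<tau> / r ^ 3 * (norm (z - p))\<^sup>2)) (at s)"
    using DERIV_chain2[OF flat_exp_deriv a, of 0] by (simp add: r_def p_def numeral_2_eq_2)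
  have "((\<lambda>s. flat_exp 0 (1 - (norm (z - (x + s *\<^sub>R v)))\<^sup>2 / (t + s * \<tau>)\<^sup>2) / (mollifier_mass * (t + s * \<tau>) ^ 5))
     has_real_derivative mollifier_rate v \<tau> r p z) (at s)"
    using gen2[OF e d r] by (simp add: mollifier_rate_def r_def p_def numeral_2_eq_2)
  then show ?thesis unfolding mollifier_def r_def p_def by (rule has_field_derivative_at_within)
qed

text \<open>A majorant, uniform over radii r \<ge> r0 up to the support, for differentiating under
  the integral. On the support |z - p| \<le> r; with \<open>flat_exp 2\<close> at most 2 and
  \<open>flat_exp 0\<close> at most 1 the coefficients are 4 = 2 * 2 and 9 = 2 * 2 + 5.\<close>

lemma mollifier_rate_le:
  assumes "0 < r0" "r0 \<le> r"
  shows "\<bar>mollifier_rate v \<tau> r p z\<bar> \<le>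
    (1 / (mollifier_mass * r0 ^ 5)) * ((4 * norm v + 9 * \<bar>\<tau>\<bar>) / r0) * indicator (cball p r) z"
proof -
  define q where "q = 1 - (norm (z - p))\<^sup>2 / r\<^sup>2"
  have r: "0 < r" using assms by simp
  show ?thesis
  proof (cases "z \<in> cball p r")
    case True
    then have n: "norm (z - p) \<le> r" by (simp add: dist_norm norm_minus_commute)
    have m: "0 < 1 / (mollifier_mass * r ^ 5)" "1 / (mollifier_mass * r ^ 5) \<le> 1 / (mollifier_mass * r0 ^ 5)"
      using mollifier_mass_pos assms by (auto intro!: divide_left_mono mult_left_mono power_mono)
    have i: "\<bar>(z - p) \<bullet> v\<bar> \<le> r * norm v"
      using Cauchy_Schwarz_ineq2[of "z - p" v] mult_right_mono[OF n norm_ge_zero, of v] by linarith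
    have a1: "\<bar>2 / r\<^sup>2 * ((z - p) \<bullet> v)\<bar> \<le> 2 * norm v / r"
      using mult_left_mono[OF i, of "2 / r\<^sup>2"] r by (simp add: abs_mult power2_eq_square)
    have "\<bar>2 * \<tau> / r ^ 3 * (norm (z - p))\<^sup>2\<bar> \<le> 2 * \<bar>\<tau>\<bar> / r ^ 3 * r\<^sup>2"
      using r n by (auto simp: abs_mult intro!: mult_left_mono power_mono divide_right_mono)
    also have "\<dots> = 2 * \<bar>\<tau>\<bar> / r" using r by (simp add: power2_eq_square power3_eq_cube)
    finally have a2: "\<bar>2 / r\<^sup>2 * ((z - p) \<bullet> v) + 2 * \<tau> / r ^ 3 * (norm (z - p))\<^sup>2\<bar> \<le> 2 * norm v / r + 2 * \<bar>\<tau>\<bar> / r"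
      using a1 by linarith
    have f2: "0 \<le> flat_exp 2 q" "flat_exp 2 q \<le> 2" "0 \<le> flat_exp 0 q" "flat_exp 0 q \<le> 1"
      using flat_exp_nonneg flat_exp_2_le_2 flat_exp_0_le_1 by auto
    have "\<bar>flat_exp 2 q * (2 / r\<^sup>2 * ((z - p) \<bullet> v) + 2 * \<tau> / r ^ 3 * (norm (z - p))\<^sup>2)\<bar>
        \<le> 2 * (2 * norm v / r + 2 * \<bar>\<tau>\<bar> / r)"
      unfolding abs_mult using f2 a2 by (intro mult_mono) auto
    moreover have "\<bar>5 * \<tau> / r * flat_exp 0 q\<bar> \<le> 5 * \<bar>\<tau>\<bar> / r * 1"
      unfolding abs_mult using f2 r by (intro mult_mono) auto
    ultimately have "\<bar>flat_exp 2 q * (2 / r\<^sup>2 * ((z - p) \<bullet> v) + 2 * \<tau> / r ^ 3 * (norm (z - p))\<^sup>2)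
        - 5 * \<tau> / r * flat_exp 0 q\<bar> \<le> 2 * (2 * norm v / r + 2 * \<bar>\<tau>\<bar> / r) + 5 * \<bar>\<tau>\<bar> / r"
      by linarith
    also have "\<dots> = (4 * norm v + 9 * \<bar>\<tau>\<bar>) / r" using r by (simp add: field_simps)
    also have "\<dots> \<le> (4 * norm v + 9 * \<bar>\<tau>\<bar>) / r0"
      using assms by (intro divide_left_mono) auto
    finally have "\<bar>mollifier_rate v \<tau> r p z\<bar> \<le> (1 / (mollifier_mass * r0 ^ 5)) * ((4 * norm v + 9 * \<bar>\<tau>\<bar>) / r0)"
      unfolding mollifier_rate_def q_def[symmetric] abs_mult
      using m order.trans[OF less_imp_le[OF m(1)] m(2)] by (intro mult_mono) (auto simp del: zero_le_divide_1_iff)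
    with True show ?thesis by simp
  next
    case False
    then have "r\<^sup>2 \<le> (norm (z - p))\<^sup>2" using r by (intro power_mono) (auto simp: dist_norm norm_minus_commute)
    then have "q \<le> 0" using r by (simp add: q_def divide_simps)
    then have "flat_exp m q = 0" for m by (simp add: flat_exp_def)
    then show ?thesis using False unfolding mollifier_rate_def q_def by simp
  qed
qed

lemma mollifier_rate_measurable [measurable]: "mollifier_rate v \<tau> r p \<in> borel_measurable borel"
  unfolding mollifier_rate_def by measurable

lemma smooth_fun_mollifier: "smooth_fun (mollifier t x)"
proof -
  have e: "mollifier t x = (\<lambda>z. flat_exp 0 (1 + (- (1 / t\<^sup>2)) * (norm (z - x))\<^sup>2) * (1 / (mollifier_mass * t ^ 5)))"
    by (auto simp: mollifier_def)
  show ?thesis unfolding e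
    by (intro smooth_fun_intros smooth_fun_comp[where \<eta>="flat_exp 0"] smooth1_flat_exp smooth_fun_dist_sq)
qed

lemma grad_mollifier:
  assumes "t > 0"
  shows "grad (mollifier t x) z =
    (- 2 * flat_exp 2 (1 - (norm (z - x))\<^sup>2 / t\<^sup>2) / (mollifier_mass * t ^ 7)) *\<^sub>R (z - x)"
proof -
  have d: "((\<lambda>q. flat_exp 0 (1 - q) / (mollifier_mass * t ^ 5)) has_real_derivative
     (- flat_exp 2 (1 - q) / (mollifier_mass * t ^ 5))) (at q)" for q
  proof -
    have "((\<lambda>q. flat_exp 0 (1 - q)) has_real_derivative flat_exp 2 (1 - q) * (-1)) (at q)"
      by (rule DERIV_chain2[of "flat_exp 0"])
         (use flat_exp_deriv[of 0 "1 - q"] in \<open>auto intro!: derivative_eq_intros simp: numeral_2_eq_2\<close>)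
    from DERIV_cdivide[OF this] show ?thesis by simp
  qed
  have "mollifier t x = (\<lambda>z. flat_exp 0 (1 - 1 / t\<^sup>2 * (norm (z - x))\<^sup>2) / (mollifier_mass * t ^ 5))"
    by (auto simp: mollifier_def)
  then show ?thesis
    using grad_radial[OF d, where c="1 / t\<^sup>2" and a=x and x=z] assms
    by (simp add: power_add[of t 2 5, simplified] mult_ac)
qed

definition transport_test :: "real ^ 5 \<Rightarrow> real \<Rightarrow> real \<Rightarrow> real ^ 5 \<Rightarrow> 5 \<Rightarrow> real ^ 5 \<Rightarrow> real" where
  "transport_test v \<tau> r p i z = mollifier r p z * transport_field v \<tau> r p z $ i"

lemma smooth_fun_transport_field: "smooth_fun (\<lambda>z. transport_field v \<tau> r p z $ i)"
proof -
  have "(\<lambda>z. transport_field v \<tau> r p z $ i) = (\<lambda>z. v $ i - (\<tau> / r) * (p $ i - z $ i))"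
    by (auto simp: transport_field_def)
  then show ?thesis by (simp only:) (intro smooth_fun_intros smooth_fun_diff)
qed

lemma test_fun_transport_test:
  assumes "r > 0" "cball p r \<subseteq> G"
  shows "test_fun G (transport_test v \<tau> r p i)"
proof (rule test_funI[of _ "cball p r"])
  show "smooth_fun (transport_test v \<tau> r p i)"
    unfolding transport_test_def[abs_def]
    by (intro smooth_fun_intros smooth_fun_mollifier smooth_fun_transport_field)
  show "transport_test v \<tau> r p i z = 0" if "z \<notin> cball p r" for z
    using that mollifier_eq_0[of r p z] assms by (simp add: transport_test_def)
qed (use assms in auto)

lemma partial_deriv_transport_test:
  assumes "r > 0"
  shows "partial_deriv i (transport_test v \<tau> r p i) z =
    grad (mollifier r p) z $ i * transport_field v \<tau> r p z $ i + mollifier r p z * (\<tau> / r)"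
proof -
  have f: "((\<lambda>z. transport_field v \<tau> r p z $ i) has_derivative (\<lambda>h. ((\<tau> / r) *\<^sub>R axis i 1) \<bullet> h)) (at z)"
  proof -
    have n: "((\<lambda>z. z $ i) has_derivative (\<lambda>h. h $ i)) (at z)"
      by (rule bounded_linear_imp_has_derivative[OF bounded_linear_vec_nth])
    have "((\<lambda>z. v $ i - (\<tau> / r) * (p $ i - z $ i)) has_derivative (\<lambda>h. 0 - (\<tau> / r) * (0 - h $ i))) (at z)"
      by (intro has_derivative_diff has_derivative_const has_derivative_mult_right n)
    then show ?thesis by (simp add: transport_field_def inner_axis')
  qed
  have "((\<lambda>z. mollifier r p z * transport_field v \<tau> r p z $ i) has_derivative
    (\<lambda>h. (transport_field v \<tau> r p z $ i *\<^sub>R grad (mollifier r p) z + mollifier r p z *\<^sub>R ((\<tau> / r) *\<^sub>R axis i 1)) \<bullet> h)) (at z)"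
    by (rule has_derivative_eq_rhs[OF has_derivative_mult[OF smooth_fun_has_derivative[OF smooth_fun_mollifier] f]])
       (auto simp: inner_add_left)
  from partial_deriv_eqI[OF this, of i] show ?thesis
    unfolding transport_test_def[abs_def] by (simp add: mult_ac)
qed

text \<open>Continuity equation: the mollifier has constant mass and is carried along by the points
  of a ball whose centre moves with velocity v and whose radius grows at rate \<tau>. The divergence
  of that velocity field is 5 \<tau> / r, which accounts for the derivative of the
  normalisation.\<close>

lemma mollifier_rate_eq_divergence:
  assumes "r > 0"
  shows "(\<Sum>i\<in>UNIV. partial_deriv i (transport_test v \<tau> r p i) z) = - mollifier_rate v \<tau> r p z"
proof -
  define a where "a = flat_exp 2 (1 - (norm (z - p))\<^sup>2 / r\<^sup>2)"
  have "(\<Sum>i\<in>UNIV. partial_deriv i (transport_test v \<tau> r p i) z) =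
     grad (mollifier r p) z \<bullet> transport_field v \<tau> r p z + 5 * (mollifier r p z * (\<tau> / r))"
    by (simp add: partial_deriv_transport_test[OF assms] sum.distrib inner_vec_def)
  also have "grad (mollifier r p) z \<bullet> transport_field v \<tau> r p z =
      (- 2 * a / (mollifier_mass * r ^ 7)) * ((z - p) \<bullet> v + \<tau> / r * (norm (z - p))\<^sup>2)"
    proof -
    have "(z - p) \<bullet> (v - (\<tau> / r) *\<^sub>R (p - z)) = (z - p) \<bullet> v + \<tau> / r * (norm (z - p))\<^sup>2"
      unfolding power2_norm_eq_inner by (simp add: inner_diff_right inner_diff_left algebra_simps)
    then show ?thesis unfolding grad_mollifier[OF assms] transport_field_def a_def[symmetric] inner_scaleR_left by (rule arg_cong)
  qed
  finally have l: "(\<Sum>i\<in>UNIV. partial_deriv i (transport_test v \<tau> r p i) z) = \<dots> + 5 * (mollifier r p z * (\<tau> / r))"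
    by simp
  have alg: "(- 2 * a / (M * r ^ 7)) * (I + \<tau> / r * N) + 5 * (b / (M * r ^ 5) * (\<tau> / r)) =
    - ((1 / (M * r ^ 5)) * (a * (2 / r\<^sup>2 * I + 2 * \<tau> / r ^ 3 * N) - 5 * \<tau> / r * b))"
    if "M > 0" for M I N b :: real
    using assms that by (simp add: field_simps eval_nat_numeral)
  show ?thesis
    unfolding l mollifier_rate_def a_def[symmetric] mollifier_def by (rule alg[OF mollifier_mass_pos])
qed

lemma integrable_mult_bounded_support:
  fixes f h :: "'a::euclidean_space \<Rightarrow> real"
  assumes "set_integrable lborel K f" "f \<in> borel_measurable borel" "h \<in> borel_measurable borel"
    "\<And>z. \<bar>h z\<bar> \<le> B * indicator K z"
  shows "integrable lborel (\<lambda>z. f z * h z)"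
proof (rule Bochner_Integration.integrable_bound)
  show "integrable lborel (\<lambda>z. B * \<bar>indicator K z *\<^sub>R f z\<bar>)"
    using assms(1) unfolding set_integrable_def by (intro integrable_mult_right integrable_abs)
  show "AE z in lborel. norm (f z * h z) \<le> norm (B * \<bar>indicator K z *\<^sub>R f z\<bar>)"
  proof (rule AE_I2)
    fix z
    have "norm (f z * h z) \<le> \<bar>f z\<bar> * (B * indicator K z)"
      unfolding real_norm_def abs_mult by (intro mult_left_mono assms) auto
    also have "\<dots> = B * \<bar>indicator K z *\<^sub>R f z\<bar>" by (simp add: indicator_def)
    finally show "norm (f z * h z) \<le> norm (B * \<bar>indicator K z *\<^sub>R f z\<bar>)" by simp
  qed
qed (use assms in simp)

lemma continuous_compact_support_bound:
  fixes h :: "'a::euclidean_space \<Rightarrow> real"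
  assumes "compact K" "continuous_on UNIV h" "\<And>z. z \<notin> K \<Longrightarrow> h z = 0"
  obtains B where "\<And>z. \<bar>h z\<bar> \<le> B * indicator K z"
proof -
  have "bounded (h ` K)"
    using assms by (intro compact_imp_bounded compact_continuous_image) (auto intro: continuous_on_subset)
  then obtain B where "\<forall>z\<in>K. \<bar>h z\<bar> \<le> B" unfolding bounded_iff by auto
  with assms(3) have "\<bar>h z\<bar> \<le> B * indicator K z" for z by (cases "z \<in> K") auto
  with that show ?thesis by blast
qed

lemma partial_deriv_eq_grad: "partial_deriv i \<phi> x = grad \<phi> x $ i"
  by (simp add: grad_def)

lemma test_fun_integrable:
  fixes f :: "real ^ 'n \<Rightarrow> real"
  assumes "test_fun G \<phi>" "\<And>K. \<lbrakk>compact K; K \<subseteq> G\<rbrakk> \<Longrightarrow> set_integrable lborel K f" "f \<in> borel_measurable borel"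
  shows "integrable lborel (\<lambda>z. f z * \<phi> z)" "integrable lborel (\<lambda>z. f z * grad \<phi> z $ i)"
proof -
  obtain K where K: "compact K" "K \<subseteq> G" "smooth_fun \<phi>" "\<And>x. x \<notin> K \<Longrightarrow> \<phi> x = 0"
    "\<And>x. x \<notin> K \<Longrightarrow> grad \<phi> x = 0"
    using test_funD[OF assms(1)] by metis
  have c: "continuous_on UNIV \<phi>" "continuous_on UNIV (\<lambda>z. grad \<phi> z $ i)"
    using smooth_fun_continuous[OF K(3)] smooth_fun_continuous[OF smooth_fun_grad_nth[OF K(3)]] by auto
  obtain B1 where B1: "\<And>z. \<bar>\<phi> z\<bar> \<le> B1 * indicator K z"
    using continuous_compact_support_bound[OF K(1) c(1) K(4)] by auto
  obtain B2 where B2: "\<And>z. \<bar>grad \<phi> z $ i\<bar> \<le> B2 * indicator K z"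
    using continuous_compact_support_bound[OF K(1) c(2)] K(5) by auto
  show "integrable lborel (\<lambda>z. f z * \<phi> z)"
    by (rule integrable_mult_bounded_support[OF assms(2)[OF K(1,2)] assms(3) _ B1])
       (use c in \<open>auto intro: borel_measurable_continuous_onI\<close>)
  show "integrable lborel (\<lambda>z. f z * grad \<phi> z $ i)"
    by (rule integrable_mult_bounded_support[OF assms(2)[OF K(1,2)] assms(3) _ B2])
       (use c in \<open>auto intro: borel_measurable_continuous_onI\<close>)
qed

lemma borel_measurable_nth [measurable (raw)]:
  fixes g :: "'a \<Rightarrow> real ^ 'n"
  assumes "g \<in> borel_measurable M"
  shows "(\<lambda>x. g x $ i) \<in> borel_measurable M"
  using borel_measurable_inner[OF assms borel_measurable_const[of "axis i 1"]] by (simp add: inner_axis)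

lemma loc_weak_gradD:
  assumes "loc_weak_grad G f g"
  shows "f \<in> borel_measurable borel" "g \<in> borel_measurable borel"
    "\<And>K. \<lbrakk>compact K; K \<subseteq> G\<rbrakk> \<Longrightarrow> set_integrable lborel K f"
    "\<And>K. \<lbrakk>compact K; K \<subseteq> G\<rbrakk> \<Longrightarrow> set_integrable lborel K (\<lambda>x. g x $ i)"
    "\<And>K. \<lbrakk>compact K; K \<subseteq> G\<rbrakk> \<Longrightarrow> set_integrable lborel K (\<lambda>x. norm (g x))"
    "test_fun G \<phi> \<Longrightarrow> (\<integral>x. f x * partial_deriv i \<phi> x \<partial>lborel) = - (\<integral>x. g x $ i * \<phi> x \<partial>lborel)"
proof -
  show "f \<in> borel_measurable borel" and g: "g \<in> borel_measurable borel"
    "\<And>K. \<lbrakk>compact K; K \<subseteq> G\<rbrakk> \<Longrightarrow> set_integrable lborel K f"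
    "test_fun G \<phi> \<Longrightarrow> (\<integral>x. f x * partial_deriv i \<phi> x \<partial>lborel) = - (\<integral>x. g x $ i * \<phi> x \<partial>lborel)"
    using assms by (auto simp: loc_weak_grad_def)
  fix K assume K: "compact K" "K \<subseteq> G"
  then have "integrable lborel (\<lambda>x. indicator K x *\<^sub>R g x)"
    using assms by (auto simp: loc_weak_grad_def set_integrable_def)
  from integrable_norm[OF this] integrable_inner_left[OF this, of "axis i 1"]
  show "set_integrable lborel K (\<lambda>x. norm (g x))" "set_integrable lborel K (\<lambda>x. g x $ i)"
    by (simp_all add: set_integrable_def inner_axis)
qed

text \<open>Mean value theorem along the path, then integration by parts: by
  \<open>mollifier_rate_eq_divergence\<close> the s-derivative of the mollified function is the
  integral of g against the mollifier times the transport field. It has two uses: v = 0 changes only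
  the radius (\<open>mollify_step\<close>), \<tau> = 0 only the centre
  (\<open>mollify_lipschitz\<close>).\<close>

lemma mollify_path:
  assumes lw: "loc_weak_grad G f g" and K: "compact K" "K \<subseteq> G"
    and ball: "\<And>s. s \<in> {0..1} \<Longrightarrow> cball (x + s *\<^sub>R v) (t + s * \<tau>) \<subseteq> K"
    and r0: "0 < r0" "\<And>s. s \<in> {0..1} \<Longrightarrow> r0 \<le> t + s * \<tau>"
  obtains s where "s \<in> {0..1}" "\<bar>mollify f (t + \<tau>) (x + v) - mollify f t x\<bar> \<le>
    (norm v + \<bar>\<tau>\<bar>) / (mollifier_mass * r0 ^ 5) *
      (LINT z:cball (x + s *\<^sub>R v) (t + s * \<tau>)|lborel. norm (g z))"
proof -
  note lw' = loc_weak_gradD[OF lw]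
  note [measurable] = lw'(1,2)
  let ?r = "\<lambda>s. t + s * \<tau>" and ?p = "\<lambda>s. x + s *\<^sub>R v"
  define D where "D s = (\<integral>z. f z * mollifier_rate v \<tau> (?r s) (?p s) z \<partial>lborel)" for s
  have rpos: "?r s > 0" if "s \<in> {0..1}" for s using r0(1) r0(2)[OF that] by linarith
  define B where "B = (1 / (mollifier_mass * r0 ^ 5)) * ((4 * norm v + 9 * \<bar>\<tau>\<bar>) / r0)"
  have "B \<ge> 0" using mollifier_mass_pos r0 by (auto simp: B_def)
  have B: "\<bar>mollifier_rate v \<tau> (?r s) (?p s) z\<bar> \<le> B * indicator K z" if "s \<in> {0..1}" for s z
  proof -
    have "indicator (cball (?p s) (?r s)) z \<le> (indicator K z :: real)"
      using ball[OF that] by (auto simp: indicator_def)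
    from mult_left_mono[OF this \<open>B \<ge> 0\<close>] mollifier_rate_le[OF r0(1) r0(2)[OF that], of v \<tau> "?p s" z]
    show ?thesis by (simp add: B_def)
  qed
  have int: "integrable lborel (\<lambda>z. f z * mollifier (?r s) (?p s) z)" if "s \<in> {0..1}" for s
  proof (rule integrable_mult_bounded_support[OF lw'(3)[OF K]])
    fix z
    show "\<bar>mollifier (?r s) (?p s) z\<bar> \<le> 1 / (mollifier_mass * (?r s) ^ 5) * indicator K z"
    proof (cases "z \<in> K")
      case True
      with mollifier_le[OF rpos[OF that], of "?p s" z] mollifier_nonneg[OF rpos[OF that], of "?p s" z]
      show ?thesis using mollifier_mass_pos rpos[OF that]
        by (cases "z \<in> cball (?p s) (?r s)") auto
    next
      case False
      then have "z \<notin> cball (?p s) (?r s)" using ball[OF that] by blast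
      with False mollifier_eq_0[OF rpos[OF that], of "?p s" z] show ?thesis by simp
    qed
  qed simp_all
  have dm: "((\<lambda>s. mollify f (?r s) (?p s)) has_real_derivative D s) (at s within {0..1})" if "s \<in> {0..1}" for s
    unfolding mollify_def D_def
    by (rule has_derivative_integral_dominated[where K=K and B=B])
       (use that mollifier_has_rate rpos B int lw'(3)[OF K] in auto)
  obtain s where s: "s \<in> {0..1}" and eq: "mollify f (t + \<tau>) (x + v) - mollify f t x = D s"
    using mvt_very_simple[of 0 1 "\<lambda>s. mollify f (?r s) (?p s)" "\<lambda>s. (*) (D s)"] dm
    by (auto simp: has_field_derivative_def)
  let ?F = "transport_test v \<tau> (?r s) (?p s)"
  have tf: "test_fun G (?F i)" for i
    using rpos[OF s] ball[OF s] K(2) by (intro test_fun_transport_test) auto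
  have "D s = - (\<integral>z. (\<Sum>i\<in>UNIV. f z * partial_deriv i (?F i) z) \<partial>lborel)"
    unfolding D_def sum_distrib_left[symmetric] mollifier_rate_eq_divergence[OF rpos[OF s]] by simp
  also have "\<dots> = - (\<Sum>i\<in>UNIV. \<integral>z. f z * partial_deriv i (?F i) z \<partial>lborel)"
    using test_fun_integrable(2)[OF tf lw'(3) lw'(1)]
    by (subst Bochner_Integration.integral_sum) (auto simp: partial_deriv_eq_grad)
  also have "\<dots> = (\<Sum>i\<in>UNIV. \<integral>z. g z $ i * ?F i z \<partial>lborel)"
    by (simp add: lw'(6)[OF tf] sum_negf)
  also have "\<dots> = (\<integral>z. (\<Sum>i\<in>UNIV. g z $ i * ?F i z) \<partial>lborel)"
    by (subst Bochner_Integration.integral_sum) (auto intro!: test_fun_integrable(1)[OF tf lw'(4)])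
  finally have D: "D s = (\<integral>z. (\<Sum>i\<in>UNIV. g z $ i * ?F i z) \<partial>lborel)" .
  have i1: "integrable lborel (\<lambda>z. \<Sum>i\<in>UNIV. g z $ i * ?F i z)"
    by (intro Bochner_Integration.integrable_sum test_fun_integrable(1)[OF tf lw'(4)]) auto
  let ?B = "cball (?p s) (?r s)"
  define c where "c = (norm v + \<bar>\<tau>\<bar>) / (mollifier_mass * r0 ^ 5)"
  have i2: "integrable lborel (\<lambda>z. c * (indicator ?B z *\<^sub>R norm (g z)))"
    using lw'(5)[OF compact_cball, of "?p s" "?r s"] ball[OF s] K(2)
    unfolding set_integrable_def by (intro integrable_mult_right) auto
  have pw: "\<bar>\<Sum>i\<in>UNIV. g z $ i * ?F i z\<bar> \<le> c * (indicator ?B z *\<^sub>R norm (g z))" for z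
  proof -
    have e: "(\<Sum>i\<in>UNIV. g z $ i * ?F i z) = mollifier (?r s) (?p s) z * (g z \<bullet> transport_field v \<tau> (?r s) (?p s) z)"
      by (simp add: transport_test_def inner_vec_def sum_distrib_left mult_ac)
    show ?thesis
    proof (cases "z \<in> ?B")
      case True
      \<comment> \<open>Within the ball the distance to the centre is at most the radius, so the
        dilation part of the velocity is at most |\<tau>|.\<close>
      have "norm ((\<tau> / ?r s) *\<^sub>R (?p s - z)) = \<bar>\<tau>\<bar> / ?r s * dist (?p s) z"
        using rpos[OF s] by (simp add: dist_norm)
      also have "\<dots> \<le> \<bar>\<tau>\<bar> / ?r s * ?r s"
        using True rpos[OF s] by (intro mult_left_mono) auto
      also have "\<dots> = \<bar>\<tau>\<bar>" using rpos[OF s] by simp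
      finally have T: "norm (transport_field v \<tau> (?r s) (?p s) z) \<le> norm v + \<bar>\<tau>\<bar>"
        unfolding transport_field_def
        using norm_triangle_ineq4[of v "(\<tau> / ?r s) *\<^sub>R (?p s - z)"] by linarith
      have M: "mollifier (?r s) (?p s) z \<le> 1 / (mollifier_mass * r0 ^ 5)"
      proof -
        have "mollifier (?r s) (?p s) z \<le> 1 / (mollifier_mass * (?r s) ^ 5)"
          using mollifier_le[OF rpos[OF s], of "?p s" z] True by simp
        also have "\<dots> \<le> 1 / (mollifier_mass * r0 ^ 5)"
          using mollifier_mass_pos r0(1) r0(2)[OF s] rpos[OF s]
          by (intro divide_left_mono mult_left_mono power_mono) auto
        finally show ?thesis .
      qed
      have "\<bar>g z \<bullet> transport_field v \<tau> (?r s) (?p s) z\<bar> \<le> norm (g z) * (norm v + \<bar>\<tau>\<bar>)"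
        using Cauchy_Schwarz_ineq2 mult_left_mono[OF T norm_ge_zero] by (rule order.trans)
      then have "\<bar>\<Sum>i\<in>UNIV. g z $ i * ?F i z\<bar> \<le> 1 / (mollifier_mass * r0 ^ 5) * (norm (g z) * (norm v + \<bar>\<tau>\<bar>))"
        unfolding e abs_mult using M mollifier_nonneg[OF rpos[OF s], of "?p s" z] mollifier_mass_pos r0(1)
        by (intro mult_mono) auto
      with True show ?thesis by (simp add: c_def mult_ac)
    next
      case False
      with mollifier_eq_0[OF rpos[OF s], of "?p s" z] show ?thesis unfolding e by simp
    qed
  qed
  have "\<bar>D s\<bar> \<le> (\<integral>z. \<bar>\<Sum>i\<in>UNIV. g z $ i * ?F i z\<bar> \<partial>lborel)"
    unfolding D using integral_norm_bound[of lborel "\<lambda>z. \<Sum>i\<in>UNIV. g z $ i * ?F i z"] by simp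
  also have "\<dots> \<le> (\<integral>z. c * (indicator ?B z *\<^sub>R norm (g z)) \<partial>lborel)"
    using i1 i2 pw by (intro integral_mono integrable_abs) auto
  also have "\<dots> = c * (LINT z:?B|lborel. norm (g z))" by (simp add: set_lebesgue_integral_def)
  finally have "\<bar>D s\<bar> \<le> c * (LINT z:?B|lborel. norm (g z))" .
  with eq s that show thesis unfolding c_def by auto
qed

section \<open>Convergence of mollifications\<close>

lemma integrable_mult_mollifier:
  assumes "integrable lborel F" "t > 0"
  shows "integrable lborel (\<lambda>z. F z * mollifier t x z)"
proof (rule integrable_mult_bounded_support)
  show "set_integrable lborel (cball x t) F"
    using integrable_mult_indicator[OF _ assms(1), of "cball x t"] by (simp add: set_integrable_def)
  show "F \<in> borel_measurable borel" using assms(1) by simp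
  show "\<bar>mollifier t x z\<bar> \<le> 1 / (mollifier_mass * t ^ 5) * indicator (cball x t) z" for z
    using mollifier_le[OF assms(2)] mollifier_nonneg[OF assms(2)] by simp
qed simp

lemma mollifier_commute: "mollifier t x z = mollifier t z x"
  by (simp add: mollifier_def norm_minus_commute)

lemma mollifier_nn_integral_centre:
  assumes "t > 0"
  shows "(\<integral>\<^sup>+x. ennreal (mollifier t x z) \<partial>lborel) = 1"
  unfolding mollifier_commute[of t _ z]
  by (subst nn_integral_eq_integral[OF mollifier_integrable[OF assms]])
     (simp_all add: mollifier_nonneg[OF assms] mollifier_integral[OF assms])

text \<open>The kernel is symmetric in centre and argument, so it has mass 1 in the centre variable
  too; the rest is an exchange of the integrals.\<close>

lemma mollify_L1_contraction:
  assumes [measurable]: "F \<in> borel_measurable borel" and "t > 0"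
  shows "(\<integral>\<^sup>+x. \<integral>\<^sup>+z. ennreal \<bar>F z\<bar> * ennreal (mollifier t x z) \<partial>lborel \<partial>lborel) = (\<integral>\<^sup>+z. ennreal \<bar>F z\<bar> \<partial>lborel)"
proof -
  have "(\<integral>\<^sup>+x. \<integral>\<^sup>+z. ennreal \<bar>F z\<bar> * ennreal (mollifier t x z) \<partial>lborel \<partial>lborel) =
    (\<integral>\<^sup>+z. \<integral>\<^sup>+x. ennreal \<bar>F z\<bar> * ennreal (mollifier t x z) \<partial>lborel \<partial>lborel)"
    by (rule lborel_pair.Fubini'[symmetric]) measurable
  also have "\<dots> = (\<integral>\<^sup>+z. ennreal \<bar>F z\<bar> \<partial>lborel)"
    by (simp add: nn_integral_cmult mollifier_nn_integral_centre[OF assms(2)])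
  finally show ?thesis .
qed

text \<open>Clipping values at N and cutting off in space by \<theta> provides a multiple of the
  indicator of a ball as majorant, which turns a.e. convergence into L^1 convergence. The truncation
  is compared with F first, and then applied to continuous functions that converge to F a.e.\<close>

lemma L1_approx_continuous:
  fixes F :: "real ^ 5 \<Rightarrow> real"
  assumes F: "integrable lborel F" and "\<epsilon> > 0"
  obtains h R where "continuous_on UNIV h" "\<And>x. norm x > R \<Longrightarrow> h x = 0" "integrable lborel h"
    "(\<integral>\<^sup>+x. ennreal \<bar>F x - h x\<bar> \<partial>lborel) < ennreal \<epsilon>"
proof -
  define clip where "clip (N::real) y = max (- N) (min N y)" for N y :: real
  define \<theta> where "\<theta> (R::real) (x::real^5) = max 0 (min 1 (R + 1 - norm x))" for R x
  define H where "H N g x = \<theta> (real N) x * clip (real N) (g x)" for N and g :: "real ^ 5 \<Rightarrow> real" and x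
  have [measurable]: "F \<in> borel_measurable borel" using F by simp
  have tm [measurable]: "\<theta> R \<in> borel_measurable borel" for R unfolding \<theta>_def by measurable
  have cb: "\<bar>clip N y\<bar> \<le> \<bar>y\<bar>" "\<bar>clip N y\<bar> \<le> N" if "N \<ge> 0" for N y using that by (auto simp: clip_def)
  have tb: "0 \<le> \<theta> R x" "\<theta> R x \<le> 1" for R x by (auto simp: \<theta>_def)
  have 1: "(\<lambda>N. \<integral>x. \<bar>F x - H N F x\<bar> \<partial>lborel) \<longlonglongrightarrow> (\<integral>x. 0 \<partial>(lborel :: (real^5) measure))"
  proof (rule integral_dominated_convergence)
    show "integrable lborel (\<lambda>x. 2 * \<bar>F x\<bar>)" using F by auto
    show "(\<lambda>x. \<bar>F x - H N F x\<bar>) \<in> borel_measurable lborel" for N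
      unfolding H_def clip_def by measurable
    show "AE x in lborel. (\<lambda>N. \<bar>F x - H N F x\<bar>) \<longlonglongrightarrow> 0"
    proof (rule AE_I2)
      fix x
      have "eventually (\<lambda>N. real N > \<bar>F x\<bar> + norm x) sequentially"
        using filterlim_real_sequentially unfolding filterlim_at_top_dense by blast
      then have "eventually (\<lambda>N. \<bar>F x - H N F x\<bar> = 0) sequentially"
      proof eventually_elim
        case (elim N)
        then have "F x \<le> real N" "- real N \<le> F x" "1 \<le> real N + 1 - norm x"
          using norm_ge_zero[of x] abs_ge_self[of "F x"] abs_ge_minus_self[of "F x"] by linarith+
        then show ?case by (simp add: H_def \<theta>_def clip_def)
      qed
      then show "(\<lambda>N. \<bar>F x - H N F x\<bar>) \<longlonglongrightarrow> 0" by (rule tendsto_eventually)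
    qed
    show "AE x in lborel. norm \<bar>F x - H N F x\<bar> \<le> 2 * \<bar>F x\<bar>" for N
    proof (rule AE_I2)
      fix x
      have "\<bar>H N F x\<bar> \<le> 1 * \<bar>F x\<bar>" unfolding H_def abs_mult
        by (rule mult_mono) (use tb cb in auto)
      then show "norm \<bar>F x - H N F x\<bar> \<le> 2 * \<bar>F x\<bar>" by simp
    qed
  qed simp
  then have "eventually (\<lambda>N. (\<integral>x. \<bar>F x - H N F x\<bar> \<partial>lborel) < \<epsilon>/2) sequentially"
    by (rule order_tendstoD(2)) (use assms in simp)
  then obtain N where N: "(\<integral>x. \<bar>F x - H N F x\<bar> \<partial>lborel) < \<epsilon>/2"
    unfolding eventually_sequentially by blast
  have Hint: "integrable lborel (H N g)" if "g \<in> borel_measurable borel" for g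
  proof (rule Bochner_Integration.integrable_bound[OF integrable_mult_right[OF integrable_indicator_cball[of 0 "real N + 1"], of "real N"]])
    show "H N g \<in> borel_measurable lborel" using that unfolding H_def clip_def by measurable
    show "AE x in lborel. norm (H N g x) \<le> norm (real N * indicator (cball 0 (real N + 1)) x)"
    proof (rule AE_I2)
      fix x
      have "\<bar>H N g x\<bar> \<le> 1 * real N" unfolding H_def abs_mult
        by (rule mult_mono) (use tb cb in auto)
      then show "norm (H N g x) \<le> norm (real N * indicator (cball 0 (real N + 1)) x)"
        by (cases "norm x \<le> real N + 1") (auto simp: H_def \<theta>_def)
    qed
  qed
  \<comment> \<open>In the form \<open>measurable_on\<close>, measurability supplies continuous
    functions that converge to F off a negligible set.\<close>
  have "F \<in> borel_measurable (lebesgue_on UNIV)"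
    using measurable_completion[of F lborel borel] by (simp add: lebesgue_on_UNIV_eq)
  then have "F measurable_on UNIV"
    using measurable_on_iff_borel_measurable[of UNIV F] by simp
  then obtain M g where M: "negligible M" and g: "\<And>n. continuous_on UNIV (g n)"
    "\<And>x. x \<notin> M \<Longrightarrow> (\<lambda>n. g n x) \<longlonglongrightarrow> F x"
    unfolding measurable_on_def by auto
  have gm [measurable]: "g n \<in> borel_measurable borel" for n
    using g(1) by (rule borel_measurable_continuous_onI)
  have "AE x in lebesgue. x \<notin> M" using M by (simp add: negligible_iff_null_sets AE_not_in)
  then have "AE x in lborel. x \<notin> M" using AE_completion_iff by (metis (no_types, lifting) AE_completion_iff)
  then have ae: "AE x in lborel. (\<lambda>n. g n x) \<longlonglongrightarrow> F x" by eventually_elim (rule g)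
  have 2: "(\<lambda>n. \<integral>x. \<bar>H N F x - H N (g n) x\<bar> \<partial>lborel) \<longlonglongrightarrow> (\<integral>x. 0 \<partial>(lborel :: (real^5) measure))"
  proof (rule integral_dominated_convergence)
    show "integrable lborel (\<lambda>x. 2 * real N * indicator (cball (0 :: real^5) (real N + 1)) x)"
      by (intro integrable_mult_right integrable_indicator_cball)
    show "(\<lambda>x. \<bar>H N F x - H N (g n) x\<bar>) \<in> borel_measurable lborel" for n
      unfolding H_def clip_def by measurable
    show "AE x in lborel. (\<lambda>n. \<bar>H N F x - H N (g n) x\<bar>) \<longlonglongrightarrow> 0"
      using ae
    proof eventually_elim
      case (elim x)
      have "(\<lambda>n. \<bar>H N F x - H N (g n) x\<bar>) \<longlonglongrightarrow> \<bar>H N F x - H N F x\<bar>"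
        unfolding H_def clip_def by (intro tendsto_intros elim)
      then show ?case by simp
    qed
    show "AE x in lborel. norm \<bar>H N F x - H N (g n) x\<bar> \<le> 2 * real N * indicator (cball 0 (real N + 1)) x" for n
    proof (rule AE_I2)
      fix x
      have b: "\<bar>H N u x\<bar> \<le> real N * indicator (cball 0 (real N + 1)) x" for u
      proof -
        have "\<bar>H N u x\<bar> \<le> 1 * real N" unfolding H_def abs_mult
          by (rule mult_mono) (use tb cb in auto)
        then show ?thesis by (cases "norm x \<le> real N + 1") (auto simp: H_def \<theta>_def)
      qed
      show "norm \<bar>H N F x - H N (g n) x\<bar> \<le> 2 * real N * indicator (cball 0 (real N + 1)) x"
        using b[of F] b[of "g n"] by simp
    qed
  qed simp
  then have "eventually (\<lambda>n. (\<integral>x. \<bar>H N F x - H N (g n) x\<bar> \<partial>lborel) < \<epsilon>/2) sequentially"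
    by (rule order_tendstoD(2)) (use assms in simp)
  then obtain n where n: "(\<integral>x. \<bar>H N F x - H N (g n) x\<bar> \<partial>lborel) < \<epsilon>/2"
    unfolding eventually_sequentially by blast
  let ?h = "H N (g n)"
  have i: "integrable lborel ?h" "integrable lborel (H N F)" by (intro Hint; simp)+
  have "(\<integral>\<^sup>+x. ennreal \<bar>F x - ?h x\<bar> \<partial>lborel) = ennreal (\<integral>x. \<bar>F x - ?h x\<bar> \<partial>lborel)"
    using F i by (intro nn_integral_eq_integral) auto
  also have "(\<integral>x. \<bar>F x - ?h x\<bar> \<partial>lborel) \<le> (\<integral>x. \<bar>F x - H N F x\<bar> + \<bar>H N F x - ?h x\<bar> \<partial>lborel)"
    using F i by (intro integral_mono) auto
  also have "\<dots> = (\<integral>x. \<bar>F x - H N F x\<bar> \<partial>lborel) + (\<integral>x. \<bar>H N F x - ?h x\<bar> \<partial>lborel)"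
    using F i by (intro Bochner_Integration.integral_add) auto
  finally have "(\<integral>\<^sup>+x. ennreal \<bar>F x - ?h x\<bar> \<partial>lborel) \<le>
    ennreal ((\<integral>x. \<bar>F x - H N F x\<bar> \<partial>lborel) + (\<integral>x. \<bar>H N F x - ?h x\<bar> \<partial>lborel))"
    by (simp add: ennreal_leI)
  also have "\<dots> < ennreal \<epsilon>" using N n assms(2) by (intro ennreal_lessI) auto
  finally have "(\<integral>\<^sup>+x. ennreal \<bar>F x - ?h x\<bar> \<partial>lborel) < ennreal \<epsilon>" .
  moreover have "continuous_on UNIV ?h"
    unfolding H_def \<theta>_def clip_def by (intro continuous_intros g)
  moreover have "?h x = 0" if "norm x > real N + 1" for x using that by (simp add: H_def \<theta>_def)
  ultimately show thesis using that i(1) by blast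
qed

lemma mollify_measurable [measurable]:
  assumes [measurable]: "F \<in> borel_measurable borel"
  shows "mollify F t \<in> borel_measurable borel"
  unfolding mollify_def by measurable

lemma mollify_continuous_L1:
  assumes h: "continuous_on UNIV h" "\<And>x. norm x > R \<Longrightarrow> h x = 0" "integrable lborel h" and "\<epsilon> > 0"
  shows "\<exists>\<delta>>0. \<forall>t. 0 < t \<and> t < \<delta> \<longrightarrow> (\<integral>\<^sup>+x. ennreal \<bar>mollify h t x - h x\<bar> \<partial>lborel) \<le> ennreal \<epsilon>"
proof -
  \<comment> \<open>With this margin, if two points are at distance less than t < 1 and one of them
    lies outside B, then h vanishes at both.\<close>
  define B where "B = cball (0 :: real ^ 5) (\<bar>R\<bar> + 2)"
  define V where "V = measure lborel B"
  have V: "V \<ge> 0" by (simp add: V_def)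
  define \<eta> where "\<eta> = \<epsilon> / (V + 1)"
  have \<eta>: "\<eta> > 0" using V assms(4) by (simp add: \<eta>_def)
  have "uniformly_continuous_on B h"
    unfolding B_def by (rule compact_uniformly_continuous) (auto intro: continuous_on_subset[OF h(1)])
  then obtain d where d: "d > 0" "\<And>x y. x \<in> B \<Longrightarrow> y \<in> B \<Longrightarrow> dist y x < d \<Longrightarrow> dist (h y) (h x) < \<eta>"
    unfolding uniformly_continuous_on_def using \<eta> by metis
  have hm: "h \<in> borel_measurable borel" using h(3) by simp
  show ?thesis
  proof (intro exI[of _ "min d 1"] conjI allI impI)
    fix t assume t: "0 < t \<and> t < min d 1"
    have close: "\<bar>h z - h x\<bar> \<le> \<eta> * indicator B x" if "dist x z < t" for x z
    proof (cases "x \<in> B \<and> z \<in> B")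
      case True
      with d(2)[of x z] that t show ?thesis by (auto simp: dist_norm norm_minus_commute)
    next
      case False
      have "norm x > \<bar>R\<bar> \<and> norm z > \<bar>R\<bar>"
        using False that t norm_triangle_ineq2[of x z] norm_triangle_ineq2[of z x]
        by (auto simp: B_def dist_norm norm_minus_commute)
      then show ?thesis using h(2)[of x] h(2)[of z] \<eta> by auto
    qed
    have pw: "\<bar>mollify h t x - h x\<bar> \<le> \<eta> * indicator B x" for x
    proof -
      have i1: "integrable lborel (\<lambda>z. h z * mollifier t x z)"
        using integrable_mult_mollifier[OF h(3)] t by auto
      have i2: "integrable lborel (\<lambda>z. h x * mollifier t x z)"
        using mollifier_integrable t by (intro integrable_mult_right) auto
      have "h x = (\<integral>z. h x * mollifier t x z \<partial>lborel)" using mollifier_integral t by simp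
      then have "mollify h t x - h x = (\<integral>z. h z * mollifier t x z - h x * mollifier t x z \<partial>lborel)"
        unfolding mollify_def using Bochner_Integration.integral_diff[OF i1 i2] by simp
      also have "\<bar>\<dots>\<bar> \<le> (\<integral>z. \<bar>h z * mollifier t x z - h x * mollifier t x z\<bar> \<partial>lborel)"
        using integral_norm_bound[of lborel "\<lambda>z. h z * mollifier t x z - h x * mollifier t x z"] by simp
      also have "\<dots> \<le> (\<integral>z. (\<eta> * indicator B x) * mollifier t x z \<partial>lborel)"
      proof (rule integral_mono)
        show "integrable lborel (\<lambda>z. \<bar>h z * mollifier t x z - h x * mollifier t x z\<bar>)" using i1 i2 by auto
        show "integrable lborel (\<lambda>z. \<eta> * indicator B x * mollifier t x z)"
          using mollifier_integrable t by (intro integrable_mult_right) auto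
        fix z
        have e: "\<bar>h z * mollifier t x z - h x * mollifier t x z\<bar> = \<bar>h z - h x\<bar> * mollifier t x z"
          using mollifier_nonneg[of t x z] t by (simp add: left_diff_distrib[symmetric] abs_mult)
        show "\<bar>h z * mollifier t x z - h x * mollifier t x z\<bar> \<le> \<eta> * indicator B x * mollifier t x z"
        proof (cases "dist x z < t")
          case True
          then show ?thesis unfolding e using close[OF True] mollifier_nonneg[of t x z] t
            by (intro mult_right_mono) auto
        next
          case False
          then show ?thesis using mollifier_eq_0[of t x z] t by simp
        qed
      qed
      also have "\<dots> = \<eta> * indicator B x" using mollifier_integral t by simp
      finally show ?thesis .
    qed
    have "(\<integral>\<^sup>+x. ennreal \<bar>mollify h t x - h x\<bar> \<partial>lborel) \<le> (\<integral>\<^sup>+x. ennreal (\<eta> * indicator B x) \<partial>lborel)"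
      by (intro nn_integral_mono ennreal_leI pw)
    also have "\<dots> = ennreal (\<integral>x. \<eta> * indicator B x \<partial>lborel)"
      unfolding B_def using \<eta> by (intro nn_integral_eq_integral integrable_mult_right integrable_indicator_cball) auto
    also have "\<dots> \<le> ennreal \<epsilon>"
      using V assms(4) by (auto simp: V_def[symmetric] \<eta>_def field_simps intro!: ennreal_leI)
    finally show "(\<integral>\<^sup>+x. ennreal \<bar>mollify h t x - h x\<bar> \<partial>lborel) \<le> ennreal \<epsilon>" .
  qed (use d in simp)
qed

lemma mollify_tendsto_L1:
  assumes F: "integrable lborel F" and "\<epsilon> > 0"
  shows "\<exists>\<delta>>0. \<forall>t. 0 < t \<and> t < \<delta> \<longrightarrow> (\<integral>\<^sup>+x. ennreal \<bar>mollify F t x - F x\<bar> \<partial>lborel) \<le> ennreal \<epsilon>"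
proof -
  obtain h R where h: "continuous_on UNIV h" "\<And>x. norm x > R \<Longrightarrow> h x = 0" "integrable lborel h"
    and Fh: "(\<integral>\<^sup>+x. ennreal \<bar>F x - h x\<bar> \<partial>lborel) < ennreal (\<epsilon>/3)"
    using L1_approx_continuous[OF F, of "\<epsilon>/3"] assms(2) by auto
  obtain \<delta> where \<delta>: "\<delta> > 0" "\<And>t. 0 < t \<Longrightarrow> t < \<delta> \<Longrightarrow>
    (\<integral>\<^sup>+x. ennreal \<bar>mollify h t x - h x\<bar> \<partial>lborel) \<le> ennreal (\<epsilon>/3)"
    using mollify_continuous_L1[of h R "\<epsilon>/3", OF h(1) h(2) h(3)] assms(2) by auto
  have [measurable]: "F \<in> borel_measurable borel" "h \<in> borel_measurable borel" using F h(3) by auto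
  show ?thesis
  proof (intro exI[of _ \<delta>] conjI allI impI \<delta>(1))
    fix t assume t: "0 < t \<and> t < \<delta>"
    let ?D = "\<lambda>x. \<integral>\<^sup>+z. ennreal \<bar>F z - h z\<bar> * ennreal (mollifier t x z) \<partial>lborel"
    have d: "ennreal \<bar>mollify F t x - mollify h t x\<bar> \<le> ?D x" for x
    proof -
      have i: "integrable lborel (\<lambda>z. F z * mollifier t x z)" "integrable lborel (\<lambda>z. h z * mollifier t x z)"
        using integrable_mult_mollifier F h(3) t by auto
      have "ennreal \<bar>mollify F t x - mollify h t x\<bar> =
          ennreal (norm (\<integral>z. F z * mollifier t x z - h z * mollifier t x z \<partial>lborel))"
        unfolding mollify_def using Bochner_Integration.integral_diff[OF i] by simp
      also have "\<dots> \<le> (\<integral>\<^sup>+z. ennreal (norm (F z * mollifier t x z - h z * mollifier t x z)) \<partial>lborel)"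
        using i by (intro integral_norm_bound_ennreal) auto
      also have "\<dots> = ?D x"
        using mollifier_nonneg t
        by (intro nn_integral_cong) (simp add: left_diff_distrib[symmetric] abs_mult ennreal_mult)
      finally show ?thesis .
    qed
    have "(\<integral>\<^sup>+x. ennreal \<bar>mollify F t x - F x\<bar> \<partial>lborel) \<le>
      (\<integral>\<^sup>+x. (?D x + ennreal \<bar>mollify h t x - h x\<bar>) + ennreal \<bar>F x - h x\<bar> \<partial>lborel)"
    proof (rule nn_integral_mono)
      fix x
      have "ennreal \<bar>mollify F t x - F x\<bar> \<le> ennreal (\<bar>mollify F t x - mollify h t x\<bar> + \<bar>mollify h t x - h x\<bar> + \<bar>F x - h x\<bar>)"
        by (rule ennreal_leI) simp
      also have "\<dots> = ennreal \<bar>mollify F t x - mollify h t x\<bar> + ennreal \<bar>mollify h t x - h x\<bar> + ennreal \<bar>F x - h x\<bar>"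
        by simp
      also have "\<dots> \<le> ?D x + ennreal \<bar>mollify h t x - h x\<bar> + ennreal \<bar>F x - h x\<bar>"
        by (intro add_right_mono d)
      finally show "ennreal \<bar>mollify F t x - F x\<bar> \<le> ?D x + ennreal \<bar>mollify h t x - h x\<bar> + ennreal \<bar>F x - h x\<bar>" .
    qed
    also have "\<dots> = (\<integral>\<^sup>+x. ?D x \<partial>lborel) + (\<integral>\<^sup>+x. ennreal \<bar>mollify h t x - h x\<bar> \<partial>lborel) + (\<integral>\<^sup>+x. ennreal \<bar>F x - h x\<bar> \<partial>lborel)"
      by (simp add: nn_integral_add)
    also have "\<dots> \<le> ennreal (\<epsilon>/3) + ennreal (\<epsilon>/3) + ennreal (\<epsilon>/3)"
      using Fh \<delta>(2)[of t] t mollify_L1_contraction[of "\<lambda>z. F z - h z" t] by (intro add_mono) auto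
    also have "\<dots> = ennreal \<epsilon>" using assms(2) by (simp add: ennreal_plus[symmetric] del: ennreal_plus)
    finally show "(\<integral>\<^sup>+x. ennreal \<bar>mollify F t x - F x\<bar> \<partial>lborel) \<le> ennreal \<epsilon>" .
  qed
qed

lemma mollify_integrable:
  assumes "integrable lborel F" "t > 0"
  shows "integrable lborel (mollify F t)"
proof (rule integrableI_bounded)
  have [measurable]: "F \<in> borel_measurable borel" using assms by auto
  show "mollify F t \<in> borel_measurable lborel" by simp
  have "(\<integral>\<^sup>+x. ennreal (norm (mollify F t x)) \<partial>lborel) \<le>
      (\<integral>\<^sup>+x. \<integral>\<^sup>+z. ennreal \<bar>F z\<bar> * ennreal (mollifier t x z) \<partial>lborel \<partial>lborel)"
  proof (rule nn_integral_mono)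
    fix x
    have "ennreal (norm (mollify F t x)) \<le> (\<integral>\<^sup>+z. ennreal (norm (F z * mollifier t x z)) \<partial>lborel)"
      unfolding mollify_def by (rule integral_norm_bound_ennreal[OF integrable_mult_mollifier[OF assms]])
    also have "\<dots> = (\<integral>\<^sup>+z. ennreal \<bar>F z\<bar> * ennreal (mollifier t x z) \<partial>lborel)"
      using mollifier_nonneg[OF assms(2)]
      by (intro nn_integral_cong) (simp add: abs_mult ennreal_mult)
    finally show "ennreal (norm (mollify F t x)) \<le> \<dots>" .
  qed
  also have "\<dots> = (\<integral>\<^sup>+z. ennreal \<bar>F z\<bar> \<partial>lborel)" by (rule mollify_L1_contraction) (use assms in auto)
  also have "\<dots> < \<infinity>" using assms(1) by (simp add: integrable_iff_bounded)
  finally show "(\<integral>\<^sup>+x. ennreal (norm (mollify F t x)) \<partial>lborel) < \<infinity>" .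
qed

text \<open>L^1 convergence yields a.e. convergence along a subsequence, and that is the form in
  which \<open>telescoping_bound\<close> takes its limit. Cutting f off to K makes it integrable and
  is not seen from points of S at radii up to t.\<close>

lemma mollify_AE_tendsto:
  assumes f: "set_integrable lborel K f" and S: "\<And>x. x \<in> S \<Longrightarrow> cball x t \<subseteq> K"
    and \<tau>: "\<And>k. 0 < \<tau> k" "\<And>k. \<tau> k \<le> t" "\<tau> \<longlonglongrightarrow> (0::real)"
  obtains r :: "nat \<Rightarrow> nat" where "strict_mono r"
    "AE x in lborel. x \<in> S \<longrightarrow> (\<lambda>k. mollify f (\<tau> (r k)) x) \<longlonglongrightarrow> f x"
proof -
  define F where "F x = indicator K x *\<^sub>R f x" for x
  have F: "integrable lborel F" using f by (simp add: F_def[abs_def] set_integrable_def)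
  define u where "u k x = mollify F (\<tau> k) x - F x" for k x
  have ui: "integrable lborel (u k)" for k
    unfolding u_def by (intro Bochner_Integration.integrable_diff F mollify_integrable \<tau>)
  have "(\<lambda>k. \<integral>x. norm (u k x) \<partial>lborel) \<longlonglongrightarrow> 0"
  proof (rule LIMSEQ_I)
    fix \<epsilon> :: real assume "\<epsilon> > 0"
    then obtain \<delta> where \<delta>: "\<delta> > 0" "\<And>t. 0 < t \<Longrightarrow> t < \<delta> \<Longrightarrow>
      (\<integral>\<^sup>+x. ennreal \<bar>mollify F t x - F x\<bar> \<partial>lborel) \<le> ennreal (\<epsilon>/2)"
      using mollify_tendsto_L1[OF F, of "\<epsilon>/2"] by auto
    obtain N where N: "\<And>n. n \<ge> N \<Longrightarrow> \<tau> n < \<delta>"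
      using order_tendstoD(2)[OF \<tau>(3) \<delta>(1)] by (auto simp: eventually_sequentially)
    have "(\<integral>x. norm (u k x) \<partial>lborel) \<le> \<epsilon>/2" if "k \<ge> N" for k
    proof -
      have "ennreal (\<integral>x. norm (u k x) \<partial>lborel) = (\<integral>\<^sup>+x. ennreal (norm (u k x)) \<partial>lborel)"
        using ui by (intro nn_integral_eq_integral[symmetric]) auto
      also have "\<dots> \<le> ennreal (\<epsilon>/2)" unfolding u_def real_norm_def by (rule \<delta>(2)[OF \<tau>(1) N[OF that]])
      finally show ?thesis using \<open>\<epsilon> > 0\<close> by (subst (asm) ennreal_le_iff) auto
    qed
    then show "\<exists>no. \<forall>n\<ge>no. norm ((\<integral>x. norm (u n x) \<partial>lborel) - 0) < \<epsilon>"
      using \<open>\<epsilon> > 0\<close> by (intro exI[of _ N]) (force simp: integral_nonneg_AE)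
  qed
  from tendsto_L1_AE_subseq[OF ui this] obtain r where r: "strict_mono r"
    and ae: "AE x in lborel. (\<lambda>n. u (r n) x) \<longlonglongrightarrow> 0" by blast
  from ae have "AE x in lborel. x \<in> S \<longrightarrow> (\<lambda>k. mollify f (\<tau> (r k)) x) \<longlonglongrightarrow> f x"
  proof eventually_elim
    case (elim x)
    show ?case
    proof
      assume x: "x \<in> S"
      have "t > 0" using \<tau>(1,2)[of 0] by linarith
      with S[OF x] have "x \<in> K" by auto
      have eq: "mollify F (\<tau> k) x = mollify f (\<tau> k) x" for k
        unfolding mollify_def
      proof (rule Bochner_Integration.integral_cong[OF refl])
        fix z
        show "F z * mollifier (\<tau> k) x z = f z * mollifier (\<tau> k) x z"
        proof (cases "z \<in> K")
          case False
          then have "z \<notin> cball x t" using S[OF x] by blast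
          then have "\<tau> k \<le> dist x z" using \<tau>(2)[of k] by simp
          with mollifier_eq_0[OF \<tau>(1)] show ?thesis by simp
        qed (simp add: F_def)
      qed
      have "(\<lambda>k. u (r k) x + F x) \<longlonglongrightarrow> 0 + F x" by (intro tendsto_intros elim)
      then show "(\<lambda>k. mollify f (\<tau> (r k)) x) \<longlonglongrightarrow> f x"
        using \<open>x \<in> K\<close> by (simp add: u_def eq F_def)
    qed
  qed
  with r that show thesis by blast
qed

section \<open>Square integrability on sets and balls\<close>

lemma set_integral_Cauchy_Schwarz:
  fixes g :: "'a::euclidean_space \<Rightarrow> 'b::euclidean_space"
  assumes "set_integrable lborel B (\<lambda>z. (norm (g z))\<^sup>2)"
    and [measurable]: "g \<in> borel_measurable borel" "B \<in> sets borel" and fin: "emeasure lborel B < \<infinity>"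
  shows "set_integrable lborel B (\<lambda>z. norm (g z))"
    "(LINT z:B|lborel. norm (g z))\<^sup>2 \<le> measure lborel B * (LINT z:B|lborel. (norm (g z))\<^sup>2)"
proof -
  have iB: "integrable lborel (indicator B :: _ \<Rightarrow> real)" using fin by (intro integrable_real_indicator) auto
  have i2: "integrable lborel (\<lambda>z. indicator B z * (norm (g z))\<^sup>2)"
    using assms(1) by (simp add: set_integrable_def)
  have i1: "integrable lborel (\<lambda>z. indicator B z * norm (g z))"
  proof (rule Bochner_Integration.integrable_bound[OF Bochner_Integration.integrable_add[OF iB i2]])
    show "AE z in lborel. norm (indicator B z * norm (g z)) \<le> norm (indicator B z + indicator B z * (norm (g z))\<^sup>2)"
    proof (rule AE_I2)
      fix z
      have "2 * norm (g z) \<le> (norm (g z))\<^sup>2 + 1" using sum_squares_bound[of "norm (g z)" 1] by simp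
      then have "norm (g z) \<le> 1 + (norm (g z))\<^sup>2" using norm_ge_zero[of "g z"] by linarith
      then show "norm (indicator B z * norm (g z)) \<le> norm (indicator B z + indicator B z * (norm (g z))\<^sup>2)"
        by (auto simp: indicator_def)
    qed
  qed simp
  then show "set_integrable lborel B (\<lambda>z. norm (g z))" by (simp add: set_integrable_def)
  define I1 I2 V where "I1 = (LINT z:B|lborel. norm (g z))" and "I2 = (LINT z:B|lborel. (norm (g z))\<^sup>2)"
    and "V = measure lborel B"
  \<comment> \<open>The integral of (|g| - a)^2 is nonnegative for every a. The choice a = I1 / V
    gives the claim; for V = 0 the expression is affine in a, which forces I1 = 0.\<close>
  have q: "0 \<le> I2 - 2 * a * I1 + a\<^sup>2 * V" for a
  proof -
    have "0 \<le> (\<integral>z. indicator B z * (norm (g z) - a)\<^sup>2 \<partial>lborel)" by (intro integral_nonneg_AE) auto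
    also have "\<dots> = (\<integral>z. (indicator B z * (norm (g z))\<^sup>2 - 2 * a * (indicator B z * norm (g z))) + a\<^sup>2 * indicator B z \<partial>lborel)"
      by (intro Bochner_Integration.integral_cong) (auto simp: power2_eq_square algebra_simps)
    also have "\<dots> = I2 - 2 * a * I1 + a\<^sup>2 * V"
      using iB i1 i2 by (simp add: I1_def I2_def V_def set_lebesgue_integral_def)
    finally show ?thesis .
  qed
  have "I1\<^sup>2 \<le> V * I2"
  proof (cases "V = 0")
    case True
    have "I1 = 0"
    proof (rule ccontr)
      assume "I1 \<noteq> 0"
      then show False using q[of "(I2 + 1) / (2 * I1)"] True by (simp add: field_simps)
    qed
    then show ?thesis using True by simp
  next
    case False
    then have "V > 0" by (simp add: V_def zero_less_measure_iff)
    then show ?thesis using q[of "I1 / V"] by (simp add: field_simps power2_eq_square)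
  qed
  then show "(LINT z:B|lborel. norm (g z))\<^sup>2 \<le> measure lborel B * (LINT z:B|lborel. (norm (g z))\<^sup>2)"
    by (simp add: I1_def I2_def V_def)
qed

definition ball_const :: real where "ball_const = measure lborel (cball (0 :: real ^ 5) 1)"

lemma ball_const_pos: "ball_const > 0"
  unfolding ball_const_def by (rule content_cball_pos) simp

lemma measure_cball_5: "0 \<le> r \<Longrightarrow> measure lborel (cball (x :: real ^ 5) r) = ball_const * r ^ 5"
  using content_cball[of r x] content_cball[of 1 "0 :: real ^ 5"] by (simp add: ball_const_def)

definition L2_le :: "(real ^ 5) set \<Rightarrow> (real ^ 5 \<Rightarrow> 'b::euclidean_space) \<Rightarrow> real \<Rightarrow> bool" where
  "L2_le K g e \<longleftrightarrow> g \<in> borel_measurable borel \<and> 0 \<le> e \<and> K \<in> sets borel \<and>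
     (\<integral>\<^sup>+x\<in>K. ennreal ((norm (g x))\<^sup>2) \<partial>lborel) \<le> ennreal (e\<^sup>2)"

lemma L2_le_set_integrable:
  assumes "L2_le K g e" "B \<subseteq> K" "B \<in> sets borel"
  shows "set_integrable lborel B (\<lambda>z. (norm (g z))\<^sup>2)" "(LINT z:B|lborel. (norm (g z))\<^sup>2) \<le> e\<^sup>2"
    "(\<integral>\<^sup>+x\<in>B. ennreal ((norm (g x))\<^sup>2) \<partial>lborel) = ennreal (LINT z:B|lborel. (norm (g z))\<^sup>2)"
proof -
  have [measurable]: "g \<in> borel_measurable borel" "B \<in> sets borel" using assms by (auto simp: L2_le_def)
  have "(\<integral>\<^sup>+x\<in>B. ennreal ((norm (g x))\<^sup>2) \<partial>lborel) \<le> (\<integral>\<^sup>+x\<in>K. ennreal ((norm (g x))\<^sup>2) \<partial>lborel)"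
    using assms(2) by (intro nn_integral_mono) (auto simp: indicator_def)
  also have "\<dots> \<le> ennreal (e\<^sup>2)" using assms(1) by (simp add: L2_le_def)
  finally have b: "(\<integral>\<^sup>+x\<in>B. ennreal ((norm (g x))\<^sup>2) \<partial>lborel) \<le> ennreal (e\<^sup>2)" .
  have eq: "(\<integral>\<^sup>+x. ennreal (indicator B x * (norm (g x))\<^sup>2) \<partial>lborel) = (\<integral>\<^sup>+x\<in>B. ennreal ((norm (g x))\<^sup>2) \<partial>lborel)"
    by (intro nn_integral_cong) (auto simp: indicator_def)
  have i: "integrable lborel (\<lambda>x. indicator B x * (norm (g x))\<^sup>2)"
  proof (rule integrableI_bounded)
    have "(\<integral>\<^sup>+x. ennreal (norm (indicator B x * (norm (g x))\<^sup>2)) \<partial>lborel) = (\<integral>\<^sup>+x\<in>B. ennreal ((norm (g x))\<^sup>2) \<partial>lborel)"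
      unfolding eq[symmetric] by (intro nn_integral_cong) simp
    then show "(\<integral>\<^sup>+x. ennreal (norm (indicator B x * (norm (g x))\<^sup>2)) \<partial>lborel) < \<infinity>"
      using b by (auto intro: order.strict_trans1)
  qed simp
  then show si: "set_integrable lborel B (\<lambda>z. (norm (g z))\<^sup>2)" by (simp add: set_integrable_def)
  show e: "(\<integral>\<^sup>+x\<in>B. ennreal ((norm (g x))\<^sup>2) \<partial>lborel) = ennreal (LINT z:B|lborel. (norm (g z))\<^sup>2)"
    using nn_integral_eq_integral[OF i] unfolding eq by (simp add: set_lebesgue_integral_def)
  show "(LINT z:B|lborel. (norm (g z))\<^sup>2) \<le> e\<^sup>2"
    using b unfolding e by (subst (asm) ennreal_le_iff) auto
qed

lemma L2_le_mono: "L2_le K g e \<Longrightarrow> B \<subseteq> K \<Longrightarrow> B \<in> sets borel \<Longrightarrow> e \<le> e' \<Longrightarrow> L2_le B g e'"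
  unfolding L2_le_def
proof (intro conjI; (elim conjE)?)
  assume a: "B \<subseteq> K" "e \<le> e'" "0 \<le> e" "(\<integral>\<^sup>+x\<in>K. ennreal ((norm (g x))\<^sup>2) \<partial>lborel) \<le> ennreal (e\<^sup>2)"
  have "(\<integral>\<^sup>+x\<in>B. ennreal ((norm (g x))\<^sup>2) \<partial>lborel) \<le> (\<integral>\<^sup>+x\<in>K. ennreal ((norm (g x))\<^sup>2) \<partial>lborel)"
    using a by (intro nn_integral_mono) (auto simp: indicator_def)
  also note a(4)
  also have "ennreal (e\<^sup>2) \<le> ennreal (e'\<^sup>2)" using a by (intro ennreal_leI power_mono) auto
  finally show "(\<integral>\<^sup>+x\<in>B. ennreal ((norm (g x))\<^sup>2) \<partial>lborel) \<le> ennreal (e'\<^sup>2)" .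
qed auto

lemma L2_le_cball:
  assumes "L2_le K g e" "cball x r \<subseteq> K" "0 \<le> r"
  shows "set_integrable lborel (cball x r) (\<lambda>z. norm (g z))"
    "(LINT z:cball x r|lborel. norm (g z))\<^sup>2 \<le> ball_const * r ^ 5 * (LINT z:cball x r|lborel. (norm (g z))\<^sup>2)"
    "(LINT z:cball x r|lborel. norm (g z)) \<le> sqrt (ball_const * r ^ 5) * e"
proof -
  have f: "emeasure lborel (cball x r) < \<infinity>" using emeasure_lborel_cball_finite[of x r] by simp
  have g: "g \<in> borel_measurable borel" "0 \<le> e" using assms by (auto simp: L2_le_def)
  note si = L2_le_set_integrable(1,2)[OF assms(1,2)]
  note cs = set_integral_Cauchy_Schwarz[OF si(1) g(1) _ f, unfolded measure_cball_5[OF assms(3)]]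
  show "set_integrable lborel (cball x r) (\<lambda>z. norm (g z))" by (rule cs) auto
  show c2: "(LINT z:cball x r|lborel. norm (g z))\<^sup>2 \<le> ball_const * r ^ 5 * (LINT z:cball x r|lborel. (norm (g z))\<^sup>2)"
    by (rule cs) auto
  have "(LINT z:cball x r|lborel. norm (g z)) \<le> sqrt (ball_const * r ^ 5 * e\<^sup>2)"
  proof (rule real_le_rsqrt, rule order.trans[OF c2])
    show "ball_const * r ^ 5 * (LINT z:cball x r|lborel. (norm (g z))\<^sup>2) \<le> ball_const * r ^ 5 * e\<^sup>2"
      using ball_const_pos assms(3) si(2) by (intro mult_left_mono) auto
  qed
  then show "(LINT z:cball x r|lborel. norm (g z)) \<le> sqrt (ball_const * r ^ 5) * e"
    using g(2) by (simp add: real_sqrt_mult)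
qed

text \<open>Taking cube roots gives |d (Suc k) - d k| \<le> X / 2^k, and the geometric series sums
  to 2 X. A limit along r is enough because |d n - d 0| is bounded for all n alike.\<close>

lemma telescoping_bound:
  fixes d :: "nat \<Rightarrow> real"
  assumes "X \<ge> 0" "\<And>k. 8 ^ k * \<bar>d (Suc k) - d k\<bar> ^ 3 \<le> X ^ 3"
    and "(\<lambda>k. d (r k)) \<longlonglongrightarrow> L"
  shows "\<bar>L - d 0\<bar> \<le> 2 * X"
proof -
  have s: "\<bar>d (Suc k) - d k\<bar> \<le> X * (1/2) ^ k" for k
  proof -
    have "(2 ^ k * \<bar>d (Suc k) - d k\<bar>) ^ 3 = 8 ^ k * \<bar>d (Suc k) - d k\<bar> ^ 3"
      by (simp add: power_mult_distrib power_mult[symmetric] mult.commute[of k] power_mult[of "2::real" 3])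
    with assms(2)[of k] have "(2 ^ k * \<bar>d (Suc k) - d k\<bar>) ^ 3 \<le> X ^ 3" by simp
    then have "2 ^ k * \<bar>d (Suc k) - d k\<bar> \<le> X" using assms(1) by (rule power_le_imp_le_base[of _ 2, simplified]) 
    then show ?thesis by (simp add: field_simps power_divide)
  qed
  have b: "\<bar>d n - d 0\<bar> \<le> 2 * X * (1 - (1/2) ^ n)" for n
  proof (induction n)
    case (Suc n)
    with s[of n] show ?case by (simp add: algebra_simps)
  qed simp
  have "\<bar>d n - d 0\<bar> \<le> 2 * X" for n
  proof -
    have "2 * X * (1 - (1/2) ^ n) \<le> 2 * X" using assms(1) by (simp add: algebra_simps)
    with b[of n] show ?thesis by linarith
  qed
  then have ev: "\<forall>k. \<bar>d (r k) - d 0\<bar> \<le> 2 * X" by blast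
  have "(\<lambda>k. \<bar>d (r k) - d 0\<bar>) \<longlonglongrightarrow> \<bar>L - d 0\<bar>" by (intro tendsto_intros assms(3))
  then show ?thesis by (rule LIMSEQ_le_const2) (use ev in auto)
qed

section \<open>Local Sobolev estimates\<close>

text \<open>256 ^ 5 stems from the least radius t / 256 on the path in \<open>mollify_step\<close>,
  where the kernel is largest; the exponent 3 from cubing the increment; the power 3/2 of
  \<open>ball_const\<close> from three applications of Cauchy-Schwarz on a ball.\<close>

definition mollify_const :: real where
  "mollify_const = (256 ^ 5 / mollifier_mass) ^ 3 * (ball_const * sqrt ball_const)"

lemma mollify_const_pos: "mollify_const > 0"
  using mollifier_mass_pos ball_const_pos by (simp add: mollify_const_def)

text \<open>Let I be the integral of |g| over the ball and write I^3 = I^2 I. In I^2 Cauchy-Schwarz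
  retains the local square integral, which is later integrated over x; the remaining factor is
  estimated by the global e. The powers of t add up to 3 (-4) + 5 + 5/2 = 1/2 - 5.\<close>

lemma mollify_step:
  assumes lw: "loc_weak_grad G f g" and K: "compact K" "K \<subseteq> G" and e: "L2_le K g e"
    and x: "cball x t \<subseteq> K" and t: "t > 0"
  shows "\<bar>mollify f (t / 256) x - mollify f t x\<bar> ^ 3 \<le>
    mollify_const * sqrt t / t ^ 5 * e * (LINT z:cball x t|lborel. (norm (g z))\<^sup>2)"
proof -
  define \<tau> where "\<tau> = t / 256 - t"
  define I J where "I = (LINT z:cball x t|lborel. norm (g z))" and "J = (LINT z:cball x t|lborel. (norm (g z))\<^sup>2)"
  have rad: "t / 256 \<le> t + s * \<tau>" "t + s * \<tau> \<le> t" if "s \<in> {0..1}" for s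
  proof -
    have "0 \<le> s * t" "s * t \<le> 1 * t" using that t by (auto intro: mult_right_mono)
    then show "t / 256 \<le> t + s * \<tau>" "t + s * \<tau> \<le> t" by (auto simp: \<tau>_def algebra_simps)
  qed
  have e0: "0 \<le> e" using e by (simp add: L2_le_def)
  note ball = L2_le_cball[OF e x less_imp_le[OF t], folded I_def J_def]
  have "I \<ge> 0" unfolding I_def set_lebesgue_integral_def by (intro integral_nonneg_AE) auto
  obtain s where s: "s \<in> {0..1}" and b: "\<bar>mollify f (t + \<tau>) (x + 0) - mollify f t x\<bar> \<le>
    (norm (0 :: real^5) + \<bar>\<tau>\<bar>) / (mollifier_mass * (t / 256) ^ 5) *
      (LINT z:cball (x + s *\<^sub>R 0) (t + s * \<tau>)|lborel. norm (g z))"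
  proof (rule mollify_path[OF lw K])
    show "cball (x + s *\<^sub>R 0) (t + s * \<tau>) \<subseteq> K" if "s \<in> {0..1}" for s
      using rad(2)[OF that] x subset_cball[of "t + s * \<tau>" t x] by auto
    show "0 < t / 256" using t by simp
    show "t / 256 \<le> t + s * \<tau>" if "s \<in> {0..1}" for s by (rule rad[OF that])
  qed blast
  have "(LINT z:cball (x + s *\<^sub>R 0) (t + s * \<tau>)|lborel. norm (g z)) \<le> I"
    unfolding I_def set_lebesgue_integral_def
  proof (rule integral_mono)
    have sub: "cball x (t + s * \<tau>) \<subseteq> cball x t" using rad(2)[OF s] by (rule subset_cball)
    have "set_integrable lborel (cball x (t + s * \<tau>)) (\<lambda>z. norm (g z))"
      by (rule set_integrable_subset[OF ball(1) _ sub]) simp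
    then show "integrable lborel (\<lambda>z. indicator (cball (x + s *\<^sub>R 0) (t + s * \<tau>)) z *\<^sub>R norm (g z))"
      by (simp add: set_integrable_def)
    show "integrable lborel (\<lambda>z. indicator (cball x t) z *\<^sub>R norm (g z))"
      using ball(1) by (simp add: set_integrable_def)
    show "indicator (cball (x + s *\<^sub>R 0) (t + s * \<tau>)) z *\<^sub>R norm (g z) \<le> indicator (cball x t) z *\<^sub>R norm (g z)" for z
      using sub by (auto simp: indicator_def)
  qed
  moreover have "\<bar>\<tau>\<bar> / (mollifier_mass * (t / 256) ^ 5) \<le> t / (mollifier_mass * (t / 256) ^ 5)"
    using t mollifier_mass_pos by (intro divide_right_mono) (auto simp: \<tau>_def)
  moreover have "0 \<le> (LINT z:cball (x + s *\<^sub>R 0) (t + s * \<tau>)|lborel. norm (g z))"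
    unfolding set_lebesgue_integral_def by (intro integral_nonneg_AE) auto
  moreover have "0 \<le> \<bar>\<tau>\<bar> / (mollifier_mass * (t / 256) ^ 5)" "0 \<le> t / (mollifier_mass * (t / 256) ^ 5)"
    using t mollifier_mass_pos by auto
  ultimately have "\<bar>\<tau>\<bar> / (mollifier_mass * (t / 256) ^ 5) *
      (LINT z:cball (x + s *\<^sub>R 0) (t + s * \<tau>)|lborel. norm (g z)) \<le> t / (mollifier_mass * (t / 256) ^ 5) * I"
    by (intro mult_mono) auto
  moreover have t': "t + \<tau> = t / 256" by (simp add: \<tau>_def)
  ultimately have "\<bar>mollify f (t / 256) x - mollify f t x\<bar> \<le> t / (mollifier_mass * (t / 256) ^ 5) * I"
    using b[unfolded t'] by simp
  also have "\<dots> = 256 ^ 5 / mollifier_mass / t ^ 4 * I" using t by (simp add: field_simps eval_nat_numeral)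
  finally have b1: "\<bar>mollify f (t / 256) x - mollify f t x\<bar> \<le> 256 ^ 5 / mollifier_mass / t ^ 4 * I" .
  have J: "J \<ge> 0" unfolding J_def set_lebesgue_integral_def by (intro integral_nonneg_AE) auto
  have "I ^ 3 = I\<^sup>2 * I" by (simp add: power2_eq_square power3_eq_cube)
  also have "\<dots> \<le> (ball_const * t ^ 5 * J) * (sqrt (ball_const * t ^ 5) * e)"
    using ball(2,3) \<open>I \<ge> 0\<close> J ball_const_pos t by (intro mult_mono) auto
  also have "sqrt (ball_const * t ^ 5) = sqrt ball_const * (t\<^sup>2 * sqrt t)"
  proof -
    have "t ^ 5 = t ^ 4 * t" by (simp add: eval_nat_numeral)
    moreover have "sqrt (t ^ 4) = t\<^sup>2" by (rule real_sqrt_unique) auto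
    ultimately show ?thesis by (simp add: real_sqrt_mult)
  qed
  finally have I3: "I ^ 3 \<le> (ball_const * t ^ 5 * J) * (sqrt ball_const * (t\<^sup>2 * sqrt t) * e)" .
  have "\<bar>mollify f (t / 256) x - mollify f t x\<bar> ^ 3 \<le> (256 ^ 5 / mollifier_mass / t ^ 4 * I) ^ 3"
    using b1 by (intro power_mono) auto
  also have "\<dots> = (256 ^ 5 / mollifier_mass / t ^ 4) ^ 3 * I ^ 3" by (rule power_mult_distrib)
  also have "\<dots> \<le> (256 ^ 5 / mollifier_mass / t ^ 4) ^ 3 * ((ball_const * t ^ 5 * J) * (sqrt ball_const * (t\<^sup>2 * sqrt t) * e))"
    using I3 t mollifier_mass_pos by (intro mult_left_mono) auto
  also have "\<dots> = mollify_const * sqrt t / t ^ 5 * e * J"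
  proof -
    have "(a / t ^ 4) ^ 3 * ((b * t ^ 5 * J) * (c * (t\<^sup>2 * d) * e)) = a ^ 3 * (b * c) * d / t ^ 5 * e * J" for a b c d
      using t by (simp add: field_simps eval_nat_numeral)
    then show ?thesis unfolding mollify_const_def by blast
  qed
  finally show ?thesis unfolding J_def .
qed

text \<open>By Fubini: the centres x whose ball of radius t contains a given z form a ball around z,
  of volume \<open>ball_const * t ^ 5\<close>.\<close>

lemma ball_average_integral_le:
  assumes e: "L2_le K g e" and S [measurable]: "S \<in> sets borel" and SK: "\<And>x. x \<in> S \<Longrightarrow> cball x t \<subseteq> K" and t: "t > 0"
  shows "(\<integral>\<^sup>+x\<in>S. ennreal (LINT z:cball x t|lborel. (norm (g z))\<^sup>2) \<partial>lborel) \<le> ennreal (ball_const * t ^ 5 * e\<^sup>2)"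
proof -
  have [measurable]: "g \<in> borel_measurable borel" "K \<in> sets borel" using e by (auto simp: L2_le_def)
  have "(\<integral>\<^sup>+x\<in>S. ennreal (LINT z:cball x t|lborel. (norm (g z))\<^sup>2) \<partial>lborel) \<le>
    (\<integral>\<^sup>+x. \<integral>\<^sup>+z. indicator {..t} (dist x z) * (ennreal ((norm (g z))\<^sup>2) * indicator K z) \<partial>lborel \<partial>lborel)"
  proof (rule nn_integral_mono)
    fix x
    show "ennreal (LINT z:cball x t|lborel. (norm (g z))\<^sup>2) * indicator S x \<le>
      (\<integral>\<^sup>+z. indicator {..t} (dist x z) * (ennreal ((norm (g z))\<^sup>2) * indicator K z) \<partial>lborel)"
    proof (cases "x \<in> S")
      case True
      have "ennreal (LINT z:cball x t|lborel. (norm (g z))\<^sup>2) = (\<integral>\<^sup>+z\<in>cball x t. ennreal ((norm (g z))\<^sup>2) \<partial>lborel)"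
        using L2_le_set_integrable(3)[OF e SK[OF True]] by simp
      also have "\<dots> = (\<integral>\<^sup>+z. indicator {..t} (dist x z) * (ennreal ((norm (g z))\<^sup>2) * indicator K z) \<partial>lborel)"
        using SK[OF True] by (intro nn_integral_cong) (auto simp: indicator_def)
      finally show ?thesis using True by simp
    qed simp
  qed
  also have "\<dots> = (\<integral>\<^sup>+z. \<integral>\<^sup>+x. indicator {..t} (dist x z) * (ennreal ((norm (g z))\<^sup>2) * indicator K z) \<partial>lborel \<partial>lborel)"
    by (rule lborel_pair.Fubini'[symmetric]) measurable
  also have "\<dots> = (\<integral>\<^sup>+z. ennreal (ball_const * t ^ 5) * (ennreal ((norm (g z))\<^sup>2) * indicator K z) \<partial>lborel)"
  proof (rule nn_integral_cong)
    fix z :: "real ^ 5"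
    have "(\<integral>\<^sup>+x. indicator {..t} (dist x z) * (ennreal ((norm (g z))\<^sup>2) * indicator K z) \<partial>lborel) =
      (\<integral>\<^sup>+x. indicator (cball z t) x \<partial>lborel) * (ennreal ((norm (g z))\<^sup>2) * indicator K z)"
      by (subst nn_integral_multc[symmetric]) (auto intro!: nn_integral_cong borel_measurable_indicator simp: indicator_def dist_commute)
    also have "(\<integral>\<^sup>+x. indicator (cball z t) x \<partial>lborel) = ennreal (ball_const * t ^ 5)"
      using emeasure_lborel_cball_finite[of z t] measure_cball_5[of t z] t
      by (subst nn_integral_indicator) (auto simp: emeasure_eq_ennreal_measure)
    finally show "(\<integral>\<^sup>+x. indicator {..t} (dist x z) * (ennreal ((norm (g z))\<^sup>2) * indicator K z) \<partial>lborel) =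
      ennreal (ball_const * t ^ 5) * (ennreal ((norm (g z))\<^sup>2) * indicator K z)" .
  qed
  also have "\<dots> = ennreal (ball_const * t ^ 5) * (\<integral>\<^sup>+z\<in>K. ennreal ((norm (g z))\<^sup>2) \<partial>lborel)"
    by (rule nn_integral_cmult) measurable
  also have "\<dots> \<le> ennreal (ball_const * t ^ 5) * ennreal (e\<^sup>2)"
    using e by (intro mult_left_mono) (auto simp: L2_le_def)
  also have "\<dots> = ennreal (ball_const * t ^ 5 * e\<^sup>2)"
    using ball_const_pos t by (simp add: ennreal_mult)
  finally show ?thesis .
qed

text \<open>Substitute for the Sobolev embedding: telescoping over the radii \<open>t / 256\<^sup>k\<close>, the \<open>k\<close>-th
  increment has cubed \<open>L\<^sup>3\<close> norm of order \<open>16\<^sup>-\<^sup>k\<close>, which beats the weight \<open>8\<^sup>k\<close> needed to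
  sum the increments pointwise.\<close>

lemma mollify_L3:
  assumes lw: "loc_weak_grad G f g" and K: "compact K" "K \<subseteq> G" and e: "L2_le K g e"
    and S [measurable]: "S \<in> sets borel" and SK: "\<And>x. x \<in> S \<Longrightarrow> cball x t \<subseteq> K" and t: "t > 0"
  shows "(\<integral>\<^sup>+x\<in>S. ennreal (\<bar>f x - mollify f t x\<bar> ^ 3) \<partial>lborel) \<le>
    ennreal (16 * mollify_const * ball_const * sqrt t * e ^ 3)"
proof -
  note lw' = loc_weak_gradD[OF lw]
  have [measurable]: "f \<in> borel_measurable borel" by (rule lw')
  have e0: "0 \<le> e" using e by (simp add: L2_le_def)
  define tk where "tk k = t / 256 ^ k" for k :: nat
  have tk: "0 < tk k" "tk k \<le> t" "tk (Suc k) = tk k / 256" for k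
  proof -
    have "1 \<le> (256::real) ^ k" by (rule one_le_power) simp
    with t show "tk k \<le> t" by (simp add: tk_def divide_le_eq mult_le_cancel_left1)
  qed (use t in \<open>simp_all add: tk_def\<close>)
  have tk0: "tk \<longlonglongrightarrow> 0"
  proof -
    have "(\<lambda>k. t * (1/256) ^ k) \<longlonglongrightarrow> t * 0" by (intro tendsto_intros LIMSEQ_power_zero) auto
    then show ?thesis by (simp add: tk_def[abs_def] power_divide)
  qed
  \<comment> \<open>This explains the ratio 256: its square root is 16 = 8 * 2, so after
    multiplication by the weight 8^k a summable factor (1/2)^k is left.\<close>
  have stk: "8 ^ k * sqrt (tk k) = sqrt t * (1/2) ^ k" for k
  proof -
    have "(256::real) ^ k = (16 ^ k)\<^sup>2" by (simp add: power2_eq_square power_mult_distrib[symmetric])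
    then have "sqrt (tk k) = sqrt t / 16 ^ k" by (simp add: tk_def real_sqrt_divide)
    moreover have "(16::real) ^ k = 8 ^ k * 2 ^ k" by (simp add: power_mult_distrib[symmetric])
    ultimately show ?thesis by (simp add: power_divide)
  qed
  define D where "D k x = 8 ^ k * \<bar>mollify f (tk (Suc k)) x - mollify f (tk k) x\<bar> ^ 3" for k x
  have D0: "D k x \<ge> 0" for k x by (simp add: D_def)
  have [measurable]: "D k \<in> borel_measurable borel" for k unfolding D_def by measurable
  have Dint: "(\<integral>\<^sup>+x\<in>S. ennreal (D k x) \<partial>lborel) \<le> ennreal (mollify_const * ball_const * sqrt t * e ^ 3 * (1/2) ^ k)" for k
  proof -
    define c where "c = 8 ^ k * (mollify_const * sqrt (tk k) / tk k ^ 5 * e)"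
    have c: "c \<ge> 0" using mollify_const_pos tk(1)[of k] e0 by (simp add: c_def)
    have SKk: "x \<in> S \<Longrightarrow> cball x (tk k) \<subseteq> K" for x using SK[of x] subset_cball[OF tk(2), of x k] by blast
    have "(\<integral>\<^sup>+x\<in>S. ennreal (D k x) \<partial>lborel) \<le>
      (\<integral>\<^sup>+x. ennreal c * (ennreal (LINT z:cball x (tk k)|lborel. (norm (g z))\<^sup>2) * indicator S x) \<partial>lborel)"
    proof (rule nn_integral_mono)
      fix x
      show "ennreal (D k x) * indicator S x \<le> ennreal c * (ennreal (LINT z:cball x (tk k)|lborel. (norm (g z))\<^sup>2) * indicator S x)"
      proof (cases "x \<in> S")
        case True
        have "D k x \<le> c * (LINT z:cball x (tk k)|lborel. (norm (g z))\<^sup>2)"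
          unfolding D_def tk(3) c_def mult.assoc[of "8 ^ k"]
          by (intro mult_left_mono mollify_step[OF lw K e SKk[OF True] tk(1)]) auto
        then have "ennreal (D k x) \<le> ennreal c * ennreal (LINT z:cball x (tk k)|lborel. (norm (g z))\<^sup>2)"
          using c by (simp add: ennreal_mult'[symmetric] ennreal_leI)
        with True show ?thesis by simp
      qed simp
    qed
    also have "\<dots> \<le> ennreal c * (\<integral>\<^sup>+x\<in>S. ennreal (LINT z:cball x (tk k)|lborel. (norm (g z))\<^sup>2) \<partial>lborel)"
    proof (rule eq_refl, rule nn_integral_cmult)
      have [measurable]: "g \<in> borel_measurable borel" by (rule lw')
      have "(\<lambda>x. LINT z:cball x (tk k)|lborel. (norm (g z))\<^sup>2) = (\<lambda>x. \<integral>z. indicator {..tk k} (dist x z) * (norm (g z))\<^sup>2 \<partial>lborel)"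
        unfolding set_lebesgue_integral_def
        by (intro ext Bochner_Integration.integral_cong) (auto simp: indicator_def)
      moreover have "\<dots> \<in> borel_measurable lborel" by measurable
      ultimately have [measurable]: "(\<lambda>x. LINT z:cball x (tk k)|lborel. (norm (g z))\<^sup>2) \<in> borel_measurable lborel" by simp
      show "(\<lambda>x. ennreal (LINT z:cball x (tk k)|lborel. (norm (g z))\<^sup>2) * indicator S x) \<in> borel_measurable lborel"
        by measurable
    qed
    also have "\<dots> \<le> ennreal c * ennreal (ball_const * tk k ^ 5 * e\<^sup>2)"
      by (intro mult_left_mono ball_average_integral_le[OF e S SKk tk(1)]) auto
    also have "\<dots> = ennreal (c * (ball_const * tk k ^ 5 * e\<^sup>2))" using c by (simp add: ennreal_mult')
    also have "c * (ball_const * tk k ^ 5 * e\<^sup>2) = mollify_const * ball_const * (8 ^ k * sqrt (tk k)) * e ^ 3"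
      using tk(1)[of k] by (simp add: c_def power2_eq_square power3_eq_cube)
    finally show ?thesis unfolding stk by (simp add: mult_ac)
  qed
  obtain r where r: "strict_mono r" and ae: "AE x in lborel. x \<in> S \<longrightarrow> (\<lambda>k. mollify f (tk (r k)) x) \<longlonglongrightarrow> f x"
    using mollify_AE_tendsto[OF lw'(3)[OF K] SK tk(1,2) tk0] by blast
  have "(\<integral>\<^sup>+x\<in>S. ennreal (\<bar>f x - mollify f t x\<bar> ^ 3) \<partial>lborel) \<le>
    (\<integral>\<^sup>+x. 8 * ((\<Sum>k. ennreal (D k x)) * indicator S x) \<partial>lborel)"
  proof (rule nn_integral_mono_AE)
    show "AE x in lborel. ennreal (\<bar>f x - mollify f t x\<bar> ^ 3) * indicator S x \<le> 8 * ((\<Sum>k. ennreal (D k x)) * indicator S x)"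
      using ae
    proof eventually_elim
      case (elim x)
      have "ennreal (\<bar>f x - mollify f t x\<bar> ^ 3) \<le> 8 * (\<Sum>k. ennreal (D k x))" if x: "x \<in> S"
      proof (cases "(\<Sum>k. ennreal (D k x)) = \<infinity>")
        case True
        then show ?thesis by simp
      next
        case False
        then obtain Y where Y: "Y \<ge> 0" "(\<Sum>k. ennreal (D k x)) = ennreal Y"
          by (cases "\<Sum>k. ennreal (D k x)") auto
        have le: "D k x \<le> Y" for k
        proof -
          have "ennreal (D k x) = (\<Sum>j\<in>{k}. ennreal (D j x))" by simp
          also have "\<dots> \<le> (\<Sum>k. ennreal (D k x))" by (rule sum_le_suminf) auto
          finally have "ennreal (D k x) \<le> (\<Sum>k. ennreal (D k x))" .
          then show ?thesis unfolding Y(2) using Y(1) by simp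
        qed
        \<comment> \<open>Every weighted increment is at most the sum Y of all of them, so the cube
          root of Y is an admissible X in \<open>telescoping_bound\<close>.\<close>
        define X where "X = root 3 Y"
        have X: "X \<ge> 0" "X ^ 3 = Y" using Y(1) by (auto simp: X_def)
        have "\<bar>f x - mollify f (tk 0) x\<bar> \<le> 2 * X"
        proof (rule telescoping_bound[where d="\<lambda>k. mollify f (tk k) x" and r=r])
          show "8 ^ k * \<bar>mollify f (tk (Suc k)) x - mollify f (tk k) x\<bar> ^ 3 \<le> X ^ 3" for k
            using le[of k] unfolding D_def X(2) .
        qed (use X(1) elim x in simp_all)
        then have "\<bar>f x - mollify f t x\<bar> ^ 3 \<le> (2 * X) ^ 3" by (intro power_mono) (auto simp: tk_def)
        also have "\<dots> = 8 * Y" using X by (simp add: power_mult_distrib)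
        finally have "ennreal (\<bar>f x - mollify f t x\<bar> ^ 3) \<le> ennreal (8 * Y)" by (rule ennreal_leI)
        then show ?thesis using Y by (simp add: ennreal_mult)
      qed
      then show ?case by (cases "x \<in> S") auto
    qed
  qed
  also have "\<dots> = 8 * (\<integral>\<^sup>+x. (\<Sum>k. ennreal (D k x) * indicator S x) \<partial>lborel)"
    by (simp only: ennreal_suminf_multc, rule nn_integral_cmult) measurable
  finally have A: "(\<integral>\<^sup>+x\<in>S. ennreal (\<bar>f x - mollify f t x\<bar> ^ 3) \<partial>lborel) \<le>
    8 * (\<integral>\<^sup>+x. (\<Sum>k. ennreal (D k x) * indicator S x) \<partial>lborel)" .
  have "(\<integral>\<^sup>+x. (\<Sum>k. ennreal (D k x) * indicator S x) \<partial>lborel) = (\<Sum>k. \<integral>\<^sup>+x. ennreal (D k x) * indicator S x \<partial>lborel)"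
    by (rule nn_integral_suminf) measurable
  also have "\<dots> \<le> (\<Sum>k. ennreal (mollify_const * ball_const * sqrt t * e ^ 3 * (1/2) ^ k))"
    by (rule suminf_le[OF Dint]) auto
  \<comment> \<open>The geometric series contributes 2 and the cubed constant of
    \<open>telescoping_bound\<close> contributes 8, hence the 16 of the claim.\<close>
  also have "\<dots> = ennreal (mollify_const * ball_const * sqrt t * e ^ 3 * 2)"
  proof -
    define c where "c = mollify_const * ball_const * sqrt t * e ^ 3"
    have c: "0 \<le> c" using mollify_const_pos ball_const_pos t e0 by (simp add: c_def)
    have "(\<lambda>k. (1/2 :: real) ^ k) sums 2" using geometric_sums[of "1/2 :: real"] by simp
    then have "(\<lambda>k. c * (1/2) ^ k) sums (c * 2)" by (rule sums_mult)
    then show ?thesis unfolding c_def[symmetric] by (intro suminf_ennreal_eq) (use c in auto)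
  qed
  finally have "(\<integral>\<^sup>+x. (\<Sum>k. ennreal (D k x) * indicator S x) \<partial>lborel) \<le>
    ennreal (mollify_const * ball_const * sqrt t * e ^ 3 * 2)" .
  from mult_left_mono[OF this, of "ennreal 8"]
  have "8 * (\<integral>\<^sup>+x. (\<Sum>k. ennreal (D k x) * indicator S x) \<partial>lborel) \<le>
    ennreal 8 * ennreal (mollify_const * ball_const * sqrt t * e ^ 3 * 2)"
    by simp
  also have "\<dots> = ennreal (8 * (mollify_const * ball_const * sqrt t * e ^ 3 * 2))"
    by (rule ennreal_mult'[symmetric]) simp
  also have "8 * (mollify_const * ball_const * sqrt t * e ^ 3 * 2) = 16 * mollify_const * ball_const * sqrt t * e ^ 3"
    by simp
  finally show ?thesis using A by (rule order.trans[rotated])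
qed

lemma mollify_lipschitz:
  assumes lw: "loc_weak_grad G f g" and K: "compact K" "K \<subseteq> G" and e: "L2_le K g e" and t: "t > 0"
    and seg: "\<And>s. s \<in> {0..1} \<Longrightarrow> cball (x + s *\<^sub>R (y - x)) t \<subseteq> K"
  shows "\<bar>mollify f t y - mollify f t x\<bar> \<le> dist x y / (mollifier_mass * t ^ 5) * (sqrt (ball_const * t ^ 5) * e)"
proof -
  obtain s where s: "s \<in> {0..1}" and b: "\<bar>mollify f (t + 0) (x + (y - x)) - mollify f t x\<bar> \<le>
    (norm (y - x) + \<bar>0\<bar>) / (mollifier_mass * t ^ 5) *
      (LINT z:cball (x + s *\<^sub>R (y - x)) (t + s * 0)|lborel. norm (g z))"
    by (rule mollify_path[OF lw K, of x "y - x" t 0 t]) (use seg t in auto)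
  have "(LINT z:cball (x + s *\<^sub>R (y - x)) t|lborel. norm (g z)) \<le> sqrt (ball_const * t ^ 5) * e"
    by (rule L2_le_cball[OF e seg[OF s]]) (use t in auto)
  then show ?thesis
    using b t mollifier_mass_pos
    by (intro order.trans[OF b[simplified]]) (auto simp: dist_norm norm_minus_commute intro!: mult_left_mono divide_right_mono)
qed

lemma mollify_abs_le:
  assumes e: "L2_le K f e" and t: "t > 0" and x: "cball x t \<subseteq> K"
  shows "\<bar>mollify f t x\<bar> \<le> 1 / (mollifier_mass * t ^ 5) * (sqrt (ball_const * t ^ 5) * e)"
proof -
  have [measurable]: "f \<in> borel_measurable borel" using e by (simp add: L2_le_def)
  have i: "integrable lborel (\<lambda>z. indicator (cball x t) z *\<^sub>R norm (f z))"
    using L2_le_cball(1)[OF e x] t by (simp add: set_integrable_def)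
  let ?c = "1 / (mollifier_mass * t ^ 5)"
  have pw: "\<bar>f z * mollifier t x z\<bar> \<le> ?c * (indicator (cball x t) z *\<^sub>R norm (f z))" for z
  proof -
    have "\<bar>f z * mollifier t x z\<bar> = \<bar>f z\<bar> * mollifier t x z" using mollifier_nonneg[OF t] by (simp add: abs_mult)
    also have "\<dots> \<le> \<bar>f z\<bar> * (?c * indicator (cball x t) z)" by (intro mult_left_mono mollifier_le t) auto
    finally show ?thesis by (simp add: mult_ac)
  qed
  have im: "integrable lborel (\<lambda>z. f z * mollifier t x z)"
    by (rule Bochner_Integration.integrable_bound[OF integrable_mult_right[OF i, of ?c]])
       (use pw order.trans[OF pw abs_ge_self] in auto)
  have "\<bar>mollify f t x\<bar> \<le> (\<integral>z. \<bar>f z * mollifier t x z\<bar> \<partial>lborel)"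
    unfolding mollify_def using integral_norm_bound[of lborel "\<lambda>z. f z * mollifier t x z"] by simp
  also have "\<dots> \<le> (\<integral>z. ?c * (indicator (cball x t) z *\<^sub>R norm (f z)) \<partial>lborel)"
    using im i pw by (intro integral_mono integrable_abs integrable_mult_right) auto
  also have "\<dots> = ?c * (LINT z:cball x t|lborel. norm (f z))" by (simp add: set_lebesgue_integral_def)
  also have "\<dots> \<le> ?c * (sqrt (ball_const * t ^ 5) * e)"
    using t mollifier_mass_pos by (intro mult_left_mono L2_le_cball[OF e x]) auto
  finally show ?thesis .
qed

section \<open>Head-pressure systems\<close>

text \<open>The bounds refer to the squared norm because (norm x)^2, unlike norm x, is smooth
  everywhere and is what the radial cutoffs are composed with.\<close>

definition shell :: "real \<Rightarrow> real \<Rightarrow> (real ^ 5) set" where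
  "shell p q = {x. p \<le> (norm x)\<^sup>2 \<and> (norm x)\<^sup>2 \<le> q}"

lemma shell_measurable [measurable]: "shell p q \<in> sets borel"
  unfolding shell_def by measurable

lemma shell_mono: "p' \<le> p \<Longrightarrow> q \<le> q' \<Longrightarrow> shell p q \<subseteq> shell p' q'"
  by (auto simp: shell_def)

lemma compact_shell: "compact (shell p q)"
proof -
  have "shell p q \<subseteq> cball 0 (sqrt q)"
    by (auto simp: shell_def real_le_rsqrt)
  moreover have "closed (shell p q)"
    unfolding shell_def by (intro closed_Collect_conj closed_Collect_le continuous_intros)
  ultimately show ?thesis
    by (metis bounded_cball bounded_subset compact_eq_bounded_closed)
qed

lemma shell_avoids_0: "0 < p \<Longrightarrow> shell p q \<subseteq> UNIV - {0}"
  by (auto simp: shell_def)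

lemma shell_subset_ball: "q < r\<^sup>2 \<Longrightarrow> 0 < r \<Longrightarrow> shell p q \<subseteq> ball 0 r"
proof
  fix x assume a: "q < r\<^sup>2" "0 < r" "x \<in> shell p q"
  then have "(norm x)\<^sup>2 < r\<^sup>2" by (auto simp: shell_def)
  then have "norm x < r" by (rule power_less_imp_less_base) (use a in simp)
  then show "x \<in> ball 0 r" by simp
qed

text \<open>The difference of the squares is (|z| - |x|) (|z| + |x|), and 9 bounds the second
  factor: |x| \<le> 4 because q \<le> 16, and |z| \<le> 5.\<close>

lemma shell_thicken:
  assumes "x \<in> shell p q" "q \<le> 16" "0 \<le> t" "t \<le> 1"
  shows "cball x t \<subseteq> shell (p - 9 * t) (q + 9 * t)"
proof
  fix z assume "z \<in> cball x t"
  then have d: "\<bar>norm z - norm x\<bar> \<le> t"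
    using norm_triangle_ineq3[of z x] by (simp add: dist_norm norm_minus_commute)
  have "(norm x)\<^sup>2 \<le> 4\<^sup>2" using assms by (auto simp: shell_def)
  then have x: "norm x \<le> 4" by (rule power2_le_imp_le) simp
  have "\<bar>(norm z)\<^sup>2 - (norm x)\<^sup>2\<bar> = \<bar>norm z - norm x\<bar> * (norm z + norm x)"
  proof -
    have "(norm z)\<^sup>2 - (norm x)\<^sup>2 = (norm z - norm x) * (norm z + norm x)"
      by (simp add: power2_eq_square algebra_simps)
    then show ?thesis by (simp only: abs_mult) simp
  qed
  also have "\<dots> \<le> t * 9" using d x assms by (intro mult_mono) auto
  finally show "z \<in> shell (p - 9 * t) (q + 9 * t)" using assms(1) by (auto simp: shell_def)
qed

definition energy :: "(real ^ 5 \<Rightarrow> real ^ 5) \<Rightarrow> real \<Rightarrow> real \<Rightarrow> real" where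
  "energy g p q = (LINT x:shell p q|lborel. (norm (g x))\<^sup>2)"

definition head_flux :: "(real ^ 5 \<Rightarrow> real) \<Rightarrow> (real ^ 5 \<Rightarrow> real ^ 5) \<Rightarrow> (real ^ 5 \<Rightarrow> real ^ 5) \<Rightarrow> real ^ 5 \<Rightarrow> real ^ 5" where
  "head_flux W g U x = (4/3 * W x) *\<^sub>R g x - (2/3 * (W x)\<^sup>2) *\<^sub>R U x"

text \<open>M is an explicit parameter because the class for fixed M is invariant under scaling
  (\<open>head_system_scale\<close>): a constant depending on M alone is uniform over all scales.
  The energy inequality is tested off the origin, whereas U is divergence free on the whole space;
  \<open>flux_bound\<close> tests the latter with a cutoff that equals 1 near 0.\<close>

definition head_system :: "real \<Rightarrow> (real ^ 5 \<Rightarrow> real) \<Rightarrow> (real ^ 5 \<Rightarrow> real ^ 5) \<Rightarrow> (real ^ 5 \<Rightarrow> real ^ 5) \<Rightarrow> bool" where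
  "head_system M W g U \<longleftrightarrow> 0 \<le> M \<and> U \<in> borel_measurable borel \<and> (\<forall>x. 0 \<le> W x) \<and>
     loc_weak_grad (UNIV - {0}) W g \<and>
     (\<forall>p q. 0 < p \<longrightarrow> (\<integral>\<^sup>+x\<in>shell p q. ennreal ((norm (g x))\<^sup>2) \<partial>lborel) < \<infinity>) \<and>
     (\<forall>r>0. (\<integral>\<^sup>+x\<in>ball 0 r. ennreal ((W x)\<^sup>2) \<partial>lborel) \<le> ennreal (M * r\<^sup>2)) \<and>
     (\<forall>r>0. (\<integral>\<^sup>+x\<in>ball 0 r. ennreal (norm (U x) ^ 3) \<partial>lborel) \<le> ennreal (M * r\<^sup>2)) \<and>
     (\<forall>\<phi>. test_fun (UNIV - {0}) \<phi> \<and> (\<forall>x. 0 \<le> \<phi> x) \<longrightarrow>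
        8/9 * (\<integral>x. (norm (g x))\<^sup>2 * \<phi> x \<partial>lborel) \<le> - (\<integral>x. head_flux W g U x \<bullet> grad \<phi> x \<partial>lborel)) \<and>
     (\<forall>\<phi>. test_fun UNIV \<phi> \<longrightarrow> (\<integral>x. U x \<bullet> grad \<phi> x \<partial>lborel) = 0)"

lemma head_systemD:
  assumes "head_system M W g U"
  shows "0 \<le> M" "U \<in> borel_measurable borel" "W \<in> borel_measurable borel" "g \<in> borel_measurable borel"
    "\<And>x. 0 \<le> W x" "loc_weak_grad (UNIV - {0}) W g"
    "\<And>p q. 0 < p \<Longrightarrow> (\<integral>\<^sup>+x\<in>shell p q. ennreal ((norm (g x))\<^sup>2) \<partial>lborel) < \<infinity>"
    "\<And>r. 0 < r \<Longrightarrow> (\<integral>\<^sup>+x\<in>ball 0 r. ennreal ((W x)\<^sup>2) \<partial>lborel) \<le> ennreal (M * r\<^sup>2)"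
    "\<And>r. 0 < r \<Longrightarrow> (\<integral>\<^sup>+x\<in>ball 0 r. ennreal (norm (U x) ^ 3) \<partial>lborel) \<le> ennreal (M * r\<^sup>2)"
    "\<And>\<phi>. test_fun (UNIV - {0}) \<phi> \<Longrightarrow> (\<And>x. 0 \<le> \<phi> x) \<Longrightarrow>
        8/9 * (\<integral>x. (norm (g x))\<^sup>2 * \<phi> x \<partial>lborel) \<le> - (\<integral>x. head_flux W g U x \<bullet> grad \<phi> x \<partial>lborel)"
    "\<And>\<phi>. test_fun UNIV \<phi> \<Longrightarrow> (\<integral>x. U x \<bullet> grad \<phi> x \<partial>lborel) = 0"
proof -
  show l: "loc_weak_grad (UNIV - {0}) W g" using assms by (simp add: head_system_def)
  from loc_weak_gradD(1,2)[OF l] show "W \<in> borel_measurable borel" "g \<in> borel_measurable borel" .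
qed (use assms in \<open>unfold head_system_def, blast+\<close>)

lemma nn_integral_indicator_mono:
  "(\<And>x. x \<in> A \<Longrightarrow> x \<in> B) \<Longrightarrow> (\<integral>\<^sup>+x\<in>A. f x \<partial>M) \<le> (\<integral>\<^sup>+x\<in>B. f x \<partial>M)"
  by (intro nn_integral_mono) (auto simp: indicator_def)

lemma energy_props:
  assumes h: "head_system M W g U" and p: "0 < p"
  shows "L2_le (shell p q) g (sqrt (energy g p q))" "0 \<le> energy g p q"
    "(\<integral>\<^sup>+x\<in>shell p q. ennreal ((norm (g x))\<^sup>2) \<partial>lborel) = ennreal (energy g p q)"
    "set_integrable lborel (shell p q) (\<lambda>x. (norm (g x))\<^sup>2)"
proof -
  note [measurable] = head_systemD(4)[OF h]
  have fin: "(\<integral>\<^sup>+x\<in>shell p q. ennreal ((norm (g x))\<^sup>2) \<partial>lborel) < \<infinity>" by (rule head_systemD(7)[OF h p])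
  then obtain r where r: "r \<ge> 0" "(\<integral>\<^sup>+x\<in>shell p q. ennreal ((norm (g x))\<^sup>2) \<partial>lborel) = ennreal r"
    by (cases "\<integral>\<^sup>+x\<in>shell p q. ennreal ((norm (g x))\<^sup>2) \<partial>lborel") auto
  have L: "L2_le (shell p q) g (sqrt r)" using r by (simp add: L2_le_def)
  show e: "(\<integral>\<^sup>+x\<in>shell p q. ennreal ((norm (g x))\<^sup>2) \<partial>lborel) = ennreal (energy g p q)"
    using L2_le_set_integrable(3)[OF L order.refl] by (simp add: energy_def)
  show "0 \<le> energy g p q" unfolding energy_def set_lebesgue_integral_def by (intro integral_nonneg_AE) auto
  with e r have "energy g p q = r" by simp
  with L show "L2_le (shell p q) g (sqrt (energy g p q))" by simp
  show "set_integrable lborel (shell p q) (\<lambda>x. (norm (g x))\<^sup>2)"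
    using L2_le_set_integrable(1)[OF L order.refl] by simp
qed

lemma energy_mono:
  assumes h: "head_system M W g U" and "0 < p'" "p' \<le> p" "q \<le> q'"
  shows "energy g p q \<le> energy g p' q'"
proof -
  have p: "0 < p" using assms by linarith
  have "ennreal (energy g p q) \<le> ennreal (energy g p' q')"
    unfolding energy_props(3)[OF h p, symmetric] energy_props(3)[OF h assms(2), symmetric]
    by (rule nn_integral_indicator_mono) (rule subsetD[OF shell_mono[OF assms(3,4)]])
  then show ?thesis using energy_props(2)[OF h, of p' q'] assms(2) by simp
qed

lemma shell_subset_ball_5: "q \<le> 16 \<Longrightarrow> shell p q \<subseteq> ball 0 5"
  by (rule shell_subset_ball) (auto simp: power2_eq_square)

text \<open>Shells with q \<le> 16 lie in the ball of radius 5. This is the source of the 5 here and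
  of the terms 25 M in the later bounds.\<close>

lemma L2_le_W:
  assumes h: "head_system M W g U" and "q \<le> 16"
  shows "L2_le (shell p q) W (5 * sqrt M)"
proof -
  have "(\<integral>\<^sup>+x\<in>shell p q. ennreal ((norm (W x))\<^sup>2) \<partial>lborel) \<le> (\<integral>\<^sup>+x\<in>ball 0 5. ennreal ((norm (W x))\<^sup>2) \<partial>lborel)"
    by (rule nn_integral_indicator_mono) (rule subsetD[OF shell_subset_ball_5[OF assms(2)]])
  also have "\<dots> = (\<integral>\<^sup>+x\<in>ball 0 5. ennreal ((W x)\<^sup>2) \<partial>lborel)" by simp
  also have "\<dots> \<le> ennreal (M * 5\<^sup>2)" by (rule head_systemD(8)[OF h]) simp
  finally have b: "(\<integral>\<^sup>+x\<in>shell p q. ennreal ((norm (W x))\<^sup>2) \<partial>lborel) \<le> ennreal (M * 5\<^sup>2)" .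
  have "M * 5\<^sup>2 = (5 * sqrt M)\<^sup>2"
    unfolding power_mult_distrib real_sqrt_pow2[OF head_systemD(1)[OF h]] by (rule mult.commute)
  with b have "(\<integral>\<^sup>+x\<in>shell p q. ennreal ((norm (W x))\<^sup>2) \<partial>lborel) \<le> ennreal ((5 * sqrt M)\<^sup>2)" by metis
  with head_systemD(1,3)[OF h] show ?thesis unfolding L2_le_def by (intro conjI) simp_all
qed

lemma cube_U_shell:
  assumes h: "head_system M W g U" and "q \<le> 16"
  shows "(\<integral>\<^sup>+x\<in>shell p q. ennreal (norm (U x) ^ 3) \<partial>lborel) \<le> ennreal (25 * M)"
proof -
  have "(\<integral>\<^sup>+x\<in>shell p q. ennreal (norm (U x) ^ 3) \<partial>lborel) \<le> (\<integral>\<^sup>+x\<in>ball 0 5. ennreal (norm (U x) ^ 3) \<partial>lborel)"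
    by (rule nn_integral_indicator_mono) (rule subsetD[OF shell_subset_ball_5[OF assms(2)]])
  also have "\<dots> \<le> ennreal (M * 5\<^sup>2)" by (rule head_systemD(9)[OF h]) simp
  also have "M * 5\<^sup>2 = 25 * M" by simp
  finally show ?thesis .
qed

lemma volume_shell:
  assumes "q \<le> 16"
  shows "(\<integral>\<^sup>+x\<in>shell p q. 1 \<partial>lborel) \<le> ennreal (ball_const * 5 ^ 5)"
proof -
  have "(\<integral>\<^sup>+x\<in>shell p q. 1 \<partial>lborel) \<le> (\<integral>\<^sup>+x. indicator (cball (0 :: real^5) 5) x \<partial>lborel)"
  proof (rule nn_integral_mono)
    fix x :: "real ^ 5"
    show "1 * indicator (shell p q) x \<le> (indicator (cball 0 5) x :: ennreal)"
      using subsetD[OF shell_subset_ball_5[OF assms], of x p] by (auto simp: indicator_def)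
  qed
  also have "\<dots> = ennreal (ball_const * 5 ^ 5)"
    using emeasure_lborel_cball_finite[of "0 :: real^5" 5] measure_cball_5[of 5 0]
    by (subst nn_integral_indicator) (auto simp: emeasure_eq_ennreal_measure)
  finally show ?thesis .
qed

text \<open>According to whether b \<le> \<kappa> a or not, one of the two terms alone is already an
  upper bound.\<close>

lemma weighted_young:
  fixes a b \<kappa> :: real
  assumes "0 \<le> a" "0 \<le> b" "0 < \<kappa>"
  shows "a\<^sup>2 * b \<le> \<kappa> * a ^ 3 + b ^ 3 / \<kappa>\<^sup>2"
proof (cases "b \<le> \<kappa> * a")
  case True
  have "a\<^sup>2 * b \<le> a\<^sup>2 * (\<kappa> * a)" using True by (intro mult_left_mono) auto
  also have "\<dots> = \<kappa> * a ^ 3" by (simp add: power2_eq_square power3_eq_cube)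
  moreover have "0 \<le> b ^ 3 / \<kappa>\<^sup>2" using assms by simp
  ultimately show ?thesis by linarith
next
  case False
  then have "a \<le> b / \<kappa>" using assms by (simp add: field_simps)
  then have "a\<^sup>2 * b \<le> (b / \<kappa>)\<^sup>2 * b" using assms by (intro mult_right_mono power_mono) auto
  also have "\<dots> = b ^ 3 / \<kappa>\<^sup>2" by (simp add: power2_eq_square power3_eq_cube)
  moreover have "0 \<le> \<kappa> * a ^ 3" using assms by simp
  ultimately show ?thesis by linarith
qed

lemma le_1_plus_cube: "0 \<le> b \<Longrightarrow> b \<le> 1 + b ^ 3" for b :: real
proof (cases "b \<le> 1")
  case False
  then have "b ^ 1 \<le> b ^ 3" by (intro power_increasing) auto
  then show ?thesis by simp
next
  case True
  assume "0 \<le> b"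
  then have "0 \<le> b ^ 3" by simp
  with True show ?thesis by linarith
qed

text \<open>The small factor \<open>u\<close> in front of the energy comes from mollifying at radius \<open>u\<^sup>4\<close> and applying
  Young's inequality with weight \<open>1 / (u \<surd>(E + 1))\<close>; it allows the energy to be absorbed.\<close>

lemma transport_term_shell_bound:
  assumes "0 \<le> M"
  obtains C where "C > 0" "\<And>W g U p q u. \<lbrakk>head_system M W g U; 0 < u; u \<le> 1; 0 < p - 9 * u ^ 4; q + 9 * u ^ 4 \<le> 16\<rbrakk> \<Longrightarrow>
    (\<integral>\<^sup>+x\<in>shell p q. ennreal ((W x)\<^sup>2 * norm (U x)) \<partial>lborel) \<le>
      ennreal (C * (u * (energy g (p - 9 * u ^ 4) (q + 9 * u ^ 4) + 1) + 1 / u ^ 40))"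
proof -
  define C3 where "C3 = 16 * mollify_const * ball_const"
  define B where "B = sqrt ball_const * (5 * sqrt M) / mollifier_mass"
  define V where "V = ball_const * 5 ^ 5"
  have pos: "C3 > 0" "B \<ge> 0" "V > 0"
    using mollify_const_pos ball_const_pos mollifier_mass_pos assms by (auto simp: C3_def B_def V_def)
  define C where "C = 2 * C3 + 50 * M + 2 * B\<^sup>2 * (V + 25 * M)"
  show thesis
  proof (rule that)
    show "C > 0" using pos assms by (auto simp: C_def intro!: add_pos_nonneg)
    fix W g U and p q u :: real
    assume h: "head_system M W g U" and u: "0 < u" "u \<le> 1" and p: "0 < p - 9 * u ^ 4" and q: "q + 9 * u ^ 4 \<le> 16"
    \<comment> \<open>The fourth power makes \<open>sqrt t\<close> equal to u^2 and
      \<open>t ^ 5\<close> equal to u^20; squaring the bound on the mollified W then produces the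
      u^40 of the claim.\<close>
    define t where "t = u ^ 4"
    have t: "0 < t" "t \<le> 1" using u by (auto simp: t_def power_le_one)
    define K where "K = shell (p - 9 * t) (q + 9 * t)"
    define E where "E = energy g (p - 9 * t) (q + 9 * t)"
    have E: "E \<ge> 0" unfolding E_def using energy_props(2)[OF h] p by (simp add: t_def)
    note hD = head_systemD[OF h]
    note [measurable] = hD(2,3,4)
    have q': "q \<le> 16" using q t(1) unfolding t_def by linarith
    have sub: "cball x t \<subseteq> K" if "x \<in> shell p q" for x
      unfolding K_def by (rule shell_thicken[OF that q']) (use t in auto)
    define a where "a x = \<bar>W x - mollify W t x\<bar>" for x
    \<comment> \<open>Using E + 1 instead of E ensures s \<ge> 1, so that the weight \<kappa> below
      makes sense also when the energy is zero.\<close>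
    define s where "s = sqrt (E + 1)"
    have s: "s \<ge> 1" "s\<^sup>2 = E + 1" "sqrt E \<le> s" using E by (auto simp: s_def)
    have a3: "(\<integral>\<^sup>+x\<in>shell p q. ennreal (a x ^ 3) \<partial>lborel) \<le> ennreal (C3 * u\<^sup>2 * s ^ 3)"
    proof -
      have "(\<integral>\<^sup>+x\<in>shell p q. ennreal (a x ^ 3) \<partial>lborel) \<le> ennreal (C3 * sqrt t * sqrt E ^ 3)"
        unfolding a_def C3_def
      proof (rule mollify_L3[OF hD(6)])
        show "compact K" "K \<subseteq> UNIV - {0}" unfolding K_def
          using compact_shell shell_avoids_0 p by (auto simp: t_def)
        show "L2_le K g (sqrt E)" unfolding K_def E_def by (rule energy_props(1)[OF h]) (use p in \<open>simp add: t_def\<close>)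
      qed (use sub t in auto)
      also have "sqrt t = u\<^sup>2" unfolding t_def by (rule real_sqrt_unique) auto
      also have "ennreal (C3 * u\<^sup>2 * sqrt E ^ 3) \<le> ennreal (C3 * u\<^sup>2 * s ^ 3)"
        using pos s E by (intro ennreal_leI mult_left_mono power_mono) auto
      finally show ?thesis .
    qed
    have b: "\<bar>mollify W t x\<bar> \<le> B / u ^ 20" if "x \<in> shell p q" for x
    proof -
      have "\<bar>mollify W t x\<bar> \<le> 1 / (mollifier_mass * t ^ 5) * (sqrt (ball_const * t ^ 5) * (5 * sqrt M))"
      proof (rule mollify_abs_le[OF _ t(1) sub[OF that]])
        show "L2_le K W (5 * sqrt M)" unfolding K_def by (rule L2_le_W[OF h]) (use q in \<open>simp add: t_def\<close>)
      qed
      also have "\<dots> \<le> 1 / (mollifier_mass * t ^ 5) * (sqrt ball_const * (5 * sqrt M))"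
        using t mollifier_mass_pos ball_const_pos assms
        by (intro mult_left_mono mult_right_mono real_sqrt_le_mono) (auto intro: mult_left_le power_le_one)
      also have "\<dots> = B / u ^ 20" unfolding B_def t_def by (simp add: power_mult[symmetric])
      finally show ?thesis .
    qed
    \<comment> \<open>Balances the two Young terms: \<kappa> u^2 s^3 = u s^2 and 1 / \<kappa>^2 =
      u^2 s^2 are both at most u (E + 1).\<close>
    define \<kappa> where "\<kappa> = 1 / (u * s)"
    have \<kappa>: "\<kappa> > 0" using u s by (simp add: \<kappa>_def)
    have \<kappa>1: "\<kappa> * (u\<^sup>2 * s ^ 3) = u * (E + 1)"
      unfolding s(2)[symmetric] \<kappa>_def using u s by (simp add: field_simps power2_eq_square power3_eq_cube)
    have \<kappa>2: "1 / \<kappa>\<^sup>2 \<le> u * (E + 1)"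
    proof -
      have "1 / \<kappa>\<^sup>2 = u\<^sup>2 * (E + 1)" unfolding s(2)[symmetric] \<kappa>_def by (simp add: power_mult_distrib power_divide)
      also have "\<dots> \<le> u * (E + 1)"
        using u E by (intro mult_right_mono) (auto simp: power2_eq_square mult_left_le)
      finally show ?thesis .
    qed
    define c1 c2 c3 where "c1 = 2 * \<kappa>" and "c2 = 2 / \<kappa>\<^sup>2 + 2 * (B / u ^ 20)\<^sup>2" and "c3 = 2 * (B / u ^ 20)\<^sup>2"
    have c: "c1 \<ge> 0" "c2 \<ge> 0" "c3 \<ge> 0" using \<kappa> by (auto simp: c1_def c2_def c3_def)
    have pw: "(W x)\<^sup>2 * norm (U x) \<le> c1 * a x ^ 3 + c2 * norm (U x) ^ 3 + c3" if "x \<in> shell p q" for x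
    proof -
      \<comment> \<open>W is split into its deviation a from the mollification, which is small in
        L^3, and the mollification, which is bounded.\<close>
      have "W x \<le> a x + B / u ^ 20" using b[OF that] by (auto simp: a_def)
      then have "(W x)\<^sup>2 \<le> (a x + B / u ^ 20)\<^sup>2" using hD(5)[of x] by (intro power_mono)
      also have "\<dots> \<le> 2 * (a x)\<^sup>2 + 2 * (B / u ^ 20)\<^sup>2"
        using sum_squares_bound[of "a x" "B / u ^ 20"] by (simp add: power2_sum)
      finally have "(W x)\<^sup>2 * norm (U x) \<le> (2 * (a x)\<^sup>2 + c3) * norm (U x)"
        unfolding c3_def by (rule mult_right_mono) simp
      also have "\<dots> = 2 * ((a x)\<^sup>2 * norm (U x)) + c3 * norm (U x)" by (simp add: algebra_simps)
      also have "\<dots> \<le> 2 * (\<kappa> * a x ^ 3 + norm (U x) ^ 3 / \<kappa>\<^sup>2) + c3 * (1 + norm (U x) ^ 3)"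
        using c by (intro add_mono mult_left_mono weighted_young le_1_plus_cube \<kappa>) (auto simp: a_def)
      also have "\<dots> = c1 * a x ^ 3 + c2 * norm (U x) ^ 3 + c3" by (simp add: c1_def c2_def c3_def algebra_simps)
      finally show ?thesis .
    qed
    have am [measurable]: "a \<in> borel_measurable borel" unfolding a_def by measurable
    have "(\<integral>\<^sup>+x\<in>shell p q. ennreal ((W x)\<^sup>2 * norm (U x)) \<partial>lborel) \<le>
      (\<integral>\<^sup>+x. ennreal c1 * (ennreal (a x ^ 3) * indicator (shell p q) x) +
         ennreal c2 * (ennreal (norm (U x) ^ 3) * indicator (shell p q) x) + ennreal c3 * (1 * indicator (shell p q) x) \<partial>lborel)"
    proof (rule nn_integral_mono)
      fix x
      show "ennreal ((W x)\<^sup>2 * norm (U x)) * indicator (shell p q) x \<le> ennreal c1 * (ennreal (a x ^ 3) * indicator (shell p q) x) +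
         ennreal c2 * (ennreal (norm (U x) ^ 3) * indicator (shell p q) x) + ennreal c3 * (1 * indicator (shell p q) x)"
      proof (cases "x \<in> shell p q")
        case True
        have "ennreal ((W x)\<^sup>2 * norm (U x)) \<le> ennreal (c1 * a x ^ 3 + c2 * norm (U x) ^ 3 + c3)"
          by (rule ennreal_leI[OF pw[OF True]])
        also have "\<dots> = ennreal c1 * ennreal (a x ^ 3) + ennreal c2 * ennreal (norm (U x) ^ 3) + ennreal c3"
          using c by (simp add: ennreal_mult' a_def)
        finally show ?thesis using True by simp
      qed simp
    qed
    also have "\<dots> = ennreal c1 * (\<integral>\<^sup>+x\<in>shell p q. ennreal (a x ^ 3) \<partial>lborel) +
       ennreal c2 * (\<integral>\<^sup>+x\<in>shell p q. ennreal (norm (U x) ^ 3) \<partial>lborel) + ennreal c3 * (\<integral>\<^sup>+x\<in>shell p q. 1 \<partial>lborel)"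
      by (simp add: nn_integral_add nn_integral_cmult)
    also have "\<dots> \<le> ennreal c1 * ennreal (C3 * u\<^sup>2 * s ^ 3) + ennreal c2 * ennreal (25 * M) + ennreal c3 * ennreal V"
      unfolding V_def by (intro add_mono mult_left_mono a3 cube_U_shell[OF h q'] volume_shell[OF q']) auto
    also have "\<dots> = ennreal (c1 * (C3 * u\<^sup>2 * s ^ 3) + c2 * (25 * M) + c3 * V)"
      using c pos s assms by (simp add: ennreal_mult'[symmetric] ennreal_plus[symmetric] del: ennreal_plus)
    also have "\<dots> \<le> ennreal (C * (u * (E + 1) + 1 / u ^ 40))"
    proof (rule ennreal_leI)
      have b2: "(B / u ^ 20)\<^sup>2 = B\<^sup>2 * (1 / u ^ 40)" by (simp add: power_divide power_mult[symmetric])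
      have "c1 * (C3 * u\<^sup>2 * s ^ 3) = 2 * C3 * (u * (E + 1))" unfolding \<kappa>1[symmetric] c1_def by simp
      moreover have "c2 * (25 * M) \<le> 50 * M * (u * (E + 1)) + 50 * M * B\<^sup>2 * (1 / u ^ 40)"
        using mult_right_mono[OF \<kappa>2, of "50 * M"] assms by (simp add: c2_def b2 algebra_simps)
      moreover have "c3 * V = 2 * B\<^sup>2 * V * (1 / u ^ 40)" by (simp add: c3_def b2)
      ultimately have "c1 * (C3 * u\<^sup>2 * s ^ 3) + c2 * (25 * M) + c3 * V \<le>
        (2 * C3 + 50 * M) * (u * (E + 1)) + 2 * B\<^sup>2 * (V + 25 * M) * (1 / u ^ 40)"
        by (simp add: algebra_simps)
      also have "\<dots> \<le> C * (u * (E + 1)) + C * (1 / u ^ 40)"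
        using pos assms u E by (intro add_mono mult_right_mono) (auto simp: C_def)
      finally show "c1 * (C3 * u\<^sup>2 * s ^ 3) + c2 * (25 * M) + c3 * V \<le> C * (u * (E + 1) + 1 / u ^ 40)"
        by (simp only: distrib_left)
    qed
    finally show "(\<integral>\<^sup>+x\<in>shell p q. ennreal ((W x)\<^sup>2 * norm (U x)) \<partial>lborel) \<le>
      ennreal (C * (u * (energy g (p - 9 * u ^ 4) (q + 9 * u ^ 4) + 1) + 1 / u ^ 40))"
      by (simp add: E_def t_def)
  qed
qed

section \<open>The scale-invariant energy bound\<close>

definition cutoff_bound :: real where
  "cutoff_bound = (SOME K. 0 < K \<and> (\<forall>t. \<bar>deriv cutoff t\<bar> \<le> K))"

lemma cutoff_bound: "0 < cutoff_bound" "\<bar>deriv cutoff t\<bar> \<le> cutoff_bound"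
  using someI_ex[OF deriv_cutoff_bounded] unfolding cutoff_bound_def by blast+

lemma cutoff_affine_DERIV:
  "((\<lambda>\<tau>. cutoff (a * \<tau> + b)) has_real_derivative deriv cutoff (a * \<tau> + b) * a) (at \<tau>)"
  by (rule DERIV_chain2[OF smooth1_has_deriv(1)[OF smooth1_cutoff]]) (auto intro!: derivative_eq_intros)

lemma smooth_fun_radial:
  assumes "\<And>k. smooth1 k \<eta>"
  shows "smooth_fun (\<lambda>x. \<eta> ((norm x)\<^sup>2))"
  using smooth_fun_comp[OF assms smooth_fun_dist_sq[of 0]] by simp

lemma grad_radial_0:
  assumes "(\<eta> has_real_derivative d) (at ((norm x)\<^sup>2))"
  shows "grad (\<lambda>x. \<eta> ((norm x)\<^sup>2)) x = (2 * d) *\<^sub>R x"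
  using grad_radial[of \<eta> d 1 x 0] assms by simp

lemma shell_cutoff:
  assumes "0 < p'" "p' < p" "q < q'"
  obtains \<phi> where "test_fun (UNIV - {0}) \<phi>" "\<And>x. 0 \<le> \<phi> x" "\<And>x. x \<in> shell p q \<Longrightarrow> \<phi> x = 1"
    "\<And>x. norm (grad \<phi> x) \<le> 2 * sqrt q' * (cutoff_bound * (1 / (p - p') + 1 / (q' - q))) * indicator (shell p' q') x"
proof -
  define a a' where "a = 1 / (p - p')" and "a' = 1 / (q' - q)"
  have a: "0 < a" "0 < a'" using assms by (auto simp: a_def a'_def)
  \<comment> \<open>The first factor rises from 0 to 1 on [p', p], the second falls from 1 to 0 on
    [q, q'].\<close>
  define \<eta> where "\<eta> \<tau> = cutoff (a * \<tau> + - (a * p')) * cutoff ((- a') * \<tau> + a' * q')" for \<tau>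
  define \<eta>' where "\<eta>' \<tau> = deriv cutoff (a * \<tau> + - (a * p')) * a * cutoff ((- a') * \<tau> + a' * q') +
     deriv cutoff ((- a') * \<tau> + a' * q') * (- a') * cutoff (a * \<tau> + - (a * p'))" for \<tau>
  have sm: "smooth1 k \<eta>" for k
    unfolding \<eta>_def by (intro smooth1_mult smooth1_affine smooth1_cutoff)
  have d: "(\<eta> has_real_derivative \<eta>' \<tau>) (at \<tau>)" for \<tau>
    unfolding \<eta>_def \<eta>'_def by (rule DERIV_mult[OF cutoff_affine_DERIV cutoff_affine_DERIV])
  have out: "\<eta> \<tau> = 0 \<and> \<eta>' \<tau> = 0" if "\<tau> < p' \<or> q' < \<tau>" for \<tau>
  proof -
    have "a * \<tau> + - (a * p') < 0 \<or> (- a') * \<tau> + a' * q' < 0"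
      using that a mult_strict_left_mono[of \<tau> p' a] mult_strict_left_mono[of q' \<tau> a'] by auto
    then show ?thesis
      using cutoff_eq_0 deriv_cutoff_outside by (fastforce simp: \<eta>_def \<eta>'_def)
  qed
  have bd: "\<bar>\<eta>' \<tau>\<bar> \<le> cutoff_bound * (a + a')" for \<tau>
  proof -
    have "\<bar>deriv cutoff s * c * cutoff r\<bar> \<le> cutoff_bound * \<bar>c\<bar> * 1" for s c r
      unfolding abs_mult using cutoff_bound cutoff_range[of r]
      by (intro mult_mono) (auto intro: less_imp_le)
    from this[of "a * \<tau> + - (a * p')" a "(- a') * \<tau> + a' * q'"] this[of "(- a') * \<tau> + a' * q'" "- a'" "a * \<tau> + - (a * p')"]
    show ?thesis using a unfolding \<eta>'_def by (simp add: algebra_simps)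
  qed
  let ?\<phi> = "\<lambda>x :: real ^ 5. \<eta> ((norm x)\<^sup>2)"
  show thesis
  proof (rule that)
    show "test_fun (UNIV - {0}) ?\<phi>"
      by (rule test_funI[OF smooth_fun_radial[OF sm] compact_shell shell_avoids_0[OF assms(1)]])
         (use out in \<open>auto simp: shell_def not_le\<close>)
    show "0 \<le> ?\<phi> x" for x unfolding \<eta>_def by (intro mult_nonneg_nonneg cutoff_range)
    show "?\<phi> x = 1" if "x \<in> shell p q" for x
    proof -
      have "1 \<le> a * (norm x)\<^sup>2 + - (a * p')" "1 \<le> (- a') * (norm x)\<^sup>2 + a' * q'"
      proof -
        have "a * (norm x)\<^sup>2 + - (a * p') = ((norm x)\<^sup>2 - p') / (p - p')"
          "(- a') * (norm x)\<^sup>2 + a' * q' = (q' - (norm x)\<^sup>2) / (q' - q)"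
          by (simp_all add: a_def a'_def diff_divide_distrib)
        then show "1 \<le> a * (norm x)\<^sup>2 + - (a * p')" "1 \<le> (- a') * (norm x)\<^sup>2 + a' * q'"
          using that assms by (auto simp: shell_def)
      qed
      then show ?thesis by (simp add: \<eta>_def cutoff_eq_1)
    qed
    show "norm (grad ?\<phi> x) \<le> 2 * sqrt q' * (cutoff_bound * (1 / (p - p') + 1 / (q' - q))) * indicator (shell p' q') x" for x
    proof (cases "x \<in> shell p' q'")
      case True
      have "norm (grad ?\<phi> x) = 2 * norm x * \<bar>\<eta>' ((norm x)\<^sup>2)\<bar>" by (simp add: grad_radial_0[OF d] abs_mult)
      also have "\<dots> \<le> 2 * sqrt q' * (cutoff_bound * (a + a'))"
        using True bd by (intro mult_mono) (auto simp: shell_def real_le_rsqrt intro: order.trans[OF zero_le_power2])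
      finally show ?thesis using True by (simp add: a_def a'_def)
    next
      case False
      then show ?thesis using out[of "(norm x)\<^sup>2"] by (auto simp: grad_radial_0[OF d] shell_def not_le)
    qed
  qed
qed

text \<open>If h is not integrable, the Bochner integral defaults to 0 and the claim is trivial.
  Fluxes can therefore be estimated before their integrability is known.\<close>

lemma ennreal_abs_integral_le: "ennreal \<bar>\<integral>x. h x \<partial>M\<bar> \<le> (\<integral>\<^sup>+x. ennreal \<bar>h x\<bar> \<partial>M)" for h :: "_ \<Rightarrow> real"
proof (cases "integrable M h")
  case True
  from integral_norm_bound_ennreal[OF this] show ?thesis by simp
qed (simp add: not_integrable_integral_eq)

lemma compact_subset_shell:
  assumes "compact K" "K \<subseteq> UNIV - {0}"
  obtains p q where "0 < p" "K \<subseteq> shell p q"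
proof (cases "K = {}")
  case False
  have c: "continuous_on K (\<lambda>x. (norm x)\<^sup>2)" by (intro continuous_intros)
  obtain x where x: "x \<in> K" "\<And>y. y \<in> K \<Longrightarrow> (norm x)\<^sup>2 \<le> (norm y)\<^sup>2"
    using continuous_attains_inf[OF assms(1) False c] by auto
  obtain z :: "real ^ 5" where z: "\<And>y. y \<in> K \<Longrightarrow> (norm y)\<^sup>2 \<le> (norm z)\<^sup>2"
    using continuous_attains_sup[OF assms(1) False c] by auto
  have "0 < (norm x)\<^sup>2" using x(1) assms(2) by auto
  with x z that show ?thesis unfolding shell_def by blast
qed (use that[of 1] in simp)

lemma energy_density_integrable:
  assumes h: "head_system M W g U" and "test_fun (UNIV - {0}) \<phi>"
  shows "integrable lborel (\<lambda>x. (norm (g x))\<^sup>2 * \<phi> x)"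
proof (rule test_fun_integrable(1)[OF assms(2)])
  fix K :: "(real ^ 5) set" assume K: "compact K" "K \<subseteq> UNIV - {0}"
  obtain p q where pq: "0 < p" "K \<subseteq> shell p q" using compact_subset_shell[OF K] .
  show "set_integrable lborel K (\<lambda>x. (norm (g x))\<^sup>2)"
    by (rule set_integrable_subset[OF energy_props(4)[OF h pq(1)] _ pq(2)])
       (use compact_imp_closed[OF K(1)] in auto)
qed (use head_systemD(4)[OF h] in measurable)

lemma energy_le_test:
  assumes h: "head_system M W g U" and \<phi>: "test_fun (UNIV - {0}) \<phi>" "\<And>x. 0 \<le> \<phi> x"
    "\<And>x. x \<in> shell p q \<Longrightarrow> \<phi> x = 1" and p: "0 < p"
  shows "energy g p q \<le> (\<integral>x. (norm (g x))\<^sup>2 * \<phi> x \<partial>lborel)"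
  unfolding energy_def set_lebesgue_integral_def
proof (rule integral_mono[OF _ energy_density_integrable[OF h \<phi>(1)]])
  show "integrable lborel (\<lambda>x. indicator (shell p q) x *\<^sub>R (norm (g x))\<^sup>2)"
    using energy_props(4)[OF h p] by (simp add: set_integrable_def)
  show "indicator (shell p q) x *\<^sub>R (norm (g x))\<^sup>2 \<le> (norm (g x))\<^sup>2 * \<phi> x" for x
    using \<phi>(2,3)[of x] by (cases "x \<in> shell p q") auto
qed

lemma mult_le_weighted_squares: "a * b \<le> c * b\<^sup>2 + a\<^sup>2 / c" if "0 < c" "0 \<le> a" "0 \<le> b" for a b c :: real
proof -
  have "a * b \<le> (c * b) * b \<or> a * b \<le> a * (a / c)"
  proof (cases "a \<le> c * b")
    case True
    then show ?thesis using that by (intro disjI1 mult_right_mono) auto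
  next
    case False
    then have "b \<le> a / c" using that by (simp add: field_simps)
    then show ?thesis using that by (intro disjI2 mult_left_mono) auto
  qed
  moreover have "0 \<le> (c * b) * b" "0 \<le> a * (a / c)" using that by auto
  ultimately have "a * b \<le> (c * b) * b + a * (a / c)" by linarith
  then show ?thesis by (simp add: power2_eq_square)
qed

lemma W_g_shell_bound:
  assumes h: "head_system M W g U" and p: "0 < p" "q \<le> 16" and l: "0 < c"
  shows "(\<integral>\<^sup>+x\<in>shell p q. ennreal (W x * norm (g x)) \<partial>lborel) \<le> ennreal (c * energy g p q + 25 * M / c)"
proof -
  note hD = head_systemD[OF h]
  note [measurable] = hD(2,3,4)
  have W2: "(\<integral>\<^sup>+x\<in>shell p q. ennreal ((norm (W x))\<^sup>2) \<partial>lborel) \<le> ennreal (25 * M)"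
    using L2_le_W[OF h p(2), of p] hD(1) by (simp add: L2_le_def power_mult_distrib)
  have "(\<integral>\<^sup>+x\<in>shell p q. ennreal (W x * norm (g x)) \<partial>lborel) \<le>
    (\<integral>\<^sup>+x. ennreal c * (ennreal ((norm (g x))\<^sup>2) * indicator (shell p q) x) +
       ennreal (1 / c) * (ennreal ((norm (W x))\<^sup>2) * indicator (shell p q) x) \<partial>lborel)"
  proof (rule nn_integral_mono)
    fix x
    have "ennreal (W x * norm (g x)) \<le> ennreal (c * (norm (g x))\<^sup>2 + (1 / c) * (norm (W x))\<^sup>2)"
      using mult_le_weighted_squares[OF l hD(5)[of x] norm_ge_zero[of "g x"]] by (intro ennreal_leI) simp
    also have "\<dots> = ennreal c * ennreal ((norm (g x))\<^sup>2) + ennreal (1 / c) * ennreal ((norm (W x))\<^sup>2)"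
      using l by (simp add: ennreal_mult'[symmetric])
    finally show "ennreal (W x * norm (g x)) * indicator (shell p q) x \<le>
      ennreal c * (ennreal ((norm (g x))\<^sup>2) * indicator (shell p q) x) +
       ennreal (1 / c) * (ennreal ((norm (W x))\<^sup>2) * indicator (shell p q) x)"
      by (cases "x \<in> shell p q") simp_all
  qed
  also have "\<dots> = ennreal c * (\<integral>\<^sup>+x\<in>shell p q. ennreal ((norm (g x))\<^sup>2) \<partial>lborel) +
     ennreal (1 / c) * (\<integral>\<^sup>+x\<in>shell p q. ennreal ((norm (W x))\<^sup>2) \<partial>lborel)"
    by (simp add: nn_integral_add nn_integral_cmult)
  also have "\<dots> \<le> ennreal c * ennreal (energy g p q) + ennreal (1 / c) * ennreal (25 * M)"
    unfolding energy_props(3)[OF h p(1)] by (intro add_left_mono mult_left_mono W2) simp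
  also have "\<dots> = ennreal (c * energy g p q + 25 * M / c)"
    using l hD(1) energy_props(2)[OF h p(1), of q]
    by (simp add: ennreal_mult'[symmetric] ennreal_plus[symmetric] del: ennreal_plus)
  finally show ?thesis .
qed

text \<open>The cutoff enters linearly, so no part of the flux is absorbed pointwise. The energy of
  the larger shell stays on the right, with a coefficient controlled by c and T, and is removed by
  \<open>hole_filling_iteration\<close>.\<close>

lemma caccioppoli:
  assumes h: "head_system M W g U" and \<phi>: "test_fun (UNIV - {0}) \<phi>" "\<And>x. 0 \<le> \<phi> x"
    "\<And>x. x \<in> shell p q \<Longrightarrow> \<phi> x = 1" "\<And>x. norm (grad \<phi> x) \<le> L * indicator (shell p' q') x"
    and p: "0 < p" "0 < p'" "q' \<le> 16" and l: "0 < c" "0 \<le> L" "0 \<le> T"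
    and T: "(\<integral>\<^sup>+x\<in>shell p' q'. ennreal ((W x)\<^sup>2 * norm (U x)) \<partial>lborel) \<le> ennreal T"
  shows "8/9 * energy g p q \<le> L * (4/3 * (c * energy g p' q' + 25 * M / c) + 2/3 * T)"
proof -
  note hD = head_systemD[OF h]
  note [measurable] = hD(2,3,4)
  define X where "X = c * energy g p' q' + 25 * M / c"
  have X: "X \<ge> 0" using l hD(1) energy_props(2)[OF h p(2), of q'] by (simp add: X_def)
  have "8/9 * energy g p q \<le> 8/9 * (\<integral>x. (norm (g x))\<^sup>2 * \<phi> x \<partial>lborel)"
    using energy_le_test[OF h \<phi>(1,2,3) p(1)] by simp
  also have "\<dots> \<le> - (\<integral>x. head_flux W g U x \<bullet> grad \<phi> x \<partial>lborel)" by (rule hD(10)[OF \<phi>(1,2)])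
  also have "\<dots> \<le> \<bar>\<integral>x. head_flux W g U x \<bullet> grad \<phi> x \<partial>lborel\<bar>" by simp
  finally have 1: "8/9 * energy g p q \<le> \<bar>\<integral>x. head_flux W g U x \<bullet> grad \<phi> x \<partial>lborel\<bar>" .
  have "ennreal \<bar>\<integral>x. head_flux W g U x \<bullet> grad \<phi> x \<partial>lborel\<bar> \<le> (\<integral>\<^sup>+x. ennreal \<bar>head_flux W g U x \<bullet> grad \<phi> x\<bar> \<partial>lborel)"
    by (rule ennreal_abs_integral_le)
  also have "\<dots> \<le> (\<integral>\<^sup>+x. ennreal (L * (4/3)) * (ennreal (W x * norm (g x)) * indicator (shell p' q') x) +
      ennreal (L * (2/3)) * (ennreal ((W x)\<^sup>2 * norm (U x)) * indicator (shell p' q') x) \<partial>lborel)"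
  proof (rule nn_integral_mono)
    fix x
    have F: "norm (head_flux W g U x) \<le> 4/3 * (W x * norm (g x)) + 2/3 * ((W x)\<^sup>2 * norm (U x))"
      unfolding head_flux_def using norm_triangle_ineq4[of "(4/3 * W x) *\<^sub>R g x" "(2/3 * (W x)\<^sup>2) *\<^sub>R U x"] hD(5)[of x]
      by simp
    have "\<bar>head_flux W g U x \<bullet> grad \<phi> x\<bar> \<le> norm (head_flux W g U x) * norm (grad \<phi> x)" by (rule Cauchy_Schwarz_ineq2)
    also have "\<dots> \<le> (4/3 * (W x * norm (g x)) + 2/3 * ((W x)\<^sup>2 * norm (U x))) * (L * indicator (shell p' q') x)"
      using F \<phi>(4)[of x] hD(5)[of x] by (intro mult_mono) auto
    finally have "ennreal \<bar>head_flux W g U x \<bullet> grad \<phi> x\<bar> \<le>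
      ennreal ((4/3 * (W x * norm (g x)) + 2/3 * ((W x)\<^sup>2 * norm (U x))) * (L * indicator (shell p' q') x))"
      by (rule ennreal_leI)
    also have "\<dots> = ennreal (L * (4/3)) * (ennreal (W x * norm (g x)) * indicator (shell p' q') x) +
      ennreal (L * (2/3)) * (ennreal ((W x)\<^sup>2 * norm (U x)) * indicator (shell p' q') x)"
    proof (cases "x \<in> shell p' q'")
      case True
      have "(4/3 * (W x * norm (g x)) + 2/3 * ((W x)\<^sup>2 * norm (U x))) * L =
        (L * (4/3)) * (W x * norm (g x)) + (L * (2/3)) * ((W x)\<^sup>2 * norm (U x))" by (simp add: algebra_simps)
      with True show ?thesis using l hD(5)[of x]
        by (simp add: ennreal_mult'[symmetric] ennreal_plus[symmetric] del: ennreal_plus)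
    qed simp
    finally show "ennreal \<bar>head_flux W g U x \<bullet> grad \<phi> x\<bar> \<le> \<dots>" .
  qed
  also have "\<dots> = ennreal (L * (4/3)) * (\<integral>\<^sup>+x\<in>shell p' q'. ennreal (W x * norm (g x)) \<partial>lborel) +
     ennreal (L * (2/3)) * (\<integral>\<^sup>+x\<in>shell p' q'. ennreal ((W x)\<^sup>2 * norm (U x)) \<partial>lborel)"
    by (simp add: nn_integral_add nn_integral_cmult)
  also have "\<dots> \<le> ennreal (L * (4/3)) * ennreal X + ennreal (L * (2/3)) * ennreal T"
    unfolding X_def by (intro add_mono mult_left_mono T W_g_shell_bound[OF h p(2,3) l(1)]) auto
  also have "\<dots> = ennreal (L * (4/3) * X + L * (2/3) * T)"
    using l X by (simp add: ennreal_mult'[symmetric] ennreal_plus[symmetric] del: ennreal_plus)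
  finally have "\<bar>\<integral>x. head_flux W g U x \<bullet> grad \<phi> x \<partial>lborel\<bar> \<le> L * (4/3) * X + L * (2/3) * T"
    using l X by (subst (asm) ennreal_le_iff) auto
  with 1 have "8/9 * energy g p q \<le> L * (4/3) * X + L * (2/3) * T" by linarith
  also have "\<dots> = L * (4/3 * X + 2/3 * T)" by (simp add: distrib_left)
  finally show ?thesis unfolding X_def .
qed

text \<open>Along \<sigma> n = 1 - 2^-n the n-th step costs K 2^(41 (n+1)), while the preceding n
  contractions gain 2^(-42 n). The surplus 2^-n sums to the total 2^42 K, and boundedness of E
  disposes of the remainder. The exponent 41 arises in \<open>energy_bound\<close>: 40 from the
  transport estimate and 1 from the gradient of the cutoff.\<close>

lemma hole_filling_iteration:
  fixes E :: "real \<Rightarrow> real"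
  assumes bounded: "\<And>s. 0 \<le> s \<Longrightarrow> s \<le> 1 \<Longrightarrow> E s \<le> B" and "0 \<le> B"
    and step: "\<And>s s'. 0 \<le> s \<Longrightarrow> s < s' \<Longrightarrow> s' \<le> 1 \<Longrightarrow> E s \<le> E s' / 2 ^ 42 + K / (s' - s) ^ 41"
    and "0 \<le> K"
  shows "E 0 \<le> 2 ^ 42 * K"
proof -
  define \<sigma> where "\<sigma> n = 1 - (1/2 :: real) ^ n" for n :: nat
  have ind: "E 0 \<le> E (\<sigma> n) / 2 ^ (42 * n) + K * 2 ^ 41 * (2 - 2 * (1/2) ^ n)" for n
  proof (induction n)
    case 0
    show ?case by (simp add: \<sigma>_def)
  next
    case (Suc n)
    have d: "\<sigma> (Suc n) - \<sigma> n = (1/2) ^ Suc n" by (simp add: \<sigma>_def)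
    have "E (\<sigma> n) \<le> E (\<sigma> (Suc n)) / 2 ^ 42 + K / (\<sigma> (Suc n) - \<sigma> n) ^ 41"
      by (rule step) (auto simp: \<sigma>_def power_le_one)
    also have "K / (\<sigma> (Suc n) - \<sigma> n) ^ 41 = K * 2 ^ (41 * Suc n)"
      unfolding d power_mult[symmetric] by (simp add: power_divide mult.commute)
    finally have "E (\<sigma> n) / 2 ^ (42 * n) \<le> (E (\<sigma> (Suc n)) / 2 ^ 42 + K * 2 ^ (41 * Suc n)) / 2 ^ (42 * n)"
      by (rule divide_right_mono) simp
    also have "\<dots> = E (\<sigma> (Suc n)) / 2 ^ (42 * Suc n) + K * 2 ^ 41 * (1/2) ^ n"
    proof -
      have "(2::real) ^ (42 * n) = 2 ^ (41 * n) * 2 ^ n" by (simp add: power_add[symmetric])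
      then have "K * 2 ^ (41 * Suc n) / 2 ^ (42 * n) = K * 2 ^ 41 * (1/2) ^ n"
        by (simp add: power_add power_divide)
      moreover have "E (\<sigma> (Suc n)) / 2 ^ 42 / 2 ^ (42 * n) = E (\<sigma> (Suc n)) / 2 ^ (42 * Suc n)"
        by (simp add: power_add)
      ultimately show ?thesis by (simp add: add_divide_distrib)
    qed
    finally show ?case using Suc.IH by (simp add: algebra_simps)
  qed
  have "E 0 \<le> B * (1/2) ^ n + 2 ^ 42 * K" for n
  proof -
    have "E (\<sigma> n) / 2 ^ (42 * n) \<le> B / 2 ^ (42 * n)"
      by (intro divide_right_mono bounded) (auto simp: \<sigma>_def power_le_one)
    also have "\<dots> \<le> B / 2 ^ n" using \<open>0 \<le> B\<close> by (intro divide_left_mono power_increasing) auto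
    finally have "E (\<sigma> n) / 2 ^ (42 * n) \<le> B * (1/2) ^ n" by (simp add: power_divide)
    moreover have "K * 2 ^ 41 * (2 - 2 * (1/2) ^ n) \<le> K * 2 ^ 41 * 2"
      using \<open>0 \<le> K\<close> by (intro mult_left_mono) auto
    ultimately show ?thesis using ind[of n] by simp
  qed
  moreover have "(\<lambda>n. B * (1/2) ^ n + 2 ^ 42 * K) \<longlonglongrightarrow> B * 0 + 2 ^ 42 * K"
    by (intro tendsto_intros LIMSEQ_power_zero) auto
  ultimately have "E 0 \<le> B * 0 + 2 ^ 42 * K" by (intro LIMSEQ_le_const) auto
  then show ?thesis by simp
qed

lemma energy_bound:
  assumes M: "0 \<le> M"
  obtains C where "C > 0" "\<And>W g U. head_system M W g U \<Longrightarrow> energy g (1/4) 4 \<le> C"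
proof -
  obtain C where C: "C > 0" "\<And>W g U p q u. \<lbrakk>head_system M W g U; 0 < u; u \<le> 1; 0 < p - 9 * u ^ 4; q + 9 * u ^ 4 \<le> 16\<rbrakk> \<Longrightarrow>
    (\<integral>\<^sup>+x\<in>shell p q. ennreal ((W x)\<^sup>2 * norm (U x)) \<partial>lborel) \<le>
      ennreal (C * (u * (energy g (p - 9 * u ^ 4) (q + 9 * u ^ 4) + 1) + 1 / u ^ 40))"
    using transport_term_shell_bound[OF M] by blast
  \<comment> \<open>108 = 6 * 18: the outer radius is at most 3, which gives 2 * 3, and the inverse
    widths of the two transition layers are 16 / d and 2 / d.\<close>
  define L where "L = 108 * cutoff_bound"
  have L: "L > 0" using cutoff_bound by (simp add: L_def)
  \<comment> \<open>\<theta> and \<epsilon> share the contraction factor 2^-42: in the estimate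
    \<open>te2\<close> the gradient term takes one half of it and the transport term at most 3/8.
    The cap 1/144 leaves room for thickening the shells.\<close>
  define \<theta> where "\<theta> = 1 / (3 * L * 2 ^ 42)"
  define \<epsilon> where "\<epsilon> = min (1/144) (1 / (2 ^ 43 * L * C))"
  have te: "\<theta> > 0" "\<epsilon> > 0" "\<epsilon> \<le> 1/144" using L C by (auto simp: \<theta>_def \<epsilon>_def)
  have te2: "9/8 * L * (4/3 * \<theta> + 2/3 * C * \<epsilon>) \<le> 1 / 2 ^ 42"
  proof -
    have "C * \<epsilon> \<le> C * (1 / (2 ^ 43 * L * C))" using C by (intro mult_left_mono) (auto simp: \<epsilon>_def)
    also have "\<dots> = 1 / (2 ^ 43 * L)" using C by simp
    finally have "9/8 * L * (4/3 * \<theta> + 2/3 * (C * \<epsilon>)) \<le> 9/8 * L * (4/3 * \<theta> + 2/3 * (1 / (2 ^ 43 * L)))"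
      using L by (intro mult_left_mono add_left_mono) auto
    also have "\<dots> \<le> 1 / 2 ^ 42" using L by (simp add: \<theta>_def field_simps)
    finally show ?thesis by (simp add: mult.assoc)
  qed
  define K where "K = 9/8 * L * (4/3 * (25 * M / \<theta>) + 2/3 * C * (\<epsilon> + 1 / \<epsilon> ^ 40))"
  have K: "K > 0" using L M te C by (auto simp: K_def intro!: mult_pos_pos add_nonneg_pos)
  show thesis
  proof (rule that[of "2 ^ 42 * K"])
    show "2 ^ 42 * K > 0" using K by simp
    fix W g U assume h: "head_system M W g U"
    \<comment> \<open>A family of shells growing from \<open>shell (1/4) 4\<close> at s = 0 to
      \<open>shell (1/8) 5\<close> at s = 1.\<close>
    define E where "E s = energy g (1/4 - s/8) (4 + s)" for s
    have E0: "0 \<le> E s" if "s \<le> 1" for s unfolding E_def using that by (intro energy_props(2)[OF h]) simp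
    have "E 0 \<le> 2 ^ 42 * K"
    proof (rule hole_filling_iteration[where B="E 1"])
      show "E s \<le> E 1" if "0 \<le> s" "s \<le> 1" for s
        unfolding E_def using that by (intro energy_mono[OF h]) auto
      show "0 \<le> E 1" by (rule E0) simp
      show "0 \<le> K" using K by simp
      fix s s' :: real assume s: "0 \<le> s" "s < s'" "s' \<le> 1"
      define d where "d = s' - s"
      have d: "0 < d" "d \<le> 1" using s by (auto simp: d_def)
      \<comment> \<open>The parameter of \<open>transport_term_shell_bound\<close> is proportional
        to the gap d, so that the factor 1 / d from the cutoff turns u E into \<epsilon> E, which
        can be contracted.\<close>
      define u where "u = \<epsilon> * d"
      have u: "0 < u" "u \<le> 1" "144 * u \<le> d"
        using te d mult_right_mono[OF te(3), of d] by (auto simp: u_def intro!: mult_le_one)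
      have "u ^ 4 \<le> u ^ 1" using u by (intro power_decreasing) auto
      then have u4: "9 * u ^ 4 \<le> d / 16" "0 \<le> u ^ 4" using u by auto
      \<comment> \<open>Halfway between the shells for s and s'. The inner room left over is d / 16,
        and thickening by 9 u^4 \<le> d / 16 stays within the shell for s'.\<close>
      define p' q' where "p' = 1/4 - (s + s') / 16" and "q' = 4 + (s + s') / 2"
      have pq: "0 < p'" "p' < 1/4 - s/8" "4 + s < q'" "0 < 1/4 - s/8" "q' \<le> 5"
        "0 < p' - 9 * u ^ 4" "q' + 9 * u ^ 4 \<le> 16" "1/4 - s'/8 \<le> p' - 9 * u ^ 4" "q' + 9 * u ^ 4 \<le> 4 + s'"
        using s u4 by (auto simp: p'_def q'_def d_def field_simps)
      obtain \<phi> where \<phi>: "test_fun (UNIV - {0}) \<phi>" "\<And>x. 0 \<le> \<phi> x" "\<And>x. x \<in> shell (1/4 - s/8) (4 + s) \<Longrightarrow> \<phi> x = 1"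
        "\<And>x. norm (grad \<phi> x) \<le> 2 * sqrt q' * (cutoff_bound * (1 / (1/4 - s/8 - p') + 1 / (q' - (4 + s)))) * indicator (shell p' q') x"
        using shell_cutoff[OF pq(1,2,3)] by blast
      have Ld: "2 * sqrt q' * (cutoff_bound * (1 / (1/4 - s/8 - p') + 1 / (q' - (4 + s)))) \<le> L / d"
      proof -
        have pd: "1/4 - s/8 - p' = d / 16" "q' - (4 + s) = d / 2" by (auto simp: p'_def q'_def d_def field_simps)
        have e: "1 / (1/4 - s/8 - p') + 1 / (q' - (4 + s)) = 18 / d" unfolding pd by simp
        have "sqrt q' \<le> 3" using pq(5) by (intro real_le_lsqrt) auto
        then have "2 * sqrt q' * (cutoff_bound * (18 / d)) \<le> 2 * 3 * (cutoff_bound * (18 / d))"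
          using cutoff_bound d by (intro mult_right_mono) auto
        then show ?thesis unfolding e L_def by simp
      qed
      have \<phi>4: "norm (grad \<phi> x) \<le> L / d * indicator (shell p' q') x" for x
        using order.trans[OF \<phi>(4) mult_right_mono[OF Ld]] by simp
      have eE: "energy g (p' - 9 * u ^ 4) (q' + 9 * u ^ 4) \<le> E s'" "energy g p' q' \<le> E s'"
      proof -
        have "1/4 - s'/8 \<le> p'" "q' \<le> 4 + s'" using pq(8,9) u4(2) by linarith+
        then show "energy g (p' - 9 * u ^ 4) (q' + 9 * u ^ 4) \<le> E s'" "energy g p' q' \<le> E s'"
          unfolding E_def using s(3) by (auto intro!: energy_mono[OF h] pq(8,9))
      qed
      define T where "T = C * (u * (E s' + 1) + 1 / u ^ 40)"
      have E': "0 \<le> E s'" by (rule E0) (use s in simp)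
      have T: "(\<integral>\<^sup>+x\<in>shell p' q'. ennreal ((W x)\<^sup>2 * norm (U x)) \<partial>lborel) \<le> ennreal T"
        using C(2)[OF h u(1,2) pq(6,7)]
      proof (rule order.trans, intro ennreal_leI)
        show "C * (u * (energy g (p' - 9 * u ^ 4) (q' + 9 * u ^ 4) + 1) + 1 / u ^ 40) \<le> T"
          unfolding T_def using C u eE(1) by (intro mult_left_mono add_right_mono add_mono) auto
      qed
      have "8/9 * E s \<le> L / d * (4/3 * (\<theta> * d * energy g p' q' + 25 * M / (\<theta> * d)) + 2/3 * T)"
        unfolding E_def
        by (rule caccioppoli[OF h \<phi>(1,2,3) \<phi>4 pq(4,1) _ _ _ _ T])
           (use pq te d L C u E' in \<open>auto simp: T_def\<close>)
      also have "\<dots> \<le> L / d * (4/3 * (\<theta> * d * E s' + 25 * M / (\<theta> * d)) + 2/3 * T)"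
        using eE(2) L d te by (intro mult_left_mono add_mono) auto
      finally have le: "8/9 * E s \<le> L / d * (4/3 * (\<theta> * d * E s' + 25 * M / (\<theta> * d)) + 2/3 * T)" .
      have "E s = 9/8 * (8/9 * E s)" by simp
      also have "\<dots> \<le> 9/8 * (L / d * (4/3 * (\<theta> * d * E s' + 25 * M / (\<theta> * d)) + 2/3 * T))"
        by (rule mult_left_mono[OF le]) simp
      also have "\<dots> = 9/8 * L * (4/3 * \<theta> + 2/3 * C * \<epsilon>) * E s' +
        9/8 * L * (4/3 * (25 * M / \<theta>) * (1 / d\<^sup>2) + 2/3 * C * (\<epsilon> + 1 / \<epsilon> ^ 40 * (1 / d ^ 41)))"
      proof -
        have "d ^ 41 = d ^ 40 * d" by (simp add: power_Suc[symmetric] mult.commute del: power_Suc) 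
        then have "1 / d * (1 / u ^ 40) = 1 / \<epsilon> ^ 40 * (1 / d ^ 41)" by (simp add: u_def power_mult_distrib)
        moreover have "1 / d * (u * (E s' + 1)) = \<epsilon> * (E s' + 1)" using d by (simp add: u_def)
        ultimately have "1 / d * T = C * (\<epsilon> * (E s' + 1) + 1 / \<epsilon> ^ 40 * (1 / d ^ 41))"
          unfolding T_def by (metis (no_types, lifting) distrib_left mult.left_commute)
        moreover have "1 / d * (\<theta> * d * E s' + 25 * M / (\<theta> * d)) = \<theta> * E s' + 25 * M / \<theta> * (1 / d\<^sup>2)"
          using d by (simp add: field_simps power2_eq_square)
        moreover have "9/8 * (L / d * (4/3 * X + 2/3 * Y)) = 9/8 * L * (4/3 * (1 / d * X) + 2/3 * (1 / d * Y))" for X Y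
          by (simp add: algebra_simps)
        ultimately show ?thesis by (simp only:) (simp add: algebra_simps)
      qed
      also have "\<dots> \<le> 1 / 2 ^ 42 * E s' + K * (1 / d ^ 41)"
      proof (rule add_mono)
        show "9/8 * L * (4/3 * \<theta> + 2/3 * C * \<epsilon>) * E s' \<le> 1 / 2 ^ 42 * E s'" by (rule mult_right_mono[OF te2 E'])
        have "d ^ 41 \<le> d\<^sup>2" "d ^ 41 \<le> 1" using d by (auto intro!: power_decreasing power_le_one)
        then have "1 / d\<^sup>2 \<le> 1 / d ^ 41" "1 \<le> 1 / d ^ 41" using d by (auto intro!: divide_left_mono)
        then have "4/3 * (25 * M / \<theta>) * (1 / d\<^sup>2) + 2/3 * C * (\<epsilon> * 1 + 1 / \<epsilon> ^ 40 * (1 / d ^ 41)) \<le>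
          4/3 * (25 * M / \<theta>) * (1 / d ^ 41) + 2/3 * C * (\<epsilon> * (1 / d ^ 41) + 1 / \<epsilon> ^ 40 * (1 / d ^ 41))"
          using M te C by (intro add_mono mult_left_mono) auto
        from mult_left_mono[OF this, of "9/8 * L"]
        show "9/8 * L * (4/3 * (25 * M / \<theta>) * (1 / d\<^sup>2) + 2/3 * C * (\<epsilon> + 1 / \<epsilon> ^ 40 * (1 / d ^ 41))) \<le> K * (1 / d ^ 41)"
          using L by (simp add: K_def algebra_simps)
      qed
      finally show "E s \<le> E s' / 2 ^ 42 + K / (s' - s) ^ 41" by (simp add: d_def)
    qed
    then show "energy g (1/4) 4 \<le> 2 ^ 42 * K" by (simp add: E_def)
  qed
qed

section \<open>The flux through a shell\<close>

text \<open>Equal to 1 near the origin, so that its gradient lives on \<open>shell 1 2\<close> alone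
  and testing with it measures the flux through one shell. Differences of two rescaled copies are
  the annular test functions of \<open>annulus_energy_le_flux\<close>.\<close>

definition unit_cutoff :: "real ^ 5 \<Rightarrow> real" where
  "unit_cutoff x = cutoff ((-1) * (norm x)\<^sup>2 + 2)"

lemma grad_unit_cutoff: "grad unit_cutoff x = (2 * (deriv cutoff ((-1) * (norm x)\<^sup>2 + 2) * (-1))) *\<^sub>R x"
  unfolding unit_cutoff_def[abs_def] by (rule grad_radial_0[OF cutoff_affine_DERIV])

lemma smooth_fun_unit_cutoff: "smooth_fun unit_cutoff"
  unfolding unit_cutoff_def[abs_def]
  by (rule smooth_fun_radial[of "\<lambda>\<tau>. cutoff ((-1) * \<tau> + 2)"]) (intro smooth1_affine smooth1_cutoff)

lemma unit_cutoff_eq_0: "2 \<le> (norm x)\<^sup>2 \<Longrightarrow> unit_cutoff x = 0"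
  unfolding unit_cutoff_def by (rule cutoff_eq_0) simp

lemma unit_cutoff_eq_1: "(norm x)\<^sup>2 \<le> 1 \<Longrightarrow> unit_cutoff x = 1"
  unfolding unit_cutoff_def by (rule cutoff_eq_1) simp

lemma test_fun_unit_cutoff: "test_fun UNIV unit_cutoff"
proof (rule test_funI[OF smooth_fun_unit_cutoff compact_cball[of 0 2]])
  fix x :: "real ^ 5" assume "x \<notin> cball 0 2"
  then have "2\<^sup>2 \<le> (norm x)\<^sup>2" by (intro power_mono) auto
  then show "unit_cutoff x = 0" by (intro unit_cutoff_eq_0) simp
qed simp

lemma norm_grad_unit_cutoff: "norm (grad unit_cutoff x) \<le> 4 * cutoff_bound * indicator (shell 1 2) x"
proof (cases "x \<in> shell 1 2")
  case True
  then have "(norm x)\<^sup>2 \<le> 2\<^sup>2" by (simp add: shell_def)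
  then have n: "norm x \<le> 2" by (rule power2_le_imp_le) simp
  have "norm (grad unit_cutoff x) = 2 * (\<bar>deriv cutoff ((-1) * (norm x)\<^sup>2 + 2)\<bar> * norm x)"
    unfolding grad_unit_cutoff by (simp add: abs_mult)
  also have "\<dots> \<le> 2 * (cutoff_bound * 2)"
    using n cutoff_bound by (intro mult_left_mono mult_mono) (auto intro: less_imp_le)
  finally show ?thesis using True by simp
next
  case False
  then have "(-1) * (norm x)\<^sup>2 + 2 < 0 \<or> 1 < (-1) * (norm x)\<^sup>2 + 2" by (auto simp: shell_def)
  then have "deriv cutoff ((-1) * (norm x)\<^sup>2 + 2) = 0" by (rule deriv_cutoff_outside)
  then show ?thesis using False unfolding grad_unit_cutoff by simp
qed

text \<open>Two points of a shell are joined inside a slightly larger shell by two segments, via a point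
  orthogonal to both.\<close>

lemma shell_oscillation:
  assumes lw: "loc_weak_grad (UNIV - {0}) W g" and K: "compact K" "K \<subseteq> UNIV - {0}" and e: "L2_le K g e"
    and t: "t > 0" and sub: "\<And>x. x \<in> shell (p / 2) q \<Longrightarrow> cball x t \<subseteq> K"
    and p: "0 < p" and xy: "x \<in> shell p q" "y \<in> shell p q"
  shows "\<bar>mollify W t x - mollify W t y\<bar> \<le> 4 * sqrt q / (mollifier_mass * t ^ 5) * (sqrt (ball_const * t ^ 5) * e)"
proof -
  have "p \<le> q" using xy by (auto simp: shell_def)
  \<comment> \<open>Two vectors span at most a plane, so dimension five leaves a direction
    orthogonal to both.\<close>
  have "dim {x, y} < DIM(real ^ 5)"
  proof -
    have "dim {x, y} \<le> card {x, y}" by (rule dim_le_card') simp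
    also have "\<dots> \<le> 2" by (cases "x = y") auto
    finally show ?thesis by simp
  qed
  then obtain w0 where w0: "w0 \<noteq> 0" "\<And>z. z \<in> span {x, y} \<Longrightarrow> orthogonal w0 z"
    by (rule orthogonal_to_subspace_exists) blast
  define w where "w = (sqrt q / norm w0) *\<^sub>R w0"
  have nw: "norm w = sqrt q" using w0(1) \<open>p \<le> q\<close> p by (simp add: w_def)
  have orth: "z \<bullet> w = 0" if "z \<in> {x, y}" for z
    using w0(2)[of z] span_base[OF that] by (simp add: w_def orthogonal_def inner_commute)
  define c where "c = 1 / (mollifier_mass * t ^ 5) * (sqrt (ball_const * t ^ 5) * e)"
  have c: "c \<ge> 0" using mollifier_mass_pos ball_const_pos t e by (auto simp: c_def L2_le_def)
  have one: "\<bar>mollify W t w - mollify W t z\<bar> \<le> 2 * sqrt q * c" if z: "z \<in> {x, y}" for z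
  proof -
    have zs: "p \<le> (norm z)\<^sup>2" "(norm z)\<^sup>2 \<le> q" using z xy by (auto simp: shell_def)
    then have nz: "norm z \<le> sqrt q" by (intro real_le_rsqrt)
    have seg: "z + s *\<^sub>R (w - z) \<in> shell (p / 2) q" if s: "s \<in> {0..1}" for s
    proof -
      have eq: "(norm (z + s *\<^sub>R (w - z)))\<^sup>2 = (1 - s)\<^sup>2 * (norm z)\<^sup>2 + s\<^sup>2 * q"
      proof -
        have "z + s *\<^sub>R (w - z) = (1 - s) *\<^sub>R z + s *\<^sub>R w" by (simp add: algebra_simps)
        then have "(norm (z + s *\<^sub>R (w - z)))\<^sup>2 = ((1 - s) *\<^sub>R z + s *\<^sub>R w) \<bullet> ((1 - s) *\<^sub>R z + s *\<^sub>R w)"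
          by (simp only: power2_norm_eq_inner)
        also have "\<dots> = (1 - s)\<^sup>2 * (z \<bullet> z) + s\<^sup>2 * (w \<bullet> w) + 2 * ((1 - s) * s * (z \<bullet> w))"
          by (simp add: inner_add_left inner_add_right inner_commute power2_eq_square)
        finally have "(norm (z + s *\<^sub>R (w - z)))\<^sup>2 = \<dots>" .
        then show ?thesis using orth[OF z] nw \<open>p \<le> q\<close> p by (simp add: power2_norm_eq_inner[symmetric])
      qed
      \<comment> \<open>On a segment between orthogonal vectors the squared norm combines those of
        the end points with weights (1-s)^2 and s^2, whose sum lies between 1/2 and 1. This is why
        the enlarged shell starts at p / 2.\<close>
      have sq: "1/2 \<le> (1 - s)\<^sup>2 + s\<^sup>2" "(1 - s)\<^sup>2 + s\<^sup>2 \<le> 1"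
      proof -
        have "0 \<le> (2 * s - 1)\<^sup>2" "0 \<le> s * (1 - s)" using s by auto
        then show "1/2 \<le> (1 - s)\<^sup>2 + s\<^sup>2" "(1 - s)\<^sup>2 + s\<^sup>2 \<le> 1"
          by (auto simp: power2_eq_square algebra_simps)
      qed
      have "p / 2 \<le> ((1 - s)\<^sup>2 + s\<^sup>2) * p" using mult_right_mono[OF sq(1), of p] p by simp
      also have "\<dots> = (1 - s)\<^sup>2 * p + s\<^sup>2 * p" by (simp add: distrib_right)
      also have "\<dots> \<le> (1 - s)\<^sup>2 * (norm z)\<^sup>2 + s\<^sup>2 * q"
        using zs \<open>p \<le> q\<close> by (intro add_mono mult_left_mono) auto
      finally have 1: "p / 2 \<le> (norm (z + s *\<^sub>R (w - z)))\<^sup>2" unfolding eq .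
      have "(1 - s)\<^sup>2 * (norm z)\<^sup>2 + s\<^sup>2 * q \<le> (1 - s)\<^sup>2 * q + s\<^sup>2 * q"
        using zs by (intro add_mono mult_left_mono) auto
      also have "\<dots> = ((1 - s)\<^sup>2 + s\<^sup>2) * q" by (simp add: distrib_right)
      also have "\<dots> \<le> 1 * q" using sq(2) p \<open>p \<le> q\<close> by (intro mult_right_mono) auto
      finally show ?thesis using 1 unfolding eq by (simp add: shell_def eq)
    qed
    have "\<bar>mollify W t w - mollify W t z\<bar> \<le> dist z w / (mollifier_mass * t ^ 5) * (sqrt (ball_const * t ^ 5) * e)"
      by (rule mollify_lipschitz[OF lw K e t]) (rule sub[OF seg])
    also have "\<dots> = dist z w * c" by (simp add: c_def)
    also have "\<dots> \<le> (2 * sqrt q) * c"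
      using c nz nw norm_triangle_ineq4[of z w] by (intro mult_right_mono) (auto simp: dist_norm)
    finally show ?thesis .
  qed
  have "\<bar>mollify W t x - mollify W t y\<bar> \<le> 2 * (2 * sqrt q * c)"
    using one[of x] one[of y] by simp
  also have "\<dots> = 4 * sqrt q / (mollifier_mass * t ^ 5) * (sqrt (ball_const * t ^ 5) * e)" by (simp add: c_def)
  finally show ?thesis .
qed

lemma mult3_le_cubes: "a * b * c \<le> a ^ 3 + b ^ 3 + c ^ 3" if "0 \<le> a" "0 \<le> b" "0 \<le> c" for a b c :: real
proof -
  define m where "m = max a (max b c)"
  have "a * b * c \<le> m * m * m" using that by (intro mult_mono) (auto simp: m_def)
  also have "\<dots> = m ^ 3" by (simp add: power3_eq_cube)
  also have "\<dots> \<le> a ^ 3 + b ^ 3 + c ^ 3" using that by (auto simp: m_def max_def)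
  finally show ?thesis .
qed

lemma add_cube_le: "(a + b) ^ 3 \<le> 8 * a ^ 3 + 8 * b ^ 3" if "0 \<le> a" "0 \<le> b" for a b :: real
proof -
  define m where "m = max a b"
  have "(a + b) ^ 3 \<le> (2 * m) ^ 3" using that by (intro power_mono) (auto simp: m_def)
  also have "\<dots> = 8 * m ^ 3" by (simp add: power_mult_distrib)
  also have "\<dots> \<le> 8 * a ^ 3 + 8 * b ^ 3" using that by (auto simp: m_def max_def)
  finally show ?thesis .
qed

text \<open>Since \<open>U\<close> is divergence free, \<open>W\<^sup>2\<close> may be replaced by \<open>W\<^sup>2 - c\<^sup>2\<close> in the transport term, where
  \<open>c\<close> is the value of the mollified \<open>W\<close> at a point of the shell. This makes the flux small
  together with the energy.\<close>

lemma flux_bound: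
  assumes M: "0 \<le> M"
  obtains C where "C > 0" "\<And>W g U e. \<lbrakk>head_system M W g U; 0 < e; energy g (1/4) 4 \<le> e\<^sup>2\<rbrakk> \<Longrightarrow>
    integrable lborel (\<lambda>x. head_flux W g U x \<bullet> grad unit_cutoff x) \<and>
    \<bar>\<integral>x. head_flux W g U x \<bullet> grad unit_cutoff x \<partial>lborel\<bar> \<le> C * (e * (1 + e ^ 3))"
proof -
  \<comment> \<open>9 t = 1/4, so balls of radius t around points of \<open>shell (1/2) 2\<close>
    stay inside \<open>shell (1/4) 4\<close>.\<close>
  define t :: real where "t = 1/36"
  define m where "m = 1 / (mollifier_mass * t ^ 5) * sqrt (ball_const * t ^ 5)"
  define C3 where "C3 = 16 * mollify_const * ball_const * sqrt t"
  define c4 where "c4 = 4 * sqrt 2 * m"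
  define c5 where "c5 = m * (5 * sqrt M)"
  define V where "V = ball_const * 5 ^ 5"
  define C6 where "C6 = 8 * C3 + 8 * c4 ^ 3 * V"
  define L where "L = 4 * cutoff_bound"
  have pos: "0 < t" "0 < m" "0 < C3" "0 < c4" "0 \<le> c5" "0 < V" "0 < C6" "0 < L"
    using mollifier_mass_pos ball_const_pos mollify_const_pos cutoff_bound M
    by (auto simp: t_def m_def C3_def c4_def c5_def V_def C6_def L_def intro!: add_pos_pos)
  define C where "C = L * (4/3 * (1 + 25 * M) + 2/3 * (C6 + 25 * M) + 4/3 * c5 * (C6 + V + 25 * M))"
  show thesis
  proof (rule that)
    show "C > 0" unfolding C_def using pos M by (intro mult_pos_pos add_pos_nonneg add_nonneg_nonneg) auto
    fix W g U and e :: real assume h: "head_system M W g U" and e: "0 < e" and en: "energy g (1/4) 4 \<le> e\<^sup>2"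
    note hD = head_systemD[OF h]
    note [measurable] = hD(2,3,4)
    define K where "K = shell (1/4) 4"
    have K: "compact K" "K \<subseteq> UNIV - {0}" unfolding K_def by (auto intro: compact_shell dest: subsetD[OF shell_avoids_0, rotated])
    have Kg: "L2_le K g e"
      unfolding K_def
      by (rule L2_le_mono[OF energy_props(1)[OF h, of "1/4" 4]]) (use en e in \<open>auto intro: real_le_lsqrt\<close>)
    have sub: "cball x t \<subseteq> K" if "x \<in> shell (1/2) 2" for x
      using shell_thicken[OF that, of t] shell_mono[of "1/4" "1/2 - 9 * t" "2 + 9 * t" 4]
      by (simp add: t_def K_def)
    have sub1: "shell 1 2 \<subseteq> shell (1/2) 2" by (rule shell_mono) auto
    define a where "a x = \<bar>W x - mollify W t x\<bar>" for x
    have a3: "(\<integral>\<^sup>+x\<in>shell 1 2. ennreal (a x ^ 3) \<partial>lborel) \<le> ennreal (C3 * e ^ 3)"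
      unfolding a_def C3_def
      by (rule mollify_L3[OF hD(6) K Kg]) (use sub sub1 pos in auto)
    \<comment> \<open>A reference point; any other point of the shell would do.\<close>
    define x0 :: "real ^ 5" where "x0 = axis 1 1"
    have x0: "x0 \<in> shell 1 2" by (simp add: x0_def shell_def)
    define c where "c = mollify W t x0"
    have c5: "\<bar>c\<bar> \<le> c5"
    proof -
      have "L2_le K W (5 * sqrt M)" unfolding K_def by (rule L2_le_W[OF h]) simp
      from mollify_abs_le[OF this pos(1) sub[OF subsetD[OF sub1 x0]]] show ?thesis
        by (simp add: c_def c5_def m_def)
    qed
    have osc: "\<bar>mollify W t x - c\<bar> \<le> c4 * e" if "x \<in> shell 1 2" for x
      using shell_oscillation[OF hD(6) K Kg pos(1) _ _ that x0] sub by (simp add: c_def c4_def m_def)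
    define w where "w x = \<bar>W x - c\<bar>" for x
    have [measurable]: "w \<in> borel_measurable borel" "a \<in> borel_measurable borel" unfolding w_def a_def by measurable
    have w0: "0 \<le> w x" "0 \<le> a x" for x by (auto simp: w_def a_def)
    \<comment> \<open>W - c is the deviation from the mollification, controlled by
      \<open>mollify_L3\<close>, plus the oscillation of the mollification, controlled by
      \<open>shell_oscillation\<close>. Both are of order e.\<close>
    have w3: "(\<integral>\<^sup>+x\<in>shell 1 2. ennreal (w x ^ 3) \<partial>lborel) \<le> ennreal (C6 * e ^ 3)"
    proof -
      have "(\<integral>\<^sup>+x\<in>shell 1 2. ennreal (w x ^ 3) \<partial>lborel) \<le>
        (\<integral>\<^sup>+x. ennreal 8 * (ennreal (a x ^ 3) * indicator (shell 1 2) x) + ennreal (8 * (c4 * e) ^ 3) * (1 * indicator (shell 1 2) x) \<partial>lborel)"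
      proof (rule nn_integral_mono)
        fix x
        show "ennreal (w x ^ 3) * indicator (shell 1 2) x \<le>
          ennreal 8 * (ennreal (a x ^ 3) * indicator (shell 1 2) x) + ennreal (8 * (c4 * e) ^ 3) * (1 * indicator (shell 1 2) x)"
        proof (cases "x \<in> shell 1 2")
          case True
          have "w x \<le> a x + c4 * e" using osc[OF True] by (auto simp: w_def a_def)
          then have "w x ^ 3 \<le> (a x + c4 * e) ^ 3" by (rule power_mono[OF _ w0(1)])
          also have "\<dots> \<le> 8 * a x ^ 3 + 8 * (c4 * e) ^ 3" by (rule add_cube_le) (use w0 pos e in auto)
          finally have "ennreal (w x ^ 3) \<le> ennreal (8 * a x ^ 3 + 8 * (c4 * e) ^ 3)" by (rule ennreal_leI)
          also have "\<dots> = ennreal 8 * ennreal (a x ^ 3) + ennreal (8 * (c4 * e) ^ 3)"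
            using w0 pos e by (subst ennreal_plus) (auto simp: ennreal_mult')
          finally show ?thesis using True by simp
        qed simp
      qed
      also have "\<dots> = ennreal 8 * (\<integral>\<^sup>+x\<in>shell 1 2. ennreal (a x ^ 3) \<partial>lborel) + ennreal (8 * (c4 * e) ^ 3) * (\<integral>\<^sup>+x\<in>shell 1 2. 1 \<partial>lborel)"
        by (subst nn_integral_add) (auto simp: nn_integral_cmult)
      also have "\<dots> \<le> ennreal 8 * ennreal (C3 * e ^ 3) + ennreal (8 * (c4 * e) ^ 3) * ennreal V"
        unfolding V_def by (intro add_mono mult_left_mono a3 volume_shell) auto
      also have "\<dots> = ennreal (8 * (C3 * e ^ 3) + 8 * (c4 * e) ^ 3 * V)"
        using pos e by (subst ennreal_plus) (auto simp: ennreal_mult')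
      also have "8 * (C3 * e ^ 3) + 8 * (c4 * e) ^ 3 * V = C6 * e ^ 3"
        by (simp add: C6_def power_mult_distrib algebra_simps)
      finally show ?thesis .
    qed
    define b where "b x = (U x \<bullet> grad unit_cutoff x)" for x
    define f where "f x = head_flux W g U x \<bullet> grad unit_cutoff x" for x
    \<comment> \<open>The flux density with W^2 replaced by W^2 - c^2. It differs from f by a
      multiple of b, whose integral is zero.\<close>
    define k where "k x = f x + 2/3 * c\<^sup>2 * b x" for x
    have gm [measurable]: "grad unit_cutoff \<in> borel_measurable borel"
      by (rule borel_measurable_continuous_onI[OF smooth_fun_continuous_grad[OF smooth_fun_unit_cutoff]])
    have [measurable]: "b \<in> borel_measurable borel" "f \<in> borel_measurable borel" "k \<in> borel_measurable borel"
      unfolding b_def f_def k_def head_flux_def by measurable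
    have bi: "integrable lborel b"
    proof (rule integrableI_bounded)
      have "(\<integral>\<^sup>+x. ennreal (norm (b x)) \<partial>lborel) \<le>
        (\<integral>\<^sup>+x. ennreal L * (ennreal (norm (U x) ^ 3) * indicator (shell 1 2) x) + ennreal L * (1 * indicator (shell 1 2) x) \<partial>lborel)"
      proof (rule nn_integral_mono)
        fix x
        have "norm (b x) \<le> norm (U x) * norm (grad unit_cutoff x)" unfolding b_def by (simp add: Cauchy_Schwarz_ineq2)
        also have "\<dots> \<le> (1 + norm (U x) ^ 3) * (L * indicator (shell 1 2) x)"
          using norm_grad_unit_cutoff[of x] le_1_plus_cube[of "norm (U x)"] unfolding L_def by (intro mult_mono) auto
        finally have "ennreal (norm (b x)) \<le> ennreal ((1 + norm (U x) ^ 3) * (L * indicator (shell 1 2) x))" by (rule ennreal_leI)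
        also have "\<dots> = ennreal L * (ennreal (norm (U x) ^ 3) * indicator (shell 1 2) x) + ennreal L * (1 * indicator (shell 1 2) x)"
          using pos by (cases "x \<in> shell 1 2") (auto simp: ennreal_mult'[symmetric] ennreal_plus[symmetric] algebra_simps simp del: ennreal_plus)
        finally show "ennreal (norm (b x)) \<le> \<dots>" .
      qed
      also have "\<dots> = ennreal L * (\<integral>\<^sup>+x\<in>shell 1 2. ennreal (norm (U x) ^ 3) \<partial>lborel) + ennreal L * (\<integral>\<^sup>+x\<in>shell 1 2. 1 \<partial>lborel)"
        by (subst nn_integral_add) (auto simp: nn_integral_cmult)
      also have "\<dots> \<le> ennreal L * ennreal (25 * M) + ennreal L * ennreal (ball_const * 5 ^ 5)"
        by (intro add_mono mult_left_mono cube_U_shell[OF h] volume_shell) auto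
      also have "\<dots> < \<infinity>" by (simp add: ennreal_mult_less_top)
      finally show "(\<integral>\<^sup>+x. ennreal (norm (b x)) \<partial>lborel) < \<infinity>" .
    qed simp
    have b0: "(\<integral>x. b x \<partial>lborel) = 0" unfolding b_def by (rule hD(11)[OF test_fun_unit_cutoff])
    \<comment> \<open>Weights for which every contribution is at least of order e: the integral of
      w^3 is of order e^3, which permits the 1 / e^2 in k1, while k2 and k3 carry a factor
      e.\<close>
    define k1 k2 k3 where "k1 = 2/3 * (1 / e\<^sup>2 + e + 2 * c5 / e\<^sup>2)" and "k2 = 2/3 * (e + 2 * c5 * e)"
      and "k3 = 2/3 * (2 * c5 * e)"
    have kpos: "0 \<le> k1" "0 \<le> k2" "0 \<le> k3" using e pos by (auto simp: k1_def k2_def k3_def)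
    have pw: "\<bar>k x\<bar> \<le> L * (4/3 * (W x * norm (g x)) + k1 * w x ^ 3 + k2 * norm (U x) ^ 3 + k3) * indicator (shell 1 2) x" for x
    proof -
      have eq: "k x = ((4/3 * W x) *\<^sub>R g x - (2/3 * ((W x)\<^sup>2 - c\<^sup>2)) *\<^sub>R U x) \<bullet> grad unit_cutoff x"
        by (simp add: k_def f_def b_def head_flux_def inner_diff_left algebra_simps)
      have "\<bar>(W x)\<^sup>2 - c\<^sup>2\<bar> = w x * \<bar>W x + c\<bar>"
        by (simp add: w_def abs_mult[symmetric] power2_eq_square algebra_simps)
      also have "\<dots> \<le> w x * (w x + 2 * c5)"
        using c5 w0(1)[of x] by (intro mult_left_mono) (auto simp: w_def)
      finally have d: "\<bar>(W x)\<^sup>2 - c\<^sup>2\<bar> \<le> w x * (w x + 2 * c5)" .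
      have "\<bar>(W x)\<^sup>2 - c\<^sup>2\<bar> * norm (U x) \<le> w x * (w x + 2 * c5) * norm (U x)"
        by (rule mult_right_mono[OF d]) simp
      \<comment> \<open>One factor w is written as e (w / e). The cube of w / e has an integral
        bounded independently of e, and e remains in front.\<close>
      also have "\<dots> = e * ((w x / e) * w x * norm (U x)) + 2 * c5 * (e * ((w x / e) * 1 * norm (U x)))"
        using e by (simp add: field_simps)
      also have "\<dots> \<le> e * ((w x / e) ^ 3 + w x ^ 3 + norm (U x) ^ 3) + 2 * c5 * (e * ((w x / e) ^ 3 + 1 ^ 3 + norm (U x) ^ 3))"
        using e w0 pos by (intro add_mono mult_left_mono mult3_le_cubes) auto
      also have "\<dots> = 3/2 * (k1 * w x ^ 3 + k2 * norm (U x) ^ 3 + k3)"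
        using e by (simp add: k1_def k2_def k3_def field_simps power2_eq_square power3_eq_cube)
      finally have u: "2/3 * (\<bar>(W x)\<^sup>2 - c\<^sup>2\<bar> * norm (U x)) \<le> k1 * w x ^ 3 + k2 * norm (U x) ^ 3 + k3" by simp
      have "norm ((4/3 * W x) *\<^sub>R g x - (2/3 * ((W x)\<^sup>2 - c\<^sup>2)) *\<^sub>R U x) \<le>
        norm ((4/3 * W x) *\<^sub>R g x) + norm ((2/3 * ((W x)\<^sup>2 - c\<^sup>2)) *\<^sub>R U x)" by (rule norm_triangle_ineq4)
      also have "norm ((4/3 * W x) *\<^sub>R g x) = 4/3 * (W x * norm (g x))" using hD(5)[of x] by simp
      also have "norm ((2/3 * ((W x)\<^sup>2 - c\<^sup>2)) *\<^sub>R U x) = 2/3 * (\<bar>(W x)\<^sup>2 - c\<^sup>2\<bar> * norm (U x))"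
        unfolding norm_scaleR abs_mult by simp
      finally have n: "norm ((4/3 * W x) *\<^sub>R g x - (2/3 * ((W x)\<^sup>2 - c\<^sup>2)) *\<^sub>R U x) \<le>
        4/3 * (W x * norm (g x)) + k1 * w x ^ 3 + k2 * norm (U x) ^ 3 + k3" using u by linarith
      have "\<bar>k x\<bar> \<le> norm ((4/3 * W x) *\<^sub>R g x - (2/3 * ((W x)\<^sup>2 - c\<^sup>2)) *\<^sub>R U x) * norm (grad unit_cutoff x)"
        unfolding eq by (rule Cauchy_Schwarz_ineq2)
      also have "\<dots> \<le> (4/3 * (W x * norm (g x)) + k1 * w x ^ 3 + k2 * norm (U x) ^ 3 + k3) * (L * indicator (shell 1 2) x)"
        using norm_grad_unit_cutoff[of x] n order.trans[OF norm_ge_zero n] unfolding L_def by (intro mult_mono) auto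
      finally show ?thesis by (simp add: mult_ac)
    qed
    define X where "X = L * (4/3 * (e + 25 * M * e) + k1 * (C6 * e ^ 3) + k2 * (25 * M) + k3 * V)"
    have X0: "0 \<le> X" unfolding X_def using pos kpos e M by (intro mult_nonneg_nonneg add_nonneg_nonneg) auto
    have kX: "(\<integral>\<^sup>+x. ennreal \<bar>k x\<bar> \<partial>lborel) \<le> ennreal X"
    proof -
      \<comment> \<open>The weight 1 / e balances the energy, at most e^2, against the bound 25 M
        for the integral of W^2.\<close>
      have Wg: "(\<integral>\<^sup>+x\<in>shell 1 2. ennreal (W x * norm (g x)) \<partial>lborel) \<le> ennreal (e + 25 * M * e)"
      proof (rule order.trans[OF W_g_shell_bound[OF h, of 1 2 "1 / e"] ennreal_leI])
        have "energy g 1 2 \<le> energy g (1/4) 4" by (rule energy_mono[OF h]) auto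
        with en have "energy g 1 2 \<le> e\<^sup>2" by linarith
        then have "1 / e * energy g 1 2 \<le> 1 / e * e\<^sup>2" using e by (intro mult_left_mono) auto
        then show "1 / e * energy g 1 2 + 25 * M / (1 / e) \<le> e + 25 * M * e" using e by (simp add: power2_eq_square)
      qed (use e in auto)
      have "(\<integral>\<^sup>+x. ennreal \<bar>k x\<bar> \<partial>lborel) \<le>
        (\<integral>\<^sup>+x. ennreal (L * (4/3)) * (ennreal (W x * norm (g x)) * indicator (shell 1 2) x) +
          ennreal (L * k1) * (ennreal (w x ^ 3) * indicator (shell 1 2) x) +
          ennreal (L * k2) * (ennreal (norm (U x) ^ 3) * indicator (shell 1 2) x) +
          ennreal (L * k3) * (1 * indicator (shell 1 2) x) \<partial>lborel)"
      proof (rule nn_integral_mono)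
        fix x
        show "ennreal \<bar>k x\<bar> \<le> ennreal (L * (4/3)) * (ennreal (W x * norm (g x)) * indicator (shell 1 2) x) +
          ennreal (L * k1) * (ennreal (w x ^ 3) * indicator (shell 1 2) x) +
          ennreal (L * k2) * (ennreal (norm (U x) ^ 3) * indicator (shell 1 2) x) +
          ennreal (L * k3) * (1 * indicator (shell 1 2) x)"
        proof (cases "x \<in> shell 1 2")
          case True
          have "L * (4/3 * (W x * norm (g x)) + k1 * w x ^ 3 + k2 * norm (U x) ^ 3 + k3) =
            L * (4/3) * (W x * norm (g x)) + L * k1 * w x ^ 3 + L * k2 * norm (U x) ^ 3 + L * k3"
            by (simp add: algebra_simps)
          then have "ennreal \<bar>k x\<bar> \<le> ennreal (L * (4/3) * (W x * norm (g x)) + L * k1 * w x ^ 3 + L * k2 * norm (U x) ^ 3 + L * k3)"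
            using pw[of x] True by (intro ennreal_leI) simp
          also have "\<dots> = ennreal (L * (4/3)) * ennreal (W x * norm (g x)) + ennreal (L * k1) * ennreal (w x ^ 3) +
            ennreal (L * k2) * ennreal (norm (U x) ^ 3) + ennreal (L * k3)"
            using pos kpos w0[of x] hD(5)[of x]
            by (subst ennreal_mult'[symmetric] ennreal_plus[symmetric]; simp)+
          finally show ?thesis using True by simp
        next
          case False
          then have "k x = 0" using pw[of x] by simp
          with False show ?thesis by simp
        qed
      qed
      also have "\<dots> = ennreal (L * (4/3)) * (\<integral>\<^sup>+x\<in>shell 1 2. ennreal (W x * norm (g x)) \<partial>lborel) +
          ennreal (L * k1) * (\<integral>\<^sup>+x\<in>shell 1 2. ennreal (w x ^ 3) \<partial>lborel) +
          ennreal (L * k2) * (\<integral>\<^sup>+x\<in>shell 1 2. ennreal (norm (U x) ^ 3) \<partial>lborel) +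
          ennreal (L * k3) * (\<integral>\<^sup>+x\<in>shell 1 2. 1 \<partial>lborel)"
        by (simp add: nn_integral_add nn_integral_cmult)
      also have "\<dots> \<le> ennreal (L * (4/3)) * ennreal (e + 25 * M * e) + ennreal (L * k1) * ennreal (C6 * e ^ 3) +
          ennreal (L * k2) * ennreal (25 * M) + ennreal (L * k3) * ennreal V"
        unfolding V_def by (intro add_mono mult_left_mono Wg w3 cube_U_shell[OF h] volume_shell) auto
      also have "\<dots> = ennreal (L * (4/3) * (e + 25 * M * e) + L * k1 * (C6 * e ^ 3) + L * k2 * (25 * M) + L * k3 * V)"
        using pos kpos e M by (subst ennreal_mult'[symmetric] ennreal_plus[symmetric]; simp)+
      also have "L * (4/3) * (e + 25 * M * e) + L * k1 * (C6 * e ^ 3) + L * k2 * (25 * M) + L * k3 * V = X"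
        by (simp add: X_def algebra_simps)
      finally show ?thesis .
    qed
    have ki: "integrable lborel k"
      using kX by (intro integrableI_bounded) (auto intro: order.strict_trans1)
    have fk: "f = (\<lambda>x. k x - 2/3 * c\<^sup>2 * b x)" by (auto simp: k_def)
    have fi: "integrable lborel f" unfolding fk using ki bi by auto
    have "(\<integral>x. f x \<partial>lborel) = (\<integral>x. k x \<partial>lborel)" unfolding fk using ki bi b0 by simp
    moreover have "\<bar>\<integral>x. k x \<partial>lborel\<bar> \<le> X"
      using order.trans[OF ennreal_abs_integral_le kX] X0 by simp
    moreover have "X \<le> C * (e * (1 + e ^ 3))"
    proof -
      have k: "k1 * (C6 * e ^ 3) = 2/3 * C6 * (e * (1 + e ^ 3)) + 4/3 * c5 * C6 * e"
        using e by (simp add: k1_def field_simps power2_eq_square power3_eq_cube)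
      have le: "e \<le> e * (1 + e ^ 3)" using e by simp
      have "X = L * (4/3 * (1 + 25 * M) * e + 2/3 * C6 * (e * (1 + e ^ 3)) + 2/3 * (25 * M) * e + 4/3 * c5 * (C6 + V + 25 * M) * e)"
        unfolding X_def k by (simp add: k2_def k3_def algebra_simps)
      also have "\<dots> \<le> L * (4/3 * (1 + 25 * M) * (e * (1 + e ^ 3)) + 2/3 * C6 * (e * (1 + e ^ 3)) + 2/3 * (25 * M) * (e * (1 + e ^ 3))
          + 4/3 * c5 * (C6 + V + 25 * M) * (e * (1 + e ^ 3)))"
        using le pos M by (intro mult_left_mono add_mono order.refl) auto
      also have "\<dots> = C * (e * (1 + e ^ 3))" unfolding C_def by algebra
      finally show ?thesis .
    qed
    ultimately show "integrable lborel (\<lambda>x. head_flux W g U x \<bullet> grad unit_cutoff x) \<and>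
      \<bar>\<integral>x. head_flux W g U x \<bullet> grad unit_cutoff x \<partial>lborel\<bar> \<le> C * (e * (1 + e ^ 3))"
      using fi unfolding f_def by auto
  qed
qed

section \<open>Scaling and the conclusion\<close>

lemma integral_scale:
  fixes F :: "real ^ 5 \<Rightarrow> real"
  assumes "t > 0" "F \<in> borel_measurable borel"
  shows "(\<integral>z. F z \<partial>lborel) = t ^ 5 * (\<integral>y. F (t *\<^sub>R y) \<partial>lborel)"
  using integral_affine[OF assms, of 0] by (simp only: add_0)

lemma grad_scale:
  fixes \<phi> :: "real ^ 'n \<Rightarrow> real"
  assumes "smooth_fun \<phi>"
  shows "grad (\<lambda>x. \<phi> (c *\<^sub>R x)) x = c *\<^sub>R grad \<phi> (c *\<^sub>R x)"
proof (rule grad_eqI)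
  show "((\<lambda>x. \<phi> (c *\<^sub>R x)) has_derivative (\<lambda>h. (c *\<^sub>R grad \<phi> (c *\<^sub>R x)) \<bullet> h)) (at x)"
    using has_derivative_compose[OF bounded_linear_imp_has_derivative[OF bounded_linear_scaleR_right]
        smooth_fun_has_derivative[OF assms]] by simp
qed

lemma test_fun_smooth: "test_fun G \<phi> \<Longrightarrow> smooth_fun \<phi>"
  by (simp add: test_fun_def smooth_fun_def)

lemma test_fun_scale:
  fixes \<phi> :: "real ^ 'n \<Rightarrow> real"
  assumes \<phi>: "test_fun G \<phi>" and t: "t > 0" and G: "\<And>x. x \<in> G \<Longrightarrow> t *\<^sub>R x \<in> G"
  shows "test_fun G (\<lambda>x. \<phi> ((1 / t) *\<^sub>R x))"
proof -
  obtain K where K: "compact K" "K \<subseteq> G" "\<And>x. x \<notin> K \<Longrightarrow> \<phi> x = 0"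
    using test_funD[OF \<phi>] by metis
  show ?thesis
  proof (rule test_funI[OF smooth_fun_comp_scale[OF test_fun_smooth[OF \<phi>]] compact_scaling[OF K(1), of t]])
    show "(*\<^sub>R) t ` K \<subseteq> G" using K(2) G by auto
    fix x assume x: "x \<notin> (*\<^sub>R) t ` K"
    have "(1 / t) *\<^sub>R x \<notin> K"
    proof
      assume "(1 / t) *\<^sub>R x \<in> K"
      then have "t *\<^sub>R ((1 / t) *\<^sub>R x) \<in> (*\<^sub>R) t ` K" by (rule imageI)
      with x t show False by simp
    qed
    then show "\<phi> ((1 / t) *\<^sub>R x) = 0" by (rule K(3))
  qed
qed

lemma shell_scale: "t > 0 \<Longrightarrow> t *\<^sub>R y \<in> shell (t\<^sup>2 * p) (t\<^sup>2 * q) \<longleftrightarrow> y \<in> shell p q"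
  by (simp add: shell_def power_mult_distrib)

lemma grad_measurable: "smooth_fun \<phi> \<Longrightarrow> grad \<phi> \<in> borel_measurable borel"
  by (rule borel_measurable_continuous_onI[OF smooth_fun_continuous_grad])

lemma smooth_fun_measurable: "smooth_fun \<phi> \<Longrightarrow> \<phi> \<in> borel_measurable borel"
  by (rule borel_measurable_continuous_onI[OF smooth_fun_continuous])

text \<open>The Navier--Stokes scaling by the factor \<open>\<mu>\<^sup>2\<close>; the square avoids fractional powers.\<close>

abbreviation scaled_W :: "real \<Rightarrow> (real ^ 5 \<Rightarrow> real) \<Rightarrow> real ^ 5 \<Rightarrow> real" where
  "scaled_W \<mu> W \<equiv> \<lambda>x. \<mu> ^ 3 * W (\<mu>\<^sup>2 *\<^sub>R x)"

abbreviation scaled_g :: "real \<Rightarrow> (real ^ 5 \<Rightarrow> real ^ 5) \<Rightarrow> real ^ 5 \<Rightarrow> real ^ 5" where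
  "scaled_g \<mu> g \<equiv> \<lambda>x. \<mu> ^ 5 *\<^sub>R g (\<mu>\<^sup>2 *\<^sub>R x)"

abbreviation scaled_U :: "real \<Rightarrow> (real ^ 5 \<Rightarrow> real ^ 5) \<Rightarrow> real ^ 5 \<Rightarrow> real ^ 5" where
  "scaled_U \<mu> U \<equiv> \<lambda>x. \<mu>\<^sup>2 *\<^sub>R U (\<mu>\<^sup>2 *\<^sub>R x)"

text \<open>\<mu>^10 is the Jacobian of x -> \<mu>^2 x in dimension five. With k = 10 the integral
  of |g|^2 is invariant; with k = 6 those of W^2 and |U|^3 acquire the factor \<mu>^-4, which
  matches the growth bound at radius \<mu>^2 r.\<close>

lemma nn_integral_scaled:
  fixes f :: "real ^ 5 \<Rightarrow> real"
  assumes \<mu>: "\<mu> > 0" and [measurable]: "f \<in> borel_measurable borel" "B \<in> sets borel" and f: "\<And>x. 0 \<le> f x"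
    and A: "\<And>y. y \<in> A \<longleftrightarrow> \<mu>\<^sup>2 *\<^sub>R y \<in> B"
  shows "(\<integral>\<^sup>+y\<in>A. ennreal (\<mu> ^ k * f (\<mu>\<^sup>2 *\<^sub>R y)) \<partial>lborel) = ennreal (\<mu> ^ k / \<mu> ^ 10) * (\<integral>\<^sup>+x\<in>B. ennreal (f x) \<partial>lborel)"
proof -
  have m: "(\<mu>\<^sup>2) ^ 5 = \<mu> ^ 10" by (simp add: power_mult[symmetric])
  have "(\<integral>\<^sup>+x\<in>B. ennreal (f x) \<partial>lborel) = ennreal (\<mu> ^ 10) * (\<integral>\<^sup>+y. ennreal (f (\<mu>\<^sup>2 *\<^sub>R y)) * indicator B (\<mu>\<^sup>2 *\<^sub>R y) \<partial>lborel)"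
    using nn_integral_affine[of "\<mu>\<^sup>2" "\<lambda>x. ennreal (f x) * indicator B x" 0] \<mu> by (simp add: m)
  then have "ennreal (\<mu> ^ k / \<mu> ^ 10) * (\<integral>\<^sup>+x\<in>B. ennreal (f x) \<partial>lborel) =
    (ennreal (\<mu> ^ k / \<mu> ^ 10) * ennreal (\<mu> ^ 10)) * (\<integral>\<^sup>+y. ennreal (f (\<mu>\<^sup>2 *\<^sub>R y)) * indicator B (\<mu>\<^sup>2 *\<^sub>R y) \<partial>lborel)"
    by (simp add: mult.assoc)
  also have "ennreal (\<mu> ^ k / \<mu> ^ 10) * ennreal (\<mu> ^ 10) = ennreal (\<mu> ^ k)"
    using \<mu> by (simp add: ennreal_mult'[symmetric])
  also have "ennreal (\<mu> ^ k) * (\<integral>\<^sup>+y. ennreal (f (\<mu>\<^sup>2 *\<^sub>R y)) * indicator B (\<mu>\<^sup>2 *\<^sub>R y) \<partial>lborel) =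
    (\<integral>\<^sup>+y. ennreal (\<mu> ^ k) * (ennreal (f (\<mu>\<^sup>2 *\<^sub>R y)) * indicator B (\<mu>\<^sup>2 *\<^sub>R y)) \<partial>lborel)"
    by (rule nn_integral_cmult[symmetric]) measurable
  also have "\<dots> = (\<integral>\<^sup>+y\<in>A. ennreal (\<mu> ^ k * f (\<mu>\<^sup>2 *\<^sub>R y)) \<partial>lborel)"
    using \<mu> f by (intro nn_integral_cong) (auto simp: indicator_def A ennreal_mult)
  finally show ?thesis by simp
qed

text \<open>Both terms of the flux are homogeneous of the same degree: 3 + 5 = 2 * 3 + 2 =
  8.\<close>

lemma head_flux_scaled:
  "head_flux (scaled_W \<mu> W) (scaled_g \<mu> g) (scaled_U \<mu> U) x = \<mu> ^ 8 *\<^sub>R head_flux W g U (\<mu>\<^sup>2 *\<^sub>R x)"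
proof -
  have c: "2/3 * (\<mu> ^ 3 * w)\<^sup>2 * \<mu>\<^sup>2 = \<mu> ^ 8 * (2/3 * w\<^sup>2)" "4/3 * (\<mu> ^ 3 * w) * \<mu> ^ 5 = \<mu> ^ 8 * (4/3 * w)" for w
    by (simp_all add: power_mult_distrib eval_nat_numeral)
  show ?thesis unfolding head_flux_def scaleR_diff_right scaleR_scaleR c ..
qed

text \<open>The Jacobian \<mu>^10 and the factor \<mu>^-2 from the gradient of the rescaled test
  function combine to the \<mu>^8 of \<open>head_flux_scaled\<close>, so the total flux is
  dimensionless.\<close>

lemma flux_scaled:
  assumes \<mu>: "\<mu> > 0" and \<phi>: "smooth_fun \<phi>"
    and [measurable]: "W \<in> borel_measurable borel" "g \<in> borel_measurable borel" "U \<in> borel_measurable borel"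
  shows "(\<integral>x. head_flux W g U x \<bullet> grad (\<lambda>x. \<phi> ((1 / \<mu>\<^sup>2) *\<^sub>R x)) x \<partial>lborel) =
      (\<integral>x. head_flux (scaled_W \<mu> W) (scaled_g \<mu> g) (scaled_U \<mu> U) x \<bullet> grad \<phi> x \<partial>lborel)"
    "integrable lborel (\<lambda>x. head_flux W g U x \<bullet> grad (\<lambda>x. \<phi> ((1 / \<mu>\<^sup>2) *\<^sub>R x)) x) \<longleftrightarrow>
      integrable lborel (\<lambda>x. head_flux (scaled_W \<mu> W) (scaled_g \<mu> g) (scaled_U \<mu> U) x \<bullet> grad \<phi> x)"
proof -
  note [measurable] = grad_measurable[OF \<phi>] grad_measurable[OF smooth_fun_comp_scale[OF \<phi>, of "1 / \<mu>\<^sup>2"]]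
  let ?F = "\<lambda>x. head_flux W g U x \<bullet> grad (\<lambda>x. \<phi> ((1 / \<mu>\<^sup>2) *\<^sub>R x)) x"
  let ?G = "\<lambda>x. head_flux (scaled_W \<mu> W) (scaled_g \<mu> g) (scaled_U \<mu> U) x \<bullet> grad \<phi> x"
  have [measurable]: "?F \<in> borel_measurable borel" unfolding head_flux_def by measurable
  have t: "0 < \<mu>\<^sup>2" using \<mu> by simp
  have eq: "?F (\<mu>\<^sup>2 *\<^sub>R y) = (1 / \<mu> ^ 10) * ?G y" for y
  proof -
    define X where "X = head_flux W g U (\<mu>\<^sup>2 *\<^sub>R y) \<bullet> grad \<phi> y"
    have "?F (\<mu>\<^sup>2 *\<^sub>R y) = (1 / \<mu>\<^sup>2) * X" unfolding grad_scale[OF \<phi>] X_def using \<mu> by simp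
    also have "\<dots> = \<mu> ^ 8 / (\<mu> ^ 8 * \<mu>\<^sup>2) * X" using \<mu> by (subst nonzero_divide_mult_cancel_left) auto
    also have "\<mu> ^ 8 * \<mu>\<^sup>2 = \<mu> ^ 10" by (simp only: power_add[symmetric]) simp
    also have "\<mu> ^ 8 / \<mu> ^ 10 * X = (1 / \<mu> ^ 10) * (\<mu> ^ 8 * X)" by simp
    also have "\<mu> ^ 8 * X = ?G y" unfolding head_flux_scaled X_def by simp
    finally show ?thesis .
  qed
  show "(\<integral>x. ?F x \<partial>lborel) = (\<integral>x. ?G x \<partial>lborel)"
    unfolding integral_scale[OF t \<open>?F \<in> borel_measurable borel\<close>] eq
    using \<mu> by (simp add: power_mult[symmetric])
  show "integrable lborel ?F \<longleftrightarrow> integrable lborel ?G"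
  proof -
    have "integrable lborel ?F \<longleftrightarrow> integrable lborel (\<lambda>y. ?F (\<mu>\<^sup>2 *\<^sub>R y))"
      using integrable_affine_iff[OF t, of ?F 0] by simp
    also have "\<dots> \<longleftrightarrow> integrable lborel ?G"
    proof
      assume "integrable lborel (\<lambda>y. ?F (\<mu>\<^sup>2 *\<^sub>R y))"
      then have "integrable lborel (\<lambda>y. \<mu> ^ 10 * ?F (\<mu>\<^sup>2 *\<^sub>R y))" by (rule integrable_mult_right)
      then show "integrable lborel ?G" unfolding eq using \<mu> by simp
    next
      assume "integrable lborel ?G"
      then show "integrable lborel (\<lambda>y. ?F (\<mu>\<^sup>2 *\<^sub>R y))" unfolding eq by (rule integrable_mult_right)
    qed
    finally show ?thesis .
  qed
qed

lemma head_system_scale: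
  assumes h: "head_system M W g U" and \<mu>: "\<mu> > 0"
  shows "head_system M (scaled_W \<mu> W) (scaled_g \<mu> g) (scaled_U \<mu> U)"
proof -
  note hD = head_systemD[OF h]
  note lw = loc_weak_gradD[OF hD(6)]
  note [measurable] = hD(2,3,4)
  have t: "0 < \<mu>\<^sup>2" using \<mu> by simp
  have ten: "(\<mu>\<^sup>2) ^ 5 = \<mu> ^ 10" by (simp add: power_mult[symmetric])
  have half: "\<mu> ^ 10 * (1 / \<mu> ^ 5 * I) = \<mu> ^ 5 * I" for I
  proof -
    have "\<mu> ^ 10 / \<mu> ^ 5 = \<mu> ^ 5" using power_diff[of \<mu> 5 10] \<mu> by simp
    then have "\<mu> ^ 10 / \<mu> ^ 5 * I = \<mu> ^ 5 * I" by (rule arg_cong)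
    then show ?thesis by simp
  qed
  have G: "x \<in> UNIV - {0} \<Longrightarrow> \<mu>\<^sup>2 *\<^sub>R x \<in> UNIV - {0}" for x :: "real ^ 5" using \<mu> by simp
  \<comment> \<open>A dilate of a compact set off the origin is again such a set, so local
    integrability is inherited.\<close>
  have si: "set_integrable lborel K (\<lambda>y. f (\<mu>\<^sup>2 *\<^sub>R y))"
    if K: "compact K" "K \<subseteq> UNIV - {0}" and f: "f \<in> borel_measurable borel"
      "\<And>K. compact K \<Longrightarrow> K \<subseteq> UNIV - {0} \<Longrightarrow> set_integrable lborel K f" for K and f :: "real ^ 5 \<Rightarrow> real"
  proof -
    let ?K = "(*\<^sub>R) (\<mu>\<^sup>2) ` K"
    have c: "compact ?K" using K(1) by (rule compact_scaling)
    have m: "\<mu>\<^sup>2 *\<^sub>R y \<in> ?K \<longleftrightarrow> y \<in> K" for y using \<mu> by (auto simp: image_iff)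
    have [measurable]: "?K \<in> sets borel" using compact_imp_closed[OF c] by (rule borel_closed)
    have "?K \<subseteq> UNIV - {0}" using K(2) \<mu> by auto
    with c have "set_integrable lborel ?K f" by (rule f(2))
    then have "integrable lborel (\<lambda>x. indicator ?K x * f x)" by (simp add: set_integrable_def)
    then have "integrable lborel (\<lambda>y. indicator ?K (\<mu>\<^sup>2 *\<^sub>R y) * f (\<mu>\<^sup>2 *\<^sub>R y))"
      using integrable_affine_iff[OF t, of "\<lambda>x. indicator ?K x * f x" 0] f(1) by simp
    moreover have "indicator ?K (\<mu>\<^sup>2 *\<^sub>R y) = (indicator K y :: real)" for y by (simp add: indicator_def m)
    ultimately show ?thesis by (simp add: set_integrable_def)
  qed
  have lwg: "loc_weak_grad (UNIV - {0}) (scaled_W \<mu> W) (scaled_g \<mu> g)"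
    unfolding loc_weak_grad_def
  proof (intro conjI allI impI)
    fix K :: "(real ^ 5) set" assume K: "compact K \<and> K \<subseteq> UNIV - {0}"
    then have Km [measurable]: "K \<in> sets borel" by (intro borel_closed compact_imp_closed) auto
    show "set_integrable lborel K (scaled_W \<mu> W)"
      using si[of K W] K lw(1,3) by (intro set_integrable_mult_right) auto
    have "set_integrable lborel K (\<lambda>y. norm (g (\<mu>\<^sup>2 *\<^sub>R y)))"
      using si[of K "\<lambda>x. norm (g x)"] K lw(2,5) by auto
    then have "integrable lborel (\<lambda>y. \<mu> ^ 5 * (indicator K y * norm (g (\<mu>\<^sup>2 *\<^sub>R y))))"
      by (intro integrable_mult_right) (simp add: set_integrable_def)
    moreover have "norm (indicator K y *\<^sub>R scaled_g \<mu> g y) = \<mu> ^ 5 * (indicator K y * norm (g (\<mu>\<^sup>2 *\<^sub>R y)))" for y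
      using \<mu> by (simp add: indicator_def)
    ultimately have "integrable lborel (\<lambda>y. norm (indicator K y *\<^sub>R scaled_g \<mu> g y))" by (simp only:)
    then show "set_integrable lborel K (scaled_g \<mu> g)"
      unfolding set_integrable_def by (subst (asm) integrable_norm_iff) measurable
  next
    fix i and \<phi> :: "real ^ 5 \<Rightarrow> real" assume \<phi>: "test_fun (UNIV - {0}) \<phi>"
    note sm = test_fun_smooth[OF \<phi>]
    note [measurable] = smooth_fun_measurable[OF sm] grad_measurable[OF sm]
    let ?\<psi> = "\<lambda>x. \<phi> ((1 / \<mu>\<^sup>2) *\<^sub>R x)"
    have [measurable]: "(\<lambda>x. partial_deriv i ?\<psi> x) \<in> borel_measurable borel"
      unfolding partial_deriv_eq_grad grad_scale[OF sm] by measurable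
    have "(\<integral>x. W x * partial_deriv i ?\<psi> x \<partial>lborel) = \<mu> ^ 10 * (\<integral>y. W (\<mu>\<^sup>2 *\<^sub>R y) * partial_deriv i ?\<psi> (\<mu>\<^sup>2 *\<^sub>R y) \<partial>lborel)"
      unfolding ten[symmetric] by (rule integral_scale[OF t]) measurable
    also have "\<dots> = \<mu> ^ 5 * (\<integral>y. scaled_W \<mu> W y * partial_deriv i \<phi> y \<partial>lborel)"
    proof -
      have "W (\<mu>\<^sup>2 *\<^sub>R y) * partial_deriv i ?\<psi> (\<mu>\<^sup>2 *\<^sub>R y) = (1 / \<mu> ^ 5) * (scaled_W \<mu> W y * partial_deriv i \<phi> y)" for y
        unfolding partial_deriv_eq_grad grad_scale[OF sm] using \<mu> by (simp add: field_simps eval_nat_numeral)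
      then show ?thesis by (simp only: integral_mult_right_zero half)
    qed
    finally have 1: "(\<integral>x. W x * partial_deriv i ?\<psi> x \<partial>lborel) = \<mu> ^ 5 * (\<integral>y. scaled_W \<mu> W y * partial_deriv i \<phi> y \<partial>lborel)" .
    have "(\<integral>x. g x $ i * ?\<psi> x \<partial>lborel) = \<mu> ^ 10 * (\<integral>y. g (\<mu>\<^sup>2 *\<^sub>R y) $ i * ?\<psi> (\<mu>\<^sup>2 *\<^sub>R y) \<partial>lborel)"
      unfolding ten[symmetric] by (rule integral_scale[OF t]) measurable
    also have "\<dots> = \<mu> ^ 5 * (\<integral>y. scaled_g \<mu> g y $ i * \<phi> y \<partial>lborel)"
    proof -
      have "g (\<mu>\<^sup>2 *\<^sub>R y) $ i * ?\<psi> (\<mu>\<^sup>2 *\<^sub>R y) = (1 / \<mu> ^ 5) * (scaled_g \<mu> g y $ i * \<phi> y)" for y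
        using \<mu> by simp
      then show ?thesis by (simp only: integral_mult_right_zero half)
    qed
    finally have 2: "(\<integral>x. g x $ i * ?\<psi> x \<partial>lborel) = \<mu> ^ 5 * (\<integral>y. scaled_g \<mu> g y $ i * \<phi> y \<partial>lborel)" .
    have "\<mu> ^ 5 * (\<integral>y. scaled_W \<mu> W y * partial_deriv i \<phi> y \<partial>lborel) = \<mu> ^ 5 * - (\<integral>y. scaled_g \<mu> g y $ i * \<phi> y \<partial>lborel)"
      using lw(6)[OF test_fun_scale[OF \<phi> t G], of i] unfolding 1 2 by simp
    then show "(\<integral>y. scaled_W \<mu> W y * partial_deriv i \<phi> y \<partial>lborel) = - (\<integral>y. scaled_g \<mu> g y $ i * \<phi> y \<partial>lborel)"
      using \<mu> by (subst (asm) mult_left_cancel) auto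
  qed measurable
  have ball: "y \<in> ball 0 r \<longleftrightarrow> \<mu>\<^sup>2 *\<^sub>R y \<in> ball 0 (\<mu>\<^sup>2 * r)" for y :: "real ^ 5" and r using \<mu> by simp
  have cube: "ennreal (\<mu> ^ 6 / \<mu> ^ 10) * ennreal (M * (\<mu>\<^sup>2 * r)\<^sup>2) = ennreal (M * r\<^sup>2)" for r
    using \<mu> by (subst ennreal_mult'[symmetric]) (auto simp: power_mult_distrib eval_nat_numeral)
  show ?thesis
    unfolding head_system_def
  proof (intro conjI allI impI lwg hD(1))
    show "0 \<le> scaled_W \<mu> W x" for x using \<mu> hD(5) by simp
    show "(\<integral>\<^sup>+x\<in>shell p q. ennreal ((norm (scaled_g \<mu> g x))\<^sup>2) \<partial>lborel) < \<infinity>" if "0 < p" for p q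
    proof -
      have "(\<integral>\<^sup>+x\<in>shell p q. ennreal ((norm (scaled_g \<mu> g x))\<^sup>2) \<partial>lborel) =
        (\<integral>\<^sup>+x\<in>shell p q. ennreal (\<mu> ^ 10 * (norm (g (\<mu>\<^sup>2 *\<^sub>R x)))\<^sup>2) \<partial>lborel)"
        using \<mu> by (simp add: power_mult_distrib power_mult[symmetric])
      also have "\<dots> = ennreal (\<mu> ^ 10 / \<mu> ^ 10) * (\<integral>\<^sup>+x\<in>shell ((\<mu>\<^sup>2)\<^sup>2 * p) ((\<mu>\<^sup>2)\<^sup>2 * q). ennreal ((norm (g x))\<^sup>2) \<partial>lborel)"
        by (rule nn_integral_scaled[OF \<mu> _ _ _ shell_scale[OF t, symmetric]]) auto
      also have "\<dots> < \<infinity>" using hD(7)[of "(\<mu>\<^sup>2)\<^sup>2 * p" "(\<mu>\<^sup>2)\<^sup>2 * q"] that t by simp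
      finally show ?thesis .
    qed
    show "(\<integral>\<^sup>+x\<in>ball 0 r. ennreal ((scaled_W \<mu> W x)\<^sup>2) \<partial>lborel) \<le> ennreal (M * r\<^sup>2)" if r: "0 < r" for r
    proof -
      have "(\<integral>\<^sup>+x\<in>ball 0 r. ennreal ((scaled_W \<mu> W x)\<^sup>2) \<partial>lborel) = (\<integral>\<^sup>+x\<in>ball 0 r. ennreal (\<mu> ^ 6 * (W (\<mu>\<^sup>2 *\<^sub>R x))\<^sup>2) \<partial>lborel)"
        by (simp add: power_mult_distrib power_mult[symmetric])
      also have "\<dots> = ennreal (\<mu> ^ 6 / \<mu> ^ 10) * (\<integral>\<^sup>+x\<in>ball 0 (\<mu>\<^sup>2 * r). ennreal ((W x)\<^sup>2) \<partial>lborel)"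
        by (rule nn_integral_scaled[OF \<mu> _ _ _ ball]) auto
      also have "\<dots> \<le> ennreal (\<mu> ^ 6 / \<mu> ^ 10) * ennreal (M * (\<mu>\<^sup>2 * r)\<^sup>2)"
        using \<mu> r by (intro mult_left_mono hD(8)) auto
      finally show ?thesis unfolding cube .
    qed
    show "(\<integral>\<^sup>+x\<in>ball 0 r. ennreal (norm (scaled_U \<mu> U x) ^ 3) \<partial>lborel) \<le> ennreal (M * r\<^sup>2)" if r: "0 < r" for r
    proof -
      have "(\<integral>\<^sup>+x\<in>ball 0 r. ennreal (norm (scaled_U \<mu> U x) ^ 3) \<partial>lborel) = (\<integral>\<^sup>+x\<in>ball 0 r. ennreal (\<mu> ^ 6 * norm (U (\<mu>\<^sup>2 *\<^sub>R x)) ^ 3) \<partial>lborel)"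
        by (simp add: power_mult_distrib power_mult[symmetric])
      also have "\<dots> = ennreal (\<mu> ^ 6 / \<mu> ^ 10) * (\<integral>\<^sup>+x\<in>ball 0 (\<mu>\<^sup>2 * r). ennreal (norm (U x) ^ 3) \<partial>lborel)"
        by (rule nn_integral_scaled[OF \<mu> _ _ _ ball]) auto
      also have "\<dots> \<le> ennreal (\<mu> ^ 6 / \<mu> ^ 10) * ennreal (M * (\<mu>\<^sup>2 * r)\<^sup>2)"
        using \<mu> r by (intro mult_left_mono hD(9)) auto
      finally show ?thesis unfolding cube .
    qed
    show "8/9 * (\<integral>x. (norm (scaled_g \<mu> g x))\<^sup>2 * \<phi> x \<partial>lborel) \<le>
      - (\<integral>x. head_flux (scaled_W \<mu> W) (scaled_g \<mu> g) (scaled_U \<mu> U) x \<bullet> grad \<phi> x \<partial>lborel)"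
      if \<phi>: "test_fun (UNIV - {0}) \<phi> \<and> (\<forall>x. 0 \<le> \<phi> x)" for \<phi>
    proof -
      note sm = test_fun_smooth[OF conjunct1[OF \<phi>]]
      note [measurable] = smooth_fun_measurable[OF sm]
      have "(\<integral>x. (norm (g x))\<^sup>2 * \<phi> ((1 / \<mu>\<^sup>2) *\<^sub>R x) \<partial>lborel) =
          \<mu> ^ 10 * (\<integral>y. (norm (g (\<mu>\<^sup>2 *\<^sub>R y)))\<^sup>2 * \<phi> ((1 / \<mu>\<^sup>2) *\<^sub>R \<mu>\<^sup>2 *\<^sub>R y) \<partial>lborel)"
        unfolding ten[symmetric] by (rule integral_scale[OF t]) measurable
      also have "\<dots> = (\<integral>y. \<mu> ^ 10 * ((norm (g (\<mu>\<^sup>2 *\<^sub>R y)))\<^sup>2 * \<phi> y) \<partial>lborel)" using \<mu> by simp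
      also have "\<dots> = (\<integral>y. (norm (scaled_g \<mu> g y))\<^sup>2 * \<phi> y \<partial>lborel)"
        using \<mu> by (intro Bochner_Integration.integral_cong) (auto simp: power_mult_distrib power_mult[symmetric])
      finally have e: "(\<integral>x. (norm (g x))\<^sup>2 * \<phi> ((1 / \<mu>\<^sup>2) *\<^sub>R x) \<partial>lborel) = (\<integral>y. (norm (scaled_g \<mu> g y))\<^sup>2 * \<phi> y \<partial>lborel)" .
      have "8/9 * (\<integral>x. (norm (g x))\<^sup>2 * \<phi> ((1 / \<mu>\<^sup>2) *\<^sub>R x) \<partial>lborel) \<le>
        - (\<integral>x. head_flux W g U x \<bullet> grad (\<lambda>x. \<phi> ((1 / \<mu>\<^sup>2) *\<^sub>R x)) x \<partial>lborel)"
        by (rule hD(10)[OF test_fun_scale[OF conjunct1[OF \<phi>] t G]]) (use \<phi> in auto)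
      then show ?thesis unfolding e flux_scaled(1)[OF \<mu> sm hD(3,4,2)] .
    qed
    show "(\<integral>x. scaled_U \<mu> U x \<bullet> grad \<phi> x \<partial>lborel) = 0" if \<phi>: "test_fun UNIV \<phi>" for \<phi>
    proof -
      note sm = test_fun_smooth[OF \<phi>]
      note [measurable] = grad_measurable[OF smooth_fun_comp_scale[OF sm, of "1 / \<mu>\<^sup>2"]]
      let ?F = "\<lambda>x. U x \<bullet> grad (\<lambda>x. \<phi> ((1 / \<mu>\<^sup>2) *\<^sub>R x)) x"
      have m: "?F \<in> borel_measurable borel" by measurable
      have eq: "?F (\<mu>\<^sup>2 *\<^sub>R y) = (1 / \<mu> ^ 4) * (scaled_U \<mu> U y \<bullet> grad \<phi> y)" for y
        unfolding grad_scale[OF sm] using \<mu> by (simp add: field_simps eval_nat_numeral)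
      have "(\<integral>x. ?F x \<partial>lborel) = 0" by (rule hD(11)[OF test_fun_scale[OF \<phi> t]]) simp
      then show ?thesis unfolding integral_scale[OF t m] eq using \<mu> by simp
    qed
  qed measurable
qed

text \<open>The factor \<mu>^10 of the scaled |g|^2 cancels the Jacobian. Shells are described by
  squared radii, so their bounds scale by \<mu>^4.\<close>

lemma energy_scaled:
  assumes h: "head_system M W g U" and \<mu>: "\<mu> > 0" and p: "0 < p"
  shows "energy (scaled_g \<mu> g) p q = energy g (\<mu> ^ 4 * p) (\<mu> ^ 4 * q)"
proof -
  have [measurable]: "g \<in> borel_measurable borel" by (rule head_systemD(4)[OF h])
  have t: "0 < \<mu>\<^sup>2" using \<mu> by simp
  have f: "(\<mu>\<^sup>2)\<^sup>2 = \<mu> ^ 4" by (simp add: power_mult[symmetric])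
  have "ennreal (energy (scaled_g \<mu> g) p q) = (\<integral>\<^sup>+x\<in>shell p q. ennreal ((norm (scaled_g \<mu> g x))\<^sup>2) \<partial>lborel)"
    by (rule energy_props(3)[OF head_system_scale[OF h \<mu>] p, symmetric])
  also have "\<dots> = (\<integral>\<^sup>+x\<in>shell p q. ennreal (\<mu> ^ 10 * (norm (g (\<mu>\<^sup>2 *\<^sub>R x)))\<^sup>2) \<partial>lborel)"
    using \<mu> by (simp add: power_mult_distrib power_mult[symmetric])
  also have "\<dots> = ennreal (\<mu> ^ 10 / \<mu> ^ 10) * (\<integral>\<^sup>+x\<in>shell ((\<mu>\<^sup>2)\<^sup>2 * p) ((\<mu>\<^sup>2)\<^sup>2 * q). ennreal ((norm (g x))\<^sup>2) \<partial>lborel)"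
    by (rule nn_integral_scaled[OF \<mu> _ _ _ shell_scale[OF t, symmetric]]) auto
  also have "\<dots> = ennreal (energy g (\<mu> ^ 4 * p) (\<mu> ^ 4 * q))"
    using \<mu> p energy_props(3)[OF h, of "\<mu> ^ 4 * p" "\<mu> ^ 4 * q"] by (simp add: f)
  finally show ?thesis
    using energy_props(2)[OF h, of "\<mu> ^ 4 * p" "\<mu> ^ 4 * q"] energy_props(2)[OF head_system_scale[OF h \<mu>] p] \<mu> p
    by (subst (asm) ennreal_inj) auto
qed

section \<open>Energy between two scales\<close>

lemma unit_cutoff_range: "0 \<le> unit_cutoff x" "unit_cutoff x \<le> 1"
  by (simp_all add: unit_cutoff_def cutoff_range)

text \<open>The test function is the cutoff at scale \<mu> minus that at scale \<nu>. By 2 \<nu>^4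
  \<le> \<mu>^4 the outer cutoff equals 1 wherever the inner one is positive, so the difference is
  nonnegative; near the origin both equal 1, so the difference vanishes there.\<close>

lemma annulus_energy_le_flux:
  assumes h: "head_system M W g U" and mn: "0 < \<nu>" "0 < \<mu>" "2 * \<nu> ^ 4 \<le> \<mu> ^ 4"
    and int: "integrable lborel (\<lambda>x. head_flux W g U x \<bullet> grad (\<lambda>x. unit_cutoff ((1 / \<mu>\<^sup>2) *\<^sub>R x)) x)"
      "integrable lborel (\<lambda>x. head_flux W g U x \<bullet> grad (\<lambda>x. unit_cutoff ((1 / \<nu>\<^sup>2) *\<^sub>R x)) x)"
  shows "8/9 * energy g (2 * \<nu> ^ 4) (\<mu> ^ 4) \<le>
    (\<integral>x. head_flux W g U x \<bullet> grad (\<lambda>x. unit_cutoff ((1 / \<nu>\<^sup>2) *\<^sub>R x)) x \<partial>lborel) -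
    (\<integral>x. head_flux W g U x \<bullet> grad (\<lambda>x. unit_cutoff ((1 / \<mu>\<^sup>2) *\<^sub>R x)) x \<partial>lborel)"
proof -
  define \<phi> where "\<phi> x = unit_cutoff ((1 / \<mu>\<^sup>2) *\<^sub>R x) - unit_cutoff ((1 / \<nu>\<^sup>2) *\<^sub>R x)" for x :: "real ^ 5"
  have sm: "smooth_fun (\<lambda>x. unit_cutoff ((1 / \<sigma>\<^sup>2) *\<^sub>R x))" for \<sigma>
    by (rule smooth_fun_comp_scale[OF smooth_fun_unit_cutoff])
  have n: "(norm ((1 / \<sigma>\<^sup>2) *\<^sub>R x))\<^sup>2 = (norm x)\<^sup>2 / \<sigma> ^ 4" for \<sigma> and x :: "real ^ 5"
    by (simp add: power_divide power_mult[symmetric])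
  have one: "unit_cutoff ((1 / \<sigma>\<^sup>2) *\<^sub>R x) = 1" if "(norm x)\<^sup>2 \<le> \<sigma> ^ 4" "0 < \<sigma>" for \<sigma> x
    by (rule unit_cutoff_eq_1) (use that in \<open>simp add: n del: norm_scaleR\<close>)
  have zero: "unit_cutoff ((1 / \<sigma>\<^sup>2) *\<^sub>R x) = 0" if "2 * \<sigma> ^ 4 \<le> (norm x)\<^sup>2" "0 < \<sigma>" for \<sigma> x
    by (rule unit_cutoff_eq_0) (use that in \<open>simp add: n field_simps del: norm_scaleR\<close>)
  have pos: "0 < \<nu> ^ 4" "0 < \<mu> ^ 4" using mn by auto
  have tf: "test_fun (UNIV - {0}) \<phi>"
  proof (rule test_funI[OF _ compact_shell[of "\<nu> ^ 4" "2 * \<mu> ^ 4"]])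
    show "smooth_fun \<phi>" unfolding \<phi>_def[abs_def] by (intro smooth_fun_diff sm)
    show "shell (\<nu> ^ 4) (2 * \<mu> ^ 4) \<subseteq> UNIV - {0}" using shell_avoids_0 pos by auto
    fix x assume "x \<notin> shell (\<nu> ^ 4) (2 * \<mu> ^ 4)"
    then consider "(norm x)\<^sup>2 < \<nu> ^ 4" | "2 * \<mu> ^ 4 < (norm x)\<^sup>2" by (auto simp: shell_def)
    then show "\<phi> x = 0"
    proof cases
      case 1
      then have "(norm x)\<^sup>2 \<le> \<nu> ^ 4" "(norm x)\<^sup>2 \<le> \<mu> ^ 4" using mn pos by linarith+
      then show ?thesis using mn by (simp only: \<phi>_def one)
    next
      case 2
      then have "2 * \<mu> ^ 4 \<le> (norm x)\<^sup>2" "2 * \<nu> ^ 4 \<le> (norm x)\<^sup>2" using mn pos by linarith+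
      then show ?thesis using mn by (simp only: \<phi>_def zero)
    qed
  qed
  have nonneg: "0 \<le> \<phi> x" for x
  proof (cases "(norm x)\<^sup>2 \<le> \<mu> ^ 4")
    case True
    show ?thesis unfolding \<phi>_def one[OF True mn(2)] using unit_cutoff_range(2) by simp
  next
    case False
    then have "2 * \<nu> ^ 4 \<le> (norm x)\<^sup>2" using mn by linarith
    from zero[OF this mn(1)] show ?thesis unfolding \<phi>_def using unit_cutoff_range(1) by simp
  qed
  have eq1: "\<phi> x = 1" if "x \<in> shell (2 * \<nu> ^ 4) (\<mu> ^ 4)" for x
    using that one[of x \<mu>] zero[of \<nu> x] mn unfolding \<phi>_def shell_def by simp
  have gr: "grad \<phi> x = grad (\<lambda>x. unit_cutoff ((1 / \<mu>\<^sup>2) *\<^sub>R x)) x - grad (\<lambda>x. unit_cutoff ((1 / \<nu>\<^sup>2) *\<^sub>R x)) x" for x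
  proof (rule grad_eqI)
    show "(\<phi> has_derivative (\<lambda>h. (grad (\<lambda>x. unit_cutoff ((1 / \<mu>\<^sup>2) *\<^sub>R x)) x - grad (\<lambda>x. unit_cutoff ((1 / \<nu>\<^sup>2) *\<^sub>R x)) x) \<bullet> h)) (at x)"
      unfolding \<phi>_def[abs_def] inner_diff_left by (intro has_derivative_diff smooth_fun_has_derivative sm)
  qed
  have "8/9 * energy g (2 * \<nu> ^ 4) (\<mu> ^ 4) \<le> 8/9 * (\<integral>x. (norm (g x))\<^sup>2 * \<phi> x \<partial>lborel)"
    using energy_le_test[OF h tf nonneg eq1] pos by simp
  also have "\<dots> \<le> - (\<integral>x. head_flux W g U x \<bullet> grad \<phi> x \<partial>lborel)"
    by (rule head_systemD(10)[OF h tf nonneg])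
  also have "(\<integral>x. head_flux W g U x \<bullet> grad \<phi> x \<partial>lborel) =
    (\<integral>x. head_flux W g U x \<bullet> grad (\<lambda>x. unit_cutoff ((1 / \<mu>\<^sup>2) *\<^sub>R x)) x \<partial>lborel) -
    (\<integral>x. head_flux W g U x \<bullet> grad (\<lambda>x. unit_cutoff ((1 / \<nu>\<^sup>2) *\<^sub>R x)) x \<partial>lborel)"
    unfolding gr inner_diff_right by (rule Bochner_Integration.integral_diff[OF int])
  finally show ?thesis by simp
qed

text \<open>Used in two ways: the annuli between the scales 1 / (n+2) and n+2 eventually contain a
  given shell, and the shells located at these two scales eventually leave every point. The factors
  4 match the bounds \<mu>^4 / 4 and 4 \<mu>^4 of the latter.\<close>

lemma shell_exhaustion:
  assumes "0 < p"
  shows "eventually (\<lambda>n. 4 * (1 / (real n + 2)) ^ 4 < p \<and> q < (real n + 2) ^ 4 / 4) sequentially"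
proof -
  have "eventually (\<lambda>n. real n > 4 * \<bar>q\<bar> + 4 / p) sequentially"
    using filterlim_real_sequentially unfolding filterlim_at_top_dense by blast
  then show ?thesis
  proof eventually_elim
    case (elim n)
    define m where "m = real n + 2"
    have "0 < 4 / p" using assms by simp
    then have m: "1 \<le> m" "4 * \<bar>q\<bar> < m" "4 / p < m" using elim abs_ge_zero[of q] unfolding m_def by linarith+
    have "m ^ 1 \<le> m ^ 4" by (rule power_increasing) (use m in auto)
    then have m4: "m \<le> m ^ 4" by simp
    have "4 / p < m ^ 4" using m m4 by linarith
    then have "4 * (1 / m) ^ 4 < p" using assms m by (simp add: field_simps power_divide)
    moreover have "q < m ^ 4 / 4" using m m4 by linarith
    ultimately show ?case by (simp add: m_def)
  qed
qed

lemma energy_vanishes: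
  assumes h: "head_system M W g U" and p: "0 < p"
  shows "energy g p q = 0"
proof -
  note hD = head_systemD[OF h]
  note [measurable] = hD(2,3,4)
  obtain C0 where C0: "C0 > 0" "\<And>W g U. head_system M W g U \<Longrightarrow> energy g (1/4) 4 \<le> C0"
    using energy_bound[OF hD(1)] by blast
  obtain C where C: "C > 0" "\<And>W g U e. \<lbrakk>head_system M W g U; 0 < e; energy g (1/4) 4 \<le> e\<^sup>2\<rbrakk> \<Longrightarrow>
    integrable lborel (\<lambda>x. head_flux W g U x \<bullet> grad unit_cutoff x) \<and>
    \<bar>\<integral>x. head_flux W g U x \<bullet> grad unit_cutoff x \<partial>lborel\<bar> \<le> C * (e * (1 + e ^ 3))"
    using flux_bound[OF hD(1)] by blast
  define T where "T \<mu> = (\<integral>x. head_flux W g U x \<bullet> grad (\<lambda>x. unit_cutoff ((1 / \<mu>\<^sup>2) *\<^sub>R x)) x \<partial>lborel)" for \<mu>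
  define F where "F \<mu> = energy g (\<mu> ^ 4 * (1/4)) (\<mu> ^ 4 * 4)" for \<mu>
  have Fe: "energy (scaled_g \<mu> g) (1/4) 4 = F \<mu>" if "\<mu> > 0" for \<mu>
    unfolding F_def by (rule energy_scaled[OF h that]) simp
  \<comment> \<open>Here e is any positive number with F \<mu> \<le> e^2, not the root itself, since
    \<open>flux_bound\<close> requires e > 0 and the energy may vanish.\<close>
  have TI: "integrable lborel (\<lambda>x. head_flux W g U x \<bullet> grad (\<lambda>x. unit_cutoff ((1 / \<mu>\<^sup>2) *\<^sub>R x)) x)"
    and TB: "\<bar>T \<mu>\<bar> \<le> C * (e * (1 + e ^ 3))" if "\<mu> > 0" "0 < e" "F \<mu> \<le> e\<^sup>2" for \<mu> e
    unfolding T_def flux_scaled[OF that(1) smooth_fun_unit_cutoff hD(3,4,2)]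
    using C(2)[OF head_system_scale[OF h that(1)] that(2)] that(3) Fe[OF that(1)] by simp_all
  \<comment> \<open>One value of e that is admissible at every scale. It makes the total energy
    finite, and only then do smaller values become available.\<close>
  define e0 where "e0 = sqrt C0"
  have e0: "0 < e0" using C0 by (simp add: e0_def)
  have Fe0: "F \<mu> \<le> e0\<^sup>2" if "\<mu> > 0" for \<mu>
    using C0(2)[OF head_system_scale[OF h that]] C0(1) by (simp add: Fe[OF that] e0_def)
  have key: "8/9 * energy g (2 * \<nu> ^ 4) (\<mu> ^ 4) \<le> \<bar>T \<nu>\<bar> + \<bar>T \<mu>\<bar>" if "0 < \<nu>" "0 < \<mu>" "2 * \<nu> ^ 4 \<le> \<mu> ^ 4" for \<nu> \<mu>
    using annulus_energy_le_flux[OF h that TI[OF that(2) e0 Fe0[OF that(2)]] TI[OF that(1) e0 Fe0[OF that(1)]]]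
    unfolding T_def[symmetric] by linarith
  define mu nu where "mu n = real n + 2" and "nu n = 1 / (real n + 2)" for n :: nat
  have mn: "0 < mu n" "0 < nu n" "2 * nu n ^ 4 \<le> mu n ^ 4" for n
  proof -
    have "1 \<le> (real n + 2) ^ 4 * (real n + 2) ^ 3" by (intro mult_ge1_I one_le_power) auto
    then have "1 * 2 \<le> (real n + 2) ^ 4 * (real n + 2) ^ 3 * (real n + 2)" by (intro mult_mono) auto
    then have "2 \<le> (real n + 2) ^ 4 * (real n + 2) ^ 4" by (simp add: eval_nat_numeral mult_ac)
    then show "2 * nu n ^ 4 \<le> mu n ^ 4" by (simp add: mu_def nu_def power_divide divide_le_eq)
  qed (auto simp: mu_def nu_def)
  define A where "A n = shell (2 * nu n ^ 4) (mu n ^ 4)" for n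
  \<comment> \<open>9/4 is 9/8 times 2: the energy of an annulus is bounded by two fluxes of the
    same size.\<close>
  define D where "D = 9/4 * (C * (e0 * (1 + e0 ^ 3)))"
  have AD: "energy g (2 * nu n ^ 4) (mu n ^ 4) \<le> D" for n
    using key[OF mn(2,1,3), of n] TB[OF mn(1) e0 Fe0[OF mn(1)], of n] TB[OF mn(2) e0 Fe0[OF mn(2)], of n]
    unfolding D_def by linarith
  have fin: "(\<integral>\<^sup>+x\<in>UNIV - {0}. ennreal ((norm (g x))\<^sup>2) \<partial>lborel) \<le> ennreal D"
  proof -
    let ?f = "\<lambda>n x. ennreal ((norm (g x))\<^sup>2) * indicator (A n) x"
    have inc: "incseq ?f"
    proof (rule incseq_SucI, rule le_funI)
      fix n x
      have "mu n ^ 4 \<le> mu (Suc n) ^ 4" "nu (Suc n) ^ 4 \<le> nu n ^ 4"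
        unfolding mu_def nu_def by (intro power_mono divide_left_mono; simp)+
      then have "A n \<subseteq> A (Suc n)" unfolding A_def by (intro shell_mono) auto
      then show "?f n x \<le> ?f (Suc n) x" by (auto simp: indicator_def)
    qed
    have "(\<integral>\<^sup>+x\<in>UNIV - {0}. ennreal ((norm (g x))\<^sup>2) \<partial>lborel) \<le> (\<integral>\<^sup>+x. (SUP n. ?f n x) \<partial>lborel)"
    proof (rule nn_integral_mono)
      fix x :: "real ^ 5"
      show "ennreal ((norm (g x))\<^sup>2) * indicator (UNIV - {0}) x \<le> (SUP n. ?f n x)"
      proof (cases "x = 0")
        case False
        then have "0 < (norm x)\<^sup>2" by simp
        from shell_exhaustion[OF this, of "(norm x)\<^sup>2"] obtain n
          where n: "4 * (1 / (real n + 2)) ^ 4 < (norm x)\<^sup>2" "(norm x)\<^sup>2 < (real n + 2) ^ 4 / 4"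
          unfolding eventually_sequentially by blast
        have "0 \<le> (1 / (real n + 2)) ^ 4" "0 \<le> (real n + 2) ^ 4" by auto
        then have "2 * (1 / (real n + 2)) ^ 4 \<le> (norm x)\<^sup>2" "(norm x)\<^sup>2 \<le> (real n + 2) ^ 4" using n by linarith+
        then have "x \<in> A n" unfolding A_def shell_def mu_def nu_def by simp
        then have "ennreal ((norm (g x))\<^sup>2) * indicator (UNIV - {0}) x \<le> ?f n x" using False by simp
        also have "\<dots> \<le> (SUP n. ?f n x)" by (rule SUP_upper) simp
        finally show ?thesis .
      qed simp
    qed
    also have "\<dots> = (SUP n. \<integral>\<^sup>+x. ?f n x \<partial>lborel)"
      by (rule nn_integral_monotone_convergence_SUP[OF inc]) (simp add: A_def)
    also have "\<dots> \<le> ennreal D"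
    proof (rule SUP_least)
      fix n
      have "(\<integral>\<^sup>+x. ?f n x \<partial>lborel) = ennreal (energy g (2 * nu n ^ 4) (mu n ^ 4))"
        unfolding A_def by (rule energy_props(3)[OF h]) (use mn(2)[of n] in simp)
      also have "\<dots> \<le> ennreal D" by (rule ennreal_leI[OF AD])
      finally show "(\<integral>\<^sup>+x. ?f n x \<partial>lborel) \<le> ennreal D" .
    qed
    finally show ?thesis .
  qed
  \<comment> \<open>The finite total energy is the majorant for the dominated convergence
    below.\<close>
  have G: "integrable lborel (\<lambda>x. indicator (UNIV - {0}) x * (norm (g x))\<^sup>2)"
  proof (rule integrableI_bounded)
    have "(\<integral>\<^sup>+x. ennreal (norm (indicator (UNIV - {0}) x * (norm (g x))\<^sup>2)) \<partial>lborel) =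
      (\<integral>\<^sup>+x\<in>UNIV - {0}. ennreal ((norm (g x))\<^sup>2) \<partial>lborel)"
      by (intro nn_integral_cong) (auto simp: indicator_def)
    also have "\<dots> < \<infinity>" using fin by (auto intro: order.strict_trans1)
    finally show "(\<integral>\<^sup>+x. ennreal (norm (indicator (UNIV - {0}) x * (norm (g x))\<^sup>2)) \<partial>lborel) < \<infinity>" .
  qed simp
  \<comment> \<open>Shells that eventually leave every point carry energy tending to 0. This is
    applied outwards along \<open>mu\<close> and inwards along \<open>nu\<close>.\<close>
  have F0: "(\<lambda>n. F (\<sigma> n)) \<longlonglongrightarrow> 0" if \<sigma>: "\<And>n. 0 < \<sigma> n"
    "\<And>x :: real ^ 5. x \<noteq> 0 \<Longrightarrow> eventually (\<lambda>n. x \<notin> shell (\<sigma> n ^ 4 * (1/4)) (\<sigma> n ^ 4 * 4)) sequentially" for \<sigma>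
  proof -
    have "(\<lambda>n. \<integral>x. indicator (shell (\<sigma> n ^ 4 * (1/4)) (\<sigma> n ^ 4 * 4)) x * (norm (g x))\<^sup>2 \<partial>lborel) \<longlonglongrightarrow>
      (\<integral>x. 0 \<partial>(lborel :: (real ^ 5) measure))"
    proof (rule integral_dominated_convergence[OF _ _ G])
      show "AE x in lborel. (\<lambda>n. indicator (shell (\<sigma> n ^ 4 * (1/4)) (\<sigma> n ^ 4 * 4)) x * (norm (g x))\<^sup>2) \<longlonglongrightarrow> 0"
      proof (rule AE_I2)
        fix x :: "real ^ 5"
        have "eventually (\<lambda>n. indicator (shell (\<sigma> n ^ 4 * (1/4)) (\<sigma> n ^ 4 * 4)) x * (norm (g x))\<^sup>2 = 0) sequentially"
        proof (cases "x = 0")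
          case True
          then have "x \<notin> shell (\<sigma> n ^ 4 * (1/4)) (\<sigma> n ^ 4 * 4)" for n
            using \<sigma>(1)[of n] shell_avoids_0[of "\<sigma> n ^ 4 * (1/4)"] by auto
          then show ?thesis by simp
        next
          case False
          from \<sigma>(2)[OF this] show ?thesis by eventually_elim simp
        qed
        then show "(\<lambda>n. indicator (shell (\<sigma> n ^ 4 * (1/4)) (\<sigma> n ^ 4 * 4)) x * (norm (g x))\<^sup>2) \<longlonglongrightarrow> 0"
          by (rule tendsto_eventually)
      qed
      show "AE x in lborel. norm (indicator (shell (\<sigma> n ^ 4 * (1/4)) (\<sigma> n ^ 4 * 4)) x * (norm (g x))\<^sup>2) \<le>
        indicator (UNIV - {0}) x * (norm (g x))\<^sup>2" for n
        using \<sigma>(1)[of n] shell_avoids_0[of "\<sigma> n ^ 4 * (1/4)"] by (intro AE_I2) (auto simp: indicator_def)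
    qed measurable
    then show ?thesis by (simp add: F_def energy_def set_lebesgue_integral_def)
  qed
  have out: "(\<lambda>n. F (mu n)) \<longlonglongrightarrow> 0"
  proof (rule F0[OF mn(1)])
    fix x :: "real ^ 5" assume "x \<noteq> 0"
    then have "0 < (norm x)\<^sup>2" by simp
    from shell_exhaustion[OF this, of "(norm x)\<^sup>2"]
    show "eventually (\<lambda>n. x \<notin> shell (mu n ^ 4 * (1/4)) (mu n ^ 4 * 4)) sequentially"
      by eventually_elim (auto simp: shell_def mu_def)
  qed
  have inn: "(\<lambda>n. F (nu n)) \<longlonglongrightarrow> 0"
  proof (rule F0[OF mn(2)])
    fix x :: "real ^ 5" assume "x \<noteq> 0"
    then have "0 < (norm x)\<^sup>2" by simp
    from shell_exhaustion[OF this, of "(norm x)\<^sup>2"]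
    show "eventually (\<lambda>n. x \<notin> shell (nu n ^ 4 * (1/4)) (nu n ^ 4 * 4)) sequentially"
      by eventually_elim (auto simp: shell_def nu_def mult.commute)
  qed
  \<comment> \<open>For e \<le> 1 each of the two fluxes is at most 2 C e, and 9/8 of their sum is
    9/2 C e.\<close>
  have small: "energy g p q \<le> 9/2 * C * e" if e: "0 < e" "e \<le> 1" for e
  proof -
    have "0 < e\<^sup>2" using e by simp
    have "eventually (\<lambda>n. F (mu n) < e\<^sup>2 \<and> F (nu n) < e\<^sup>2 \<and>
        4 * (1 / (real n + 2)) ^ 4 < p \<and> q < (real n + 2) ^ 4 / 4) sequentially"
      using order_tendstoD(2)[OF out \<open>0 < e\<^sup>2\<close>] order_tendstoD(2)[OF inn \<open>0 < e\<^sup>2\<close>] shell_exhaustion[OF p, of q]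
      by eventually_elim simp
    then obtain n where n: "F (mu n) < e\<^sup>2" "F (nu n) < e\<^sup>2" "4 * nu n ^ 4 < p" "q < mu n ^ 4 / 4"
      unfolding eventually_sequentially mu_def nu_def by blast
    have "energy g p q \<le> energy g (2 * nu n ^ 4) (mu n ^ 4)"
      using n(3,4) zero_less_power[OF mn(1), of n 4] zero_less_power[OF mn(2), of n 4] by (intro energy_mono[OF h]) linarith+
    moreover have "\<bar>T (mu n)\<bar> \<le> C * (e * (1 + e ^ 3))" "\<bar>T (nu n)\<bar> \<le> C * (e * (1 + e ^ 3))"
      using TB[OF mn(1) e(1)] TB[OF mn(2) e(1)] n by auto
    moreover have "C * (e * (1 + e ^ 3)) \<le> C * (e * 2)"
      using C e power_le_one[of e 3] by (intro mult_left_mono) auto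
    ultimately show ?thesis using key[OF mn(2,1,3), of n] by linarith
  qed
  have "energy g p q \<le> 0"
  proof (rule ccontr)
    assume "\<not> energy g p q \<le> 0"
    then have E: "0 < energy g p q" by simp
    \<comment> \<open>With this e the bound \<open>small\<close> is at most half of the energy,
      which is absurd.\<close>
    define e where "e = min 1 (energy g p q / (9 * C))"
    have e: "0 < e" "e \<le> 1" "e \<le> energy g p q / (9 * C)" using E C by (auto simp: e_def)
    have "9/2 * C * e \<le> 9/2 * C * (energy g p q / (9 * C))" using e C by (intro mult_left_mono) auto
    also have "\<dots> = energy g p q / 2" using C by simp
    finally show False using small[OF e(1,2)] E by linarith
  qed
  then show ?thesis using energy_props(2)[OF h p, of q] by linarith
qed

section \<open>Vanishing of \<open>W\<close>\<close>

lemma cball_subset_shell: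
  assumes "0 < a" "x \<in> shell (a\<^sup>2) (b\<^sup>2)" "0 \<le> b"
  shows "cball x (a / 2) \<subseteq> shell ((a / 2)\<^sup>2) ((b + a / 2)\<^sup>2)"
proof
  fix z assume "z \<in> cball x (a / 2)"
  then have d: "\<bar>norm z - norm x\<bar> \<le> a / 2"
    using norm_triangle_ineq3[of z x] by (simp add: dist_norm norm_minus_commute)
  have "a \<le> norm x" "norm x \<le> b"
    using assms by (auto simp: shell_def intro: power2_le_imp_le)
  then have "a / 2 \<le> norm z" "norm z \<le> b + a / 2" using d by linarith+
  then show "z \<in> shell ((a / 2)\<^sup>2) ((b + a / 2)\<^sup>2)"
    using assms by (auto simp: shell_def intro!: power_mono)
qed

text \<open>The energy is zero on every shell, so the Sobolev estimates apply with e = 0: by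
  \<open>mollify_L3\<close> W agrees a.e. with its mollification, and by
  \<open>shell_oscillation\<close> the mollification has no oscillation. Working at one fixed radius
  avoids any limit of mollifications.\<close>

lemma W_constant_on_shell:
  assumes h: "head_system M W g U" and pq: "0 < p" "p \<le> q"
  obtains c where "AE x in lborel. x \<in> shell p q \<longrightarrow> W x = c"
proof -
  note hD = head_systemD[OF h]
  note [measurable] = hD(2,3,4)
  \<comment> \<open>a is the inner radius of the enlarged shell from
    \<open>shell_oscillation\<close>, so balls of radius a / 2 around its points avoid the
    origin.\<close>
  define a where "a = sqrt (p / 2)"
  define b where "b = sqrt q"
  have ab: "0 < a" "0 \<le> b" "a\<^sup>2 = p / 2" "b\<^sup>2 = q" using pq by (auto simp: a_def b_def)
  define K where "K = shell ((a / 2)\<^sup>2) ((b + a / 2)\<^sup>2)"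
  have K: "compact K" "K \<subseteq> UNIV - {0}" unfolding K_def using compact_shell shell_avoids_0 ab by auto
  have Kg: "L2_le K g 0"
    using energy_props(1)[OF h, of "(a / 2)\<^sup>2" "(b + a / 2)\<^sup>2"] energy_vanishes[OF h, of "(a / 2)\<^sup>2" "(b + a / 2)\<^sup>2"] ab
    by (simp add: K_def)
  have sub: "cball x (a / 2) \<subseteq> K" if "x \<in> shell (p / 2) q" for x
    unfolding K_def using cball_subset_shell[OF ab(1) _ ab(2)] that ab(3,4) by simp
  have sub1: "shell p q \<subseteq> shell (p / 2) q" using pq by (intro shell_mono) auto
  have t: "0 < a / 2" using ab by simp
  have "(\<integral>\<^sup>+x\<in>shell p q. ennreal (\<bar>W x - mollify W (a / 2) x\<bar> ^ 3) \<partial>lborel) \<le>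
    ennreal (16 * mollify_const * ball_const * sqrt (a / 2) * 0 ^ 3)"
    by (rule mollify_L3[OF hD(6) K Kg]) (use sub sub1 t in auto)
  then have "(\<integral>\<^sup>+x\<in>shell p q. ennreal (\<bar>W x - mollify W (a / 2) x\<bar> ^ 3) \<partial>lborel) = 0" by simp
  then have ae: "AE x in lborel. ennreal (\<bar>W x - mollify W (a / 2) x\<bar> ^ 3) * indicator (shell p q) x = 0"
    by (subst (asm) nn_integral_0_iff_AE) auto
  define x0 :: "real ^ 5" where "x0 = sqrt p *\<^sub>R axis 1 1"
  have x0: "x0 \<in> shell p q" using pq by (simp add: x0_def shell_def)
  show thesis
  proof (rule that[of "mollify W (a / 2) x0"])
    show "AE x in lborel. x \<in> shell p q \<longrightarrow> W x = mollify W (a / 2) x0"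
      using ae
    proof eventually_elim
      case (elim x)
      show ?case
      proof
        assume x: "x \<in> shell p q"
        have "\<bar>mollify W (a / 2) x - mollify W (a / 2) x0\<bar> \<le>
          4 * sqrt q / (mollifier_mass * (a / 2) ^ 5) * (sqrt (ball_const * (a / 2) ^ 5) * 0)"
          by (rule shell_oscillation[OF hD(6) K Kg t sub pq(1) x x0])
        moreover have "\<bar>W x - mollify W (a / 2) x\<bar> ^ 3 \<le> 0" using elim x by simp
        ultimately show "W x = mollify W (a / 2) x0" by (simp add: power_le_zero_eq)
      qed
    qed
  qed
qed

text \<open>b \<ge> 2 a gives b^5 \<ge> 32 a^5, so removing the inner ball costs at most half of the
  volume.\<close>

lemma measure_shell_ge:
  assumes "0 < a" "2 * a \<le> b"
  shows "ennreal (ball_const * b ^ 5 / 2) \<le> emeasure lborel (shell (a\<^sup>2) (b\<^sup>2))"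
proof -
  have "cball 0 b - cball (0 :: real ^ 5) a \<subseteq> shell (a\<^sup>2) (b\<^sup>2)"
    using assms by (auto simp: shell_def intro!: power_mono)
  then have le: "emeasure lborel (cball 0 b - cball (0 :: real ^ 5) a) \<le> emeasure lborel (shell (a\<^sup>2) (b\<^sup>2))"
    by (intro emeasure_mono) auto
  have f: "emeasure lborel (cball (0 :: real ^ 5) r) \<noteq> \<infinity>" for r
    using less_imp_neq[OF emeasure_lborel_cball_finite[of 0 r]] by simp
  have "emeasure lborel (cball 0 b - cball (0 :: real ^ 5) a) = emeasure lborel (cball (0 :: real ^ 5) b) - emeasure lborel (cball (0 :: real ^ 5) a)"
    using assms f by (intro emeasure_Diff) auto
  also have "\<dots> = ennreal (ball_const * b ^ 5) - ennreal (ball_const * a ^ 5)"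
    using assms f measure_cball_5[of _ 0] by (simp add: emeasure_eq_ennreal_measure)
  also have "\<dots> = ennreal (ball_const * b ^ 5 - ball_const * a ^ 5)"
    using assms ball_const_pos by (intro ennreal_minus) auto
  finally have e: "emeasure lborel (cball 0 b - cball (0 :: real ^ 5) a) = ennreal (ball_const * b ^ 5 - ball_const * a ^ 5)" .
  have "(2 * a) ^ 5 \<le> b ^ 5" using assms by (intro power_mono) auto
  then have "32 * a ^ 5 \<le> b ^ 5" by (simp add: power_mult_distrib)
  moreover have "0 \<le> a ^ 5" using assms by simp
  ultimately have "2 * a ^ 5 \<le> b ^ 5" by linarith
  then have "ball_const * (2 * a ^ 5) \<le> ball_const * b ^ 5" using ball_const_pos by (intro mult_left_mono) auto
  then have "ennreal (ball_const * b ^ 5 / 2) \<le> ennreal (ball_const * b ^ 5 - ball_const * a ^ 5)"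
    by (intro ennreal_leI) simp
  with e le show ?thesis by simp
qed

text \<open>On the shell from a to b the function W is a constant c; its volume is of order b^5 and
  its share of W^2 at most of order b^2, so c^2 is of order b^-3. The constants for different b are
  never compared: the limit is taken in the integral over a fixed inner shell.\<close>

lemma head_system_trivial:
  assumes h: "head_system M W g U"
  shows "AE x in lborel. W x = 0"
proof -
  note hD = head_systemD[OF h]
  note [measurable] = hD(2,3,4)
  have shell0: "AE x in lborel. x \<in> shell (a\<^sup>2) (d\<^sup>2) \<longrightarrow> W x = 0" if a: "0 < a" "2 * a \<le> d" for a d
  proof -
    have d: "0 < d" using a by simp
    have bound: "(\<integral>\<^sup>+x\<in>shell (a\<^sup>2) (d\<^sup>2). ennreal ((W x)\<^sup>2) \<partial>lborel) \<le> ennreal (8 * M / (ball_const * b ^ 3) * (ball_const * d ^ 5))"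
      if b: "d \<le> b" for b
    proof -
      have b0: "0 < b" using b d by simp
      have "a\<^sup>2 \<le> b\<^sup>2" using a b by (intro power_mono) auto
      then obtain c where c: "AE x in lborel. x \<in> shell (a\<^sup>2) (b\<^sup>2) \<longrightarrow> W x = c"
        using W_constant_on_shell[OF h, of "a\<^sup>2" "b\<^sup>2"] a by auto
      have ic: "(\<integral>\<^sup>+x\<in>S. ennreal ((W x)\<^sup>2) \<partial>lborel) = ennreal (c\<^sup>2) * emeasure lborel S"
        if S: "S \<subseteq> shell (a\<^sup>2) (b\<^sup>2)" "S \<in> sets borel" for S
      proof -
        have "(\<integral>\<^sup>+x\<in>S. ennreal ((W x)\<^sup>2) \<partial>lborel) = (\<integral>\<^sup>+x. ennreal (c\<^sup>2) * indicator S x \<partial>lborel)"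
          using c S(1) by (intro nn_integral_cong_AE) (auto elim!: eventually_mono simp: indicator_def)
        then show ?thesis using S(2) by (simp add: nn_integral_cmult_indicator)
      qed
      have "ennreal (c\<^sup>2) * ennreal (ball_const * b ^ 5 / 2) \<le> ennreal (c\<^sup>2) * emeasure lborel (shell (a\<^sup>2) (b\<^sup>2))"
        using a b by (intro mult_left_mono measure_shell_ge) auto
      also have "\<dots> = (\<integral>\<^sup>+x\<in>shell (a\<^sup>2) (b\<^sup>2). ennreal ((W x)\<^sup>2) \<partial>lborel)" by (rule ic[symmetric]) auto
      also have "\<dots> \<le> (\<integral>\<^sup>+x\<in>ball 0 (2 * b). ennreal ((W x)\<^sup>2) \<partial>lborel)"
      proof (rule nn_integral_indicator_mono)
        show "x \<in> ball 0 (2 * b)" if "x \<in> shell (a\<^sup>2) (b\<^sup>2)" for x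
          using subsetD[OF shell_subset_ball that, of "2 * b"] b0 by (simp add: power_mult_distrib)
      qed
      also have "\<dots> \<le> ennreal (M * (2 * b)\<^sup>2)" by (rule hD(8)) (use b0 in simp)
      finally have "ennreal (c\<^sup>2) * ennreal (ball_const * b ^ 5 / 2) \<le> ennreal (M * (2 * b)\<^sup>2)" .
      then have "ennreal (c\<^sup>2 * (ball_const * b ^ 5 / 2)) \<le> ennreal (M * (2 * b)\<^sup>2)" by (subst ennreal_mult') auto
      then have "c\<^sup>2 * (ball_const * b ^ 5 / 2) \<le> M * (2 * b)\<^sup>2" using hD(1) by (subst (asm) ennreal_le_iff) auto
      then have "c\<^sup>2 * (ball_const * b ^ 5 / 2) / (ball_const * b ^ 5 / 2) \<le> M * (2 * b)\<^sup>2 / (ball_const * b ^ 5 / 2)"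
        using ball_const_pos b0 by (intro divide_right_mono) auto
      then have c2: "c\<^sup>2 \<le> 8 * M / (ball_const * b ^ 3)"
        using ball_const_pos b0 by (simp add: power_mult_distrib) (simp add: field_simps eval_nat_numeral)
      have "(\<integral>\<^sup>+x\<in>shell (a\<^sup>2) (d\<^sup>2). ennreal ((W x)\<^sup>2) \<partial>lborel) = ennreal (c\<^sup>2) * emeasure lborel (shell (a\<^sup>2) (d\<^sup>2))"
        using b d by (intro ic shell_mono) (auto intro: power_mono)
      also have "emeasure lborel (shell (a\<^sup>2) (d\<^sup>2)) \<le> emeasure lborel (cball (0 :: real ^ 5) d)"
        using d by (intro emeasure_mono) (auto simp: shell_def intro: power2_le_imp_le)
      also have "\<dots> = ennreal (ball_const * d ^ 5)"
        using emeasure_lborel_cball_finite[of "0 :: real ^ 5" d] measure_cball_5[of d 0] d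
        by (simp add: emeasure_eq_ennreal_measure)
      also have "ennreal (c\<^sup>2) * ennreal (ball_const * d ^ 5) \<le> ennreal (8 * M / (ball_const * b ^ 3)) * ennreal (ball_const * d ^ 5)"
        by (intro mult_right_mono ennreal_leI c2) simp
      also have "\<dots> = ennreal (8 * M / (ball_const * b ^ 3) * (ball_const * d ^ 5))"
        using hD(1) ball_const_pos b0 d by (intro ennreal_mult[symmetric]) auto
      finally show ?thesis by (simp add: mult_left_mono)
    qed
    have "((\<lambda>n. 8 * M * d ^ 5 * inverse (real n)) \<longlongrightarrow> 8 * M * d ^ 5 * 0) sequentially"
      by (intro tendsto_intros lim_inverse_n)
    then have lim: "((\<lambda>n. ennreal (8 * M * d ^ 5 * inverse (real n))) \<longlongrightarrow> ennreal (8 * M * d ^ 5 * 0)) sequentially"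
      by (rule tendsto_ennrealI)
    have ev: "eventually (\<lambda>n. (\<integral>\<^sup>+x\<in>shell (a\<^sup>2) (d\<^sup>2). ennreal ((W x)\<^sup>2) \<partial>lborel) \<le> ennreal (8 * M * d ^ 5 * inverse (real n))) sequentially"
    proof -
      have "eventually (\<lambda>n. real n > d + 1) sequentially"
        using filterlim_real_sequentially unfolding filterlim_at_top_dense by blast
      then show ?thesis
      proof eventually_elim
        case (elim n)
        have n: "1 \<le> real n" "d \<le> real n" using elim d by auto
        have "real n ^ 1 \<le> real n ^ 3" by (rule power_increasing) (use n in auto)
        then have i: "inverse (real n ^ 3) \<le> inverse (real n)" using n by (intro le_imp_inverse_le) auto
        have "8 * M / (ball_const * real n ^ 3) * (ball_const * d ^ 5) = 8 * M * d ^ 5 * inverse (real n ^ 3)"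
          using ball_const_pos n by (simp add: field_simps)
        also have "\<dots> \<le> 8 * M * d ^ 5 * inverse (real n)"
          using hD(1) d by (intro mult_left_mono i) auto
        finally show ?case using bound[OF n(2)] by (auto intro: order.trans ennreal_leI)
      qed
    qed
    have "(\<integral>\<^sup>+x\<in>shell (a\<^sup>2) (d\<^sup>2). ennreal ((W x)\<^sup>2) \<partial>lborel) \<le> ennreal (8 * M * d ^ 5 * 0)"
      by (rule tendsto_lowerbound[OF lim ev]) simp
    then have "(\<integral>\<^sup>+x\<in>shell (a\<^sup>2) (d\<^sup>2). ennreal ((W x)\<^sup>2) \<partial>lborel) = 0" by simp
    then have "AE x in lborel. ennreal ((W x)\<^sup>2) * indicator (shell (a\<^sup>2) (d\<^sup>2)) x = 0"
      by (subst (asm) nn_integral_0_iff_AE) auto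
    then show ?thesis by eventually_elim auto
  qed
  \<comment> \<open>Countably many shells exhaust the complement of the origin, and the origin is a
    null set.\<close>
  have "AE x in lborel. \<forall>n. x \<in> shell ((1 / (real n + 2))\<^sup>2) ((real n + 2)\<^sup>2) \<longrightarrow> W x = 0"
  proof (subst AE_all_countable, rule allI, rule shell0)
    fix n
    have "2 \<le> (real n + 2) * (real n + 2)" by (simp add: algebra_simps)
    then show "2 * (1 / (real n + 2)) \<le> real n + 2" by (simp add: divide_le_eq)
  qed simp
  moreover have "AE x :: real ^ 5 in lborel. x \<noteq> 0"
    by (rule AE_lborel_singleton)
  ultimately show ?thesis
  proof eventually_elim
    case (elim x)
    obtain n where "norm x + 1 / norm x < real n" using reals_Archimedean2 by blast
    moreover have nx: "0 < norm x" "0 < 1 / norm x" using elim(2) by auto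
    ultimately have n: "norm x \<le> real n + 2" "1 / norm x \<le> real n + 2" by linarith+
    then have "1 / (real n + 2) \<le> norm x" using nx by (simp add: field_simps)
    then have "x \<in> shell ((1 / (real n + 2))\<^sup>2) ((real n + 2)\<^sup>2)"
      unfolding shell_def using n(1) by (simp only: mem_Collect_eq) (intro conjI power_mono; simp)
    with elim(1) show "W x = 0" by blast
  qed
qed

section \<open>From suitable weak solutions to head-pressure systems\<close>

lemma borel_measurable_vecI:
  fixes f :: "'a \<Rightarrow> real ^ 'n"
  assumes "\<And>i. (\<lambda>x. f x $ i) \<in> borel_measurable M"
  shows "f \<in> borel_measurable M"
  using assms by (subst borel_measurable_euclidean_space) (auto simp: Basis_vec_def inner_axis)

lemma borel_representative_vec:
  fixes f :: "real ^ 5 \<Rightarrow> real ^ 5"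
  assumes "f \<in> borel_measurable lebesgue"
  obtains f' where "f' \<in> borel_measurable borel" "AE x in lborel. f x = f' x"
proof -
  have "\<forall>i. \<exists>h. h \<in> borel_measurable lborel \<and> (AE x in lborel. f x $ i = h x)"
    using completion_ex_borel_measurable_real[OF borel_measurable_nth[OF assms]] by blast
  then obtain h where h: "\<And>i. h i \<in> borel_measurable lborel" "\<And>i. AE x in lborel. f x $ i = h i x"
    by metis
  show thesis
  proof (rule that[of "\<lambda>x. \<chi> i. h i x"])
    show "(\<lambda>x. \<chi> i. h i x) \<in> borel_measurable borel"
      by (rule borel_measurable_vecI) (use h(1) in simp)
    have "AE x in lborel. \<forall>i\<in>UNIV. f x $ i = h i x"
      by (rule AE_finite_allI) (auto intro: h(2))
    then show "AE x in lborel. f x = (\<chi> i. h i x)"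
      by eventually_elim (simp add: vec_eq_iff)
  qed
qed

text \<open>Passage from the completed measure on G to a Borel representative on the whole space.
  The a.e. assumption includes x \<in> G, since G will be the whole space or the complement of the
  origin, both of full measure.\<close>

lemma set_lebesgue_integral_eq_lborel:
  fixes F F' :: "real ^ 5 \<Rightarrow> real"
  assumes m: "F' \<in> borel_measurable borel" and ae: "AE x in lborel. x \<in> G \<and> F x = F' x"
  shows "(LINT x:G|lebesgue. F x) = (\<integral>x. F' x \<partial>lborel)"
proof -
  have a: "AE x in lebesgue. F' x = indicator G x *\<^sub>R F x"
    using AE_completion[OF ae] by eventually_elim auto
  have F': "F' \<in> borel_measurable lborel" using m by simp
  have F'l: "F' \<in> borel_measurable lebesgue" by (rule measurable_completion[OF F'])
  have "(LINT x:G|lebesgue. F x) = (\<integral>x. F' x \<partial>lebesgue)"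
    unfolding set_lebesgue_integral_def
    by (rule integral_cong_AE[OF borel_measurable_AE[OF F'l a] F'l]) (use a in \<open>auto elim!: eventually_mono\<close>)
  also have "\<dots> = (\<integral>x. F' x \<partial>lborel)" by (rule integral_completion[OF F'])
  finally show ?thesis .
qed

lemma L_loc_finite_lborel:
  fixes f f' :: "real ^ 5 \<Rightarrow> 'b::euclidean_space"
  assumes L: "L_loc p G f" and ae: "AE x in lborel. f x = f' x" and K: "compact K" "K \<subseteq> G"
  shows "(\<integral>\<^sup>+x\<in>K. ennreal (norm (f' x) powr p) \<partial>lborel) < \<infinity>"
proof -
  have "integrable lebesgue (\<lambda>x. indicator K x *\<^sub>R (norm (f x) powr p))"
    using L K by (auto simp: L_loc_def set_integrable_def)
  then have "(\<integral>\<^sup>+x. ennreal (norm (indicator K x *\<^sub>R (norm (f x) powr p))) \<partial>lebesgue) < \<infinity>"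
    by (simp add: integrable_iff_bounded)
  moreover have "(\<integral>\<^sup>+x. ennreal (norm (indicator K x *\<^sub>R (norm (f x) powr p))) \<partial>lebesgue) =
      (\<integral>\<^sup>+x\<in>K. ennreal (norm (f' x) powr p) \<partial>lborel)"
    unfolding nn_integral_completion
    by (rule nn_integral_cong_AE) (use ae in \<open>eventually_elim, auto simp: indicator_def\<close>)
  ultimately show ?thesis by simp
qed

lemma L_loc_set_integrable_lborel:
  fixes f f' :: "real ^ 5 \<Rightarrow> 'b::euclidean_space"
  assumes L: "L_loc 1 G f" and ae: "AE x in lborel. f x = f' x" and [measurable]: "f' \<in> borel_measurable borel"
    and K: "compact K" "K \<subseteq> G"
  shows "set_integrable lborel K f'"
  unfolding set_integrable_def
proof (rule integrableI_bounded)
  have [measurable]: "K \<in> sets borel" using K(1) by (intro borel_closed compact_imp_closed)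
  show "(\<lambda>x. indicator K x *\<^sub>R f' x) \<in> borel_measurable lborel" by measurable
  have "(\<integral>\<^sup>+x. ennreal (norm (indicator K x *\<^sub>R f' x)) \<partial>lborel) = (\<integral>\<^sup>+x\<in>K. ennreal (norm (f' x) powr 1) \<partial>lborel)"
    by (intro nn_integral_cong) (auto simp: indicator_def)
  with L_loc_finite_lborel[OF L ae K] show "(\<integral>\<^sup>+x. ennreal (norm (indicator K x *\<^sub>R f' x)) \<partial>lborel) < \<infinity>" by simp
qed

text \<open>The left side is H_+^(3/2), and H_+ is at most twice the larger of u^2 / 2 and |p|. This
  places W^2 under the same Morrey bound as |U|^3 and |P|^(3/2).\<close>

lemma head_power_le:
  fixes u p :: real
  assumes "0 \<le> u"
  shows "(max (u\<^sup>2 / 2 + p) 0 powr (3/4))\<^sup>2 \<le> 4 * u ^ 3 + 4 * \<bar>p\<bar> powr (3/2)"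
proof -
  define H where "H = max (u\<^sup>2 / 2 + p) 0"
  have H0: "0 \<le> H" by (simp add: H_def)
  have "(H powr (3/4))\<^sup>2 = H powr (3/2)"
    by (simp add: power2_eq_square powr_add[symmetric])
  also have "\<dots> \<le> 4 * u ^ 3 + 4 * \<bar>p\<bar> powr (3/2)"
  proof (cases "\<bar>p\<bar> \<le> u\<^sup>2 / 2")
    case True
    then have "H \<le> u\<^sup>2" unfolding H_def by auto
    then have "H powr (3/2) \<le> (u\<^sup>2) powr (3/2)" using H0 by (intro powr_mono2) auto
    also have "(u\<^sup>2) powr (3/2) = u ^ 3"
    proof -
      have "(u\<^sup>2) powr (3/2) = (u powr 2) powr (3/2)" using assms by simp
      also have "\<dots> = u powr 3" unfolding powr_powr by simp
      finally show ?thesis using assms by simp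
    qed
    finally have "H powr (3/2) \<le> u ^ 3" .
    moreover have "0 \<le> u ^ 3" "0 \<le> \<bar>p\<bar> powr (3/2)" using assms by auto
    ultimately show ?thesis by linarith
  next
    case False
    then have "H \<le> 2 * \<bar>p\<bar>" unfolding H_def by auto
    then have "H powr (3/2) \<le> (2 * \<bar>p\<bar>) powr (3/2)" using H0 by (intro powr_mono2) auto
    also have "\<dots> = 2 powr (3/2) * \<bar>p\<bar> powr (3/2)" by (rule powr_mult) 
    also have "\<dots> \<le> 4 * \<bar>p\<bar> powr (3/2)"
    proof (rule mult_right_mono)
      have "(2::real) powr (3/2) \<le> 2 powr 2" by (rule powr_mono) auto
      then show "(2::real) powr (3/2) \<le> 4" by simp
    qed simp
    finally have "H powr (3/2) \<le> 4 * \<bar>p\<bar> powr (3/2)" .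
    moreover have "0 \<le> u ^ 3" using assms by simp
    ultimately show ?thesis by linarith
  qed
  finally show ?thesis unfolding H_def .
qed

lemma Morrey_bounds:
  assumes "Morrey U P < \<infinity>"
  obtains m where "0 \<le> m"
    "\<And>r. 0 < r \<Longrightarrow> (\<integral>\<^sup>+x\<in>ball 0 r. ennreal (norm (U x) ^ 3) \<partial>lborel) \<le> ennreal (m * r\<^sup>2)"
    "\<And>r. 0 < r \<Longrightarrow> (\<integral>\<^sup>+x\<in>ball 0 r. ennreal (\<bar>P x\<bar> powr (3/2)) \<partial>lborel) \<le> ennreal (m * r\<^sup>2)"
proof -
  obtain m where m: "0 \<le> m" "Morrey U P = ennreal m" using assms by (cases "Morrey U P") auto
  have scale: "X \<le> ennreal (m * r\<^sup>2)" if r: "0 < r" and X: "ennreal (1 / r\<^sup>2) * X \<le> ennreal m" for r X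
  proof -
    have "ennreal (r\<^sup>2) * (ennreal (1 / r\<^sup>2) * X) \<le> ennreal (r\<^sup>2) * ennreal m" by (rule mult_left_mono[OF X]) simp
    moreover have "ennreal (r\<^sup>2) * ennreal (1 / r\<^sup>2) = 1" using r by (subst ennreal_mult'[symmetric]) auto
    moreover have "ennreal (r\<^sup>2) * ennreal m = ennreal (m * r\<^sup>2)"
      using m(1) by (subst ennreal_mult'[symmetric]) (auto simp: mult.commute)
    ultimately show ?thesis by (simp add: mult.assoc[symmetric])
  qed
  have 1: "ennreal (1 / r\<^sup>2) * (\<integral>\<^sup>+x\<in>ball 0 r. ennreal (norm (U x) ^ 3) \<partial>lebesgue) \<le> ennreal m"
    and 2: "ennreal (1 / r\<^sup>2) * (\<integral>\<^sup>+x\<in>ball 0 r. ennreal (\<bar>P x\<bar> powr (3/2)) \<partial>lebesgue) \<le> ennreal m" if "0 < r" for r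
  proof -
    have r: "r \<in> {0<..}" using that by simp
    show "ennreal (1 / r\<^sup>2) * (\<integral>\<^sup>+x\<in>ball 0 r. ennreal (norm (U x) ^ 3) \<partial>lebesgue) \<le> ennreal m"
      unfolding m(2)[symmetric] Morrey_def by (rule order.trans[OF SUP_upper[OF r]]) simp
    show "ennreal (1 / r\<^sup>2) * (\<integral>\<^sup>+x\<in>ball 0 r. ennreal (\<bar>P x\<bar> powr (3/2)) \<partial>lebesgue) \<le> ennreal m"
      unfolding m(2)[symmetric] Morrey_def by (rule order.trans[OF SUP_upper[OF r]]) simp
  qed
  show thesis
    by (rule that[OF m(1)]) (use scale 1 2 in \<open>auto simp: nn_integral_completion\<close>)
qed

theorem proposition1p9:
  fixes U :: "real ^ 5 \<Rightarrow> real ^ 5" and P :: "real ^ 5 \<Rightarrow> real"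
  assumes "suitable_weak_solution UNIV U P"
    and "Morrey U P < \<infinity>"
    and "RHP (UNIV - {0}) U P"
  shows "AE x in lebesgue. head U P x \<le> 0"
proof -
  define W where "W = (\<lambda>x. max (head U P x) 0 powr (3/4))"
  define g where "g = weak_grad (UNIV - {0}) W"
  let ?G = "UNIV - {0 :: real ^ 5}"
  have H1: "H1_loc ?G W" and rhp: "\<And>\<phi>. test_fun ?G \<phi> \<Longrightarrow> (\<And>x. 0 \<le> \<phi> x) \<Longrightarrow>
      (LINT x:?G|lebesgue. 8/9 * (norm (g x))\<^sup>2 * \<phi> x) \<le>
      dist_div ?G (\<lambda>x. (4/3 * W x) *\<^sub>R g x - (2/3 * (W x)\<^sup>2) *\<^sub>R U x) \<phi>"
    using assms(3) unfolding RHP_def Let_def W_def g_def by auto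
  have "\<exists>g. is_weak_grad ?G W g \<and> L_loc 2 ?G g" using H1 by (simp add: H1_loc_def)
  \<comment> \<open>\<open>weak_grad\<close> is a choice; its specification is available because
    \<open>H1_loc\<close> provides a witness.\<close>
  from someI_ex[OF this] have wg: "is_weak_grad ?G W g" and g2: "L_loc 2 ?G g"
    by (auto simp: g_def weak_grad_def)
  have aeG: "AE x in lborel. x \<in> ?G" using AE_lborel_singleton[of 0] by eventually_elim simp
  have Um: "U \<in> borel_measurable lebesgue"
  proof (rule borel_measurable_vecI)
    fix i
    have "H1_loc UNIV (\<lambda>x. U x $ i)" using assms(1) by (simp add: suitable_weak_solution_def)
    then show "(\<lambda>x. U x $ i) \<in> borel_measurable lebesgue"
      by (simp add: H1_loc_def L_loc_def set_borel_measurable_def)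
  qed
  have Pm: "P \<in> borel_measurable lebesgue"
    using assms(1) by (simp add: suitable_weak_solution_def L_loc_def set_borel_measurable_def)
  have Wm: "W \<in> borel_measurable lebesgue"
    unfolding W_def head_def using Um Pm by measurable
  obtain U' where U': "U' \<in> borel_measurable borel" "AE x in lborel. U x = U' x"
    using borel_representative_vec[OF Um] .
  obtain W0 where W0: "W0 \<in> borel_measurable lborel" "AE x in lborel. W x = W0 x"
    using completion_ex_borel_measurable_real[OF Wm] by blast
  \<comment> \<open>\<open>head_system\<close> demands nonnegativity at every point, and a Borel
    representative of W has it only almost everywhere.\<close>
  define W' where "W' x = max 0 (W0 x)" for x
  have W': "W' \<in> borel_measurable borel" "AE x in lborel. W x = W' x" "\<And>x. 0 \<le> W' x"
  proof -
    show "W' \<in> borel_measurable borel" using W0(1) unfolding W'_def by simp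
    show "AE x in lborel. W x = W' x"
      using W0(2)
    proof eventually_elim
      case (elim x)
      have "0 \<le> W x" by (simp add: W_def)
      with elim show ?case by (simp add: W'_def)
    qed
    show "\<And>x. 0 \<le> W' x" by (simp add: W'_def)
  qed
  \<comment> \<open>The local spaces provide measurability of g only on the complement of the
    origin; the indicator alters g on a null set.\<close>
  have "(\<lambda>x. indicator ?G x *\<^sub>R g x) \<in> borel_measurable lebesgue"
    using g2 by (simp add: L_loc_def set_borel_measurable_def)
  then obtain g' where g': "g' \<in> borel_measurable borel" "AE x in lborel. indicator ?G x *\<^sub>R g x = g' x"
    using borel_representative_vec by blast
  have aeg: "AE x in lborel. g x = g' x"
    using g'(2) aeG by eventually_elim simp
  note [measurable] = U'(1) W'(1) g'(1)
  obtain m where m: "0 \<le> m"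
    "\<And>r. 0 < r \<Longrightarrow> (\<integral>\<^sup>+x\<in>ball 0 r. ennreal (norm (U x) ^ 3) \<partial>lborel) \<le> ennreal (m * r\<^sup>2)"
    "\<And>r. 0 < r \<Longrightarrow> (\<integral>\<^sup>+x\<in>ball 0 r. ennreal (\<bar>P x\<bar> powr (3/2)) \<partial>lborel) \<le> ennreal (m * r\<^sup>2)"
    using Morrey_bounds[OF assms(2)] by blast
  \<comment> \<open>8 = 4 + 4: \<open>head_power_le\<close> bounds W^2 by four times |U|^3 plus four
    times |P|^(3/2), and both have the growth constant m.\<close>
  have "head_system (8 * m) W' g' U'"
    unfolding head_system_def
  proof (intro conjI allI impI)
    show "0 \<le> 8 * m" using m by simp
    show "U' \<in> borel_measurable borel" by simp
    show "0 \<le> W' x" for x by (rule W'(3))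
    show "loc_weak_grad ?G W' g'"
      unfolding loc_weak_grad_def
    proof (intro conjI allI impI)
      show "set_integrable lborel K W'" "set_integrable lborel K g'" if "compact K \<and> K \<subseteq> ?G" for K
        using wg that L_loc_set_integrable_lborel[OF _ W'(2,1)] L_loc_set_integrable_lborel[OF _ aeg g'(1)]
        by (auto simp: is_weak_grad_def)
      fix i \<phi> assume \<phi>: "test_fun ?G \<phi>"
      note [measurable] = smooth_fun_measurable[OF test_fun_smooth[OF \<phi>]] grad_measurable[OF test_fun_smooth[OF \<phi>]]
      have "(LINT x:?G|lebesgue. W x * partial_deriv i \<phi> x) = (\<integral>x. W' x * partial_deriv i \<phi> x \<partial>lborel)"
        unfolding partial_deriv_eq_grad
        by (rule set_lebesgue_integral_eq_lborel) (measurable, use W'(2) aeG in eventually_elim, simp)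
      moreover have "(LINT x:?G|lebesgue. g x $ i * \<phi> x) = (\<integral>x. g' x $ i * \<phi> x \<partial>lborel)"
        by (rule set_lebesgue_integral_eq_lborel) (measurable, use aeg aeG in eventually_elim, simp)
      moreover have "- (LINT x:?G|lebesgue. W x * partial_deriv i \<phi> x) = (LINT x:?G|lebesgue. g x $ i * \<phi> x)"
        using wg \<phi> by (simp add: is_weak_grad_def dist_partial_def)
      ultimately show "(\<integral>x. W' x * partial_deriv i \<phi> x \<partial>lborel) = - (\<integral>x. g' x $ i * \<phi> x \<partial>lborel)" by simp
    qed simp_all
    show "(\<integral>\<^sup>+x\<in>shell p q. ennreal ((norm (g' x))\<^sup>2) \<partial>lborel) < \<infinity>" if "0 < p" for p q
      using L_loc_finite_lborel[OF g2 aeg compact_shell shell_avoids_0[OF that], of q] by simp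
    show "(\<integral>\<^sup>+x\<in>ball 0 r. ennreal (norm (U' x) ^ 3) \<partial>lborel) \<le> ennreal (8 * m * r\<^sup>2)" if "0 < r" for r
    proof -
      have "(\<integral>\<^sup>+x\<in>ball 0 r. ennreal (norm (U' x) ^ 3) \<partial>lborel) = (\<integral>\<^sup>+x\<in>ball 0 r. ennreal (norm (U x) ^ 3) \<partial>lborel)"
        by (rule nn_integral_cong_AE) (use U'(2) in eventually_elim, simp)
      also have "\<dots> \<le> ennreal (m * r\<^sup>2)" by (rule m(2)[OF that])
      also have "\<dots> \<le> ennreal (8 * m * r\<^sup>2)" using m(1) by (intro ennreal_leI mult_right_mono) auto
      finally show ?thesis .
    qed
    show "(\<integral>\<^sup>+x\<in>ball 0 r. ennreal ((W' x)\<^sup>2) \<partial>lborel) \<le> ennreal (8 * m * r\<^sup>2)" if r: "0 < r" for r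
    proof -
      have "(\<integral>\<^sup>+x\<in>ball 0 r. ennreal ((W' x)\<^sup>2) \<partial>lborel) \<le>
        (\<integral>\<^sup>+x. 4 * (ennreal (norm (U x) ^ 3) * indicator (ball 0 r) x) + 4 * (ennreal (\<bar>P x\<bar> powr (3/2)) * indicator (ball 0 r) x) \<partial>lborel)"
      proof (rule nn_integral_mono_AE)
        show "AE x in lborel. ennreal ((W' x)\<^sup>2) * indicator (ball 0 r) x \<le>
          4 * (ennreal (norm (U x) ^ 3) * indicator (ball 0 r) x) + 4 * (ennreal (\<bar>P x\<bar> powr (3/2)) * indicator (ball 0 r) x)"
          using W'(2)
        proof eventually_elim
          case (elim x)
          have "(W' x)\<^sup>2 \<le> 4 * norm (U x) ^ 3 + 4 * \<bar>P x\<bar> powr (3/2)"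
            unfolding elim[symmetric] W_def head_def by (rule head_power_le) simp
          then have "ennreal ((W' x)\<^sup>2) \<le> ennreal (4 * norm (U x) ^ 3 + 4 * \<bar>P x\<bar> powr (3/2))" by (rule ennreal_leI)
          also have "\<dots> = 4 * ennreal (norm (U x) ^ 3) + 4 * ennreal (\<bar>P x\<bar> powr (3/2))"
            by (simp add: ennreal_mult')
          finally show ?case by (cases "x \<in> ball 0 r") simp_all
        qed
      qed
      also have "\<dots> = (\<integral>\<^sup>+x. 4 * (ennreal (norm (U x) ^ 3) * indicator (ball 0 r) x) + 4 * (ennreal (\<bar>P x\<bar> powr (3/2)) * indicator (ball 0 r) x) \<partial>lebesgue)"
        by (simp add: nn_integral_completion)
      also have "\<dots> = 4 * (\<integral>\<^sup>+x\<in>ball 0 r. ennreal (norm (U x) ^ 3) \<partial>lebesgue) + 4 * (\<integral>\<^sup>+x\<in>ball 0 r. ennreal (\<bar>P x\<bar> powr (3/2)) \<partial>lebesgue)"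
      proof -
        note [measurable] = Um Pm fmeasurableD[OF lmeasurable_ball[of 0 r]]
        have "(\<lambda>x. ennreal (norm (U x) ^ 3) * indicator (ball 0 r) x) \<in> borel_measurable lebesgue"
          "(\<lambda>x. ennreal (\<bar>P x\<bar> powr (3/2)) * indicator (ball 0 r) x) \<in> borel_measurable lebesgue" by measurable
        then show ?thesis by (simp add: nn_integral_add nn_integral_cmult)
      qed
      also have "\<dots> \<le> 4 * ennreal (m * r\<^sup>2) + 4 * ennreal (m * r\<^sup>2)"
        unfolding nn_integral_completion by (intro add_mono mult_left_mono m r) auto
      also have "\<dots> = ennreal (8 * m * r\<^sup>2)"
      proof -
        have "4 * ennreal (m * r\<^sup>2) = ennreal (4 * (m * r\<^sup>2))" by (subst ennreal_mult') auto
        then show ?thesis using m(1) by (simp add: ennreal_plus[symmetric] del: ennreal_plus)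
      qed
      finally show ?thesis .
    qed
    show "8/9 * (\<integral>x. (norm (g' x))\<^sup>2 * \<phi> x \<partial>lborel) \<le> - (\<integral>x. head_flux W' g' U' x \<bullet> grad \<phi> x \<partial>lborel)"
      if \<phi>: "test_fun ?G \<phi> \<and> (\<forall>x. 0 \<le> \<phi> x)" for \<phi>
    proof -
      note [measurable] = smooth_fun_measurable[OF test_fun_smooth[OF conjunct1[OF \<phi>]]]
        grad_measurable[OF test_fun_smooth[OF conjunct1[OF \<phi>]]]
      have fm: "(\<lambda>x. head_flux W' g' U' x \<bullet> grad \<phi> x) \<in> borel_measurable borel"
        unfolding head_flux_def by measurable
      have "(LINT x:?G|lebesgue. 8/9 * (norm (g x))\<^sup>2 * \<phi> x) = (\<integral>x. 8/9 * ((norm (g' x))\<^sup>2 * \<phi> x) \<partial>lborel)"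
        by (rule set_lebesgue_integral_eq_lborel) (measurable, use aeg aeG in eventually_elim, simp)
      moreover have "(LINT x:?G|lebesgue. ((4/3 * W x) *\<^sub>R g x - (2/3 * (W x)\<^sup>2) *\<^sub>R U x) \<bullet> grad \<phi> x) =
          (\<integral>x. head_flux W' g' U' x \<bullet> grad \<phi> x \<partial>lborel)"
        by (rule set_lebesgue_integral_eq_lborel[OF fm]) (use aeg aeG W'(2) U'(2) in eventually_elim, simp add: head_flux_def)
      ultimately show ?thesis using rhp[of \<phi>] \<phi> by (simp add: dist_div_def)
    qed
    show "(\<integral>x. U' x \<bullet> grad \<phi> x \<partial>lborel) = 0" if \<phi>: "test_fun UNIV \<phi>" for \<phi>
    proof -
      note [measurable] = grad_measurable[OF test_fun_smooth[OF \<phi>]]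
      have "(LINT x:UNIV|lebesgue. U x \<bullet> grad \<phi> x) = (\<integral>x. U' x \<bullet> grad \<phi> x \<partial>lborel)"
        by (rule set_lebesgue_integral_eq_lborel) (measurable, use U'(2) in eventually_elim, simp)
      moreover have "dist_div UNIV U \<phi> = 0" using assms(1) \<phi> by (simp add: suitable_weak_solution_def)
      ultimately show ?thesis by (simp add: dist_div_def)
    qed
  qed
  then have "AE x in lborel. W' x = 0" by (rule head_system_trivial)
  then have "AE x in lborel. head U P x \<le> 0"
    using W'(2)
  proof eventually_elim
    case (elim x)
    then have "max (head U P x) 0 powr (3/4) = 0" by (simp add: W_def)
    then have "max (head U P x) 0 = 0" by simp
    then show ?case by simp
  qed
  then show ?thesis by (rule AE_completion)
qed

end
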